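(* Over primitive recursive set theory extended by the axiom of dependent choice, the following two axiom schemas are equivalent (each schema proves every instance of the other): (1) Reflection for first order formulas with real parameters: for every formula $\psi(x)$ of first order set theory with a single free variable $x$ and no parameters, $$\forall_{r\subseteq\omega}\big(\psi(r)\to\exists_N(\text{$N$ is a transitive set}\land\psi(r)^N)\big).$$ (2) Induction over $\Delta(\mathbb R)$-definable well-founded classes: for every $\Sigma$-formula $\theta_\Sigma(x,y,r)$, every $\Pi$-formula $\theta_\Pi(x,y,r)$ and every formula $\varphi(x,\vec z)$ of set theory, $$\forall_{r\subseteq\omega}\big(\operatorname{\Delta\text{-}Rel}[X^r]\land\operatorname{WF}[X^r]\to\operatorname{Ind}[X^r,\varphi]\big).$$
   Context: Primitive recursive set theory (with infinity) consists of extensionality, regularity and infinity, together with axioms stating that the primitive recursive set functions of Jensen and Karp (where $\omega$ is admitted as a parameter) are total and satisfy their defining equations. $\psi(r)^N$ denotes the relativization of $\psi(r)$ to $N$ (all quantifiers bounded to $N$). Formulas are in negation normal form. A quantifier is bounded if it has the form $\forall_{x\in y}$ or $\exists_{x\in y}$ with $y$ a set variable or parameter; a $\Sigma$-formula (resp. $\Pi$-formula) is a negation-normal-form formula in which all universal (resp. existential) quantifiers are bounded. Given $\theta_\Sigma,\theta_\Pi$ and $r$, write $x\leq_X^r y:\equiv\theta_\Sigma(x,y,r)$, $x\in X^r:\equiv x\leq^r_X x$, and $x<^r_X y:\equiv x\leq^r_X y\land x\neq y$. Then $\operatorname{\Delta\text{-}Rel}[X^r]:\equiv\forall_{x,y}(x\leq_X^r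 y\to x\in X^r\land y\in X^r)\land\forall_{x,y}(\theta_\Sigma(x,y,r)\leftrightarrow\theta_\Pi(x,y,r))$; $\operatorname{WF}[X^r]:\equiv\forall_w(w\neq\emptyset\to\exists_{x\in w}\forall_{y\in w}\neg\,y<^r_X x)$ (with $w$ ranging over sets); $\operatorname{Ind}[X^r,\varphi]:\equiv\forall_{\vec z}\big(\forall_{x\in X^r}(\forall_{y<^r_X x}\varphi(y,\vec z)\to\varphi(x,\vec z))\to\forall_{x\in X^r}\varphi(x,\vec z)\big)$, with no restriction on the parameters $\vec z$. The class $X^r$ need not be set-like. *)

theory Defs
  imports Main
begin

section \<open>Function symbols\<close>

text \<open>
  Descriptions of the primitive recursive set functions, with \<open>\<omega>\<close> as a parameter:
    \<^item> \<open>Zero\<close>: the constant \<open>\<emptyset>\<close>;  \<open>Omega\<close>: the constant \<open>\<omega>\<close>;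
    \<^item> \<open>Proj n i\<close>: \<open>(x\<^sub>0,\<dots>,x\<^sub>n\<^sub>-\<^sub>1) \<mapsto> x\<^sub>i\<close>;
    \<^item> \<open>Adj\<close>: \<open>(x,y) \<mapsto> x \<union> {y}\<close>;
    \<^item> \<open>Cond\<close>: \<open>(x,y,u,v) \<mapsto> x\<close> if \<open>u \<in> v\<close>, and \<open>y\<close> otherwise;
    \<^item> \<open>Comp n g hs\<close>: \<open>n\<close>-ary composition \<open>x \<mapsto> g (h\<^sub>1 x, \<dots>, h\<^sub>m x)\<close>;
    \<^item> \<open>Rec g\<close>: the function with \<open>F (z, x) = g (\<Union>{F (u, x) | u \<in> z}, z, x)\<close>.
\<close>

datatype psf =
    Zero
  | Omega
  | Proj nat nat
  | Adj
  | Cond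
  | Comp nat psf "psf list"
  | Rec psf

primrec arity :: "psf \<Rightarrow> nat" where
  "arity Zero = 0"
| "arity Omega = 0"
| "arity (Proj n i) = n"
| "arity Adj = 2"
| "arity Cond = 4"
| "arity (Comp n g hs) = n"
| "arity (Rec g) = arity g - 1"

primrec wf_psf :: "psf \<Rightarrow> bool" where
  "wf_psf Zero \<longleftrightarrow> True"
| "wf_psf Omega \<longleftrightarrow> True"
| "wf_psf (Proj n i) \<longleftrightarrow> i < n"
| "wf_psf Adj \<longleftrightarrow> True"
| "wf_psf Cond \<longleftrightarrow> True"
| "wf_psf (Comp n g hs) \<longleftrightarrow>
     wf_psf g \<and> length hs = arity g \<and> list_all wf_psf hs \<and> list_all (\<lambda>h. arity h = n) hs"
| "wf_psf (Rec g) \<longleftrightarrow> wf_psf g \<and> 2 \<le> arity g"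


section \<open>Terms and formulas in negation normal form\<close>

text \<open>Variables are de Bruijn indices: \<open>Var 0\<close> refers to the innermost quantifier.\<close>

datatype trm = Var nat | Fn psf "trm list"

datatype fm =
    Mem trm trm
  | NMem trm trm
  | Eq trm trm
  | NEq trm trm
  | And fm fm
  | Or fm fm
  | All fm
  | Ex fm

primrec wf_trm :: "trm \<Rightarrow> bool" where
  "wf_trm (Var i) \<longleftrightarrow> True"
| "wf_trm (Fn f ts) \<longleftrightarrow> wf_psf f \<and> length ts = arity f \<and> list_all wf_trm ts"

primrec wf_fm :: "fm \<Rightarrow> bool" where
  "wf_fm (Mem s t) \<longleftrightarrow> wf_trm s \<and> wf_trm t"
| "wf_fm (NMem s t) \<longleftrightarrow> wf_trm s \<and> wf_trm t"
| "wf_fm (Eq s t) \<longleftrightarrow> wf_trm s \<and> wf_trm t"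
| "wf_fm (NEq s t) \<longleftrightarrow> wf_trm s \<and> wf_trm t"
| "wf_fm (And \<phi> \<psi>) \<longleftrightarrow> wf_fm \<phi> \<and> wf_fm \<psi>"
| "wf_fm (Or \<phi> \<psi>) \<longleftrightarrow> wf_fm \<phi> \<and> wf_fm \<psi>"
| "wf_fm (All \<phi>) \<longleftrightarrow> wf_fm \<phi>"
| "wf_fm (Ex \<phi>) \<longleftrightarrow> wf_fm \<phi>"

primrec fv_trm :: "trm \<Rightarrow> nat set" where
  "fv_trm (Var i) = {i}"
| "fv_trm (Fn f ts) = \<Union> (set (map fv_trm ts))"

primrec fv :: "fm \<Rightarrow> nat set" where
  "fv (Mem s t) = fv_trm s \<union> fv_trm t"
| "fv (NMem s t) = fv_trm s \<union> fv_trm t"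
| "fv (Eq s t) = fv_trm s \<union> fv_trm t"
| "fv (NEq s t) = fv_trm s \<union> fv_trm t"
| "fv (And \<phi> \<psi>) = fv \<phi> \<union> fv \<psi>"
| "fv (Or \<phi> \<psi>) = fv \<phi> \<union> fv \<psi>"
| "fv (All \<phi>) = {i. Suc i \<in> fv \<phi>}"
| "fv (Ex \<phi>) = {i. Suc i \<in> fv \<phi>}"

text \<open>Formulas of first order set theory, i.e. without primitive recursive function symbols.\<close>

primrec is_Var :: "trm \<Rightarrow> bool" where
  "is_Var (Var i) \<longleftrightarrow> True"
| "is_Var (Fn f ts) \<longleftrightarrow> False"

primrec set_fm :: "fm \<Rightarrow> bool" where
  "set_fm (Mem s t) \<longleftrightarrow> is_Var s \<and> is_Var t"
| "set_fm (NMem s t) \<longleftrightarrow> is_Var s \<and> is_Var t"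
| "set_fm (Eq s t) \<longleftrightarrow> is_Var s \<and> is_Var t"
| "set_fm (NEq s t) \<longleftrightarrow> is_Var s \<and> is_Var t"
| "set_fm (And \<phi> \<psi>) \<longleftrightarrow> set_fm \<phi> \<and> set_fm \<psi>"
| "set_fm (Or \<phi> \<psi>) \<longleftrightarrow> set_fm \<phi> \<and> set_fm \<psi>"
| "set_fm (All \<phi>) \<longleftrightarrow> set_fm \<phi>"
| "set_fm (Ex \<phi>) \<longleftrightarrow> set_fm \<phi>"

primrec sb_trm :: "(nat \<Rightarrow> trm) \<Rightarrow> trm \<Rightarrow> trm" where
  "sb_trm \<sigma> (Var i) = \<sigma> i"
| "sb_trm \<sigma> (Fn f ts) = Fn f (map (sb_trm \<sigma>) ts)"

definition lift_trm :: "trm \<Rightarrow> trm" where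
  "lift_trm = sb_trm (\<lambda>i. Var (Suc i))"

definition up :: "(nat \<Rightarrow> trm) \<Rightarrow> nat \<Rightarrow> trm" where
  "up \<sigma> i = (case i of 0 \<Rightarrow> Var 0 | Suc j \<Rightarrow> lift_trm (\<sigma> j))"

primrec sb :: "(nat \<Rightarrow> trm) \<Rightarrow> fm \<Rightarrow> fm" where
  "sb \<sigma> (Mem s t) = Mem (sb_trm \<sigma> s) (sb_trm \<sigma> t)"
| "sb \<sigma> (NMem s t) = NMem (sb_trm \<sigma> s) (sb_trm \<sigma> t)"
| "sb \<sigma> (Eq s t) = Eq (sb_trm \<sigma> s) (sb_trm \<sigma> t)"
| "sb \<sigma> (NEq s t) = NEq (sb_trm \<sigma> s) (sb_trm \<sigma> t)"
| "sb \<sigma> (And \<phi> \<psi>) = And (sb \<sigma> \<phi>) (sb \<sigma> \<psi>)"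
| "sb \<sigma> (Or \<phi> \<psi>) = Or (sb \<sigma> \<phi>) (sb \<sigma> \<psi>)"
| "sb \<sigma> (All \<phi>) = All (sb (up \<sigma>) \<phi>)"
| "sb \<sigma> (Ex \<phi>) = Ex (sb (up \<sigma>) \<phi>)"

definition lift :: "fm \<Rightarrow> fm" where
  "lift = sb (\<lambda>i. Var (Suc i))"

text \<open>
  \<open>inst \<phi> [t\<^sub>0,\<dots>,t\<^sub>n\<^sub>-\<^sub>1]\<close> is \<open>\<phi>(t\<^sub>0,\<dots>,t\<^sub>n\<^sub>-\<^sub>1)\<close>, with \<open>t\<^sub>i\<close> in place of the free variable
  \<open>Var i\<close>. The remaining free variables move down by \<open>n\<close>.
\<close>

definition inst :: "fm \<Rightarrow> trm list \<Rightarrow> fm" where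
  "inst \<phi> ts = sb (\<lambda>i. if i < length ts then ts ! i else Var (i - length ts)) \<phi>"

primrec neg :: "fm \<Rightarrow> fm" where
  "neg (Mem s t) = NMem s t"
| "neg (NMem s t) = Mem s t"
| "neg (Eq s t) = NEq s t"
| "neg (NEq s t) = Eq s t"
| "neg (And \<phi> \<psi>) = Or (neg \<phi>) (neg \<psi>)"
| "neg (Or \<phi> \<psi>) = And (neg \<phi>) (neg \<psi>)"
| "neg (All \<phi>) = Ex (neg \<phi>)"
| "neg (Ex \<phi>) = All (neg \<phi>)"

definition Imp :: "fm \<Rightarrow> fm \<Rightarrow> fm" where
  "Imp \<phi> \<psi> = Or (neg \<phi>) \<psi>"

definition Iff :: "fm \<Rightarrow> fm \<Rightarrow> fm" where
  "Iff \<phi> \<psi> = And (Imp \<phi> \<psi>) (Imp \<psi> \<phi>)"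

definition Alls :: "nat \<Rightarrow> fm \<Rightarrow> fm" where
  "Alls n \<phi> = (All ^^ n) \<phi>"

text \<open>The bound \<open>t\<close> of a bounded quantifier lives outside the scope of that quantifier.\<close>

definition BAll :: "trm \<Rightarrow> fm \<Rightarrow> fm" where
  "BAll t \<phi> = All (Or (NMem (Var 0) (lift_trm t)) \<phi>)"

definition BEx :: "trm \<Rightarrow> fm \<Rightarrow> fm" where
  "BEx t \<phi> = Ex (And (Mem (Var 0) (lift_trm t)) \<phi>)"

inductive sigma_fm :: "fm \<Rightarrow> bool" where
  "sigma_fm (Mem (Var i) (Var j))"
| "sigma_fm (NMem (Var i) (Var j))"
| "sigma_fm (Eq (Var i) (Var j))"
| "sigma_fm (NEq (Var i) (Var j))"
| "sigma_fm \<phi> \<Longrightarrow> sigma_fm \<psi> \<Longrightarrow> sigma_fm (And \<phi> \<psi>)"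
| "sigma_fm \<phi> \<Longrightarrow> sigma_fm \<psi> \<Longrightarrow> sigma_fm (Or \<phi> \<psi>)"
| "sigma_fm \<phi> \<Longrightarrow> sigma_fm (BAll (Var i) \<phi>)"
| "sigma_fm \<phi> \<Longrightarrow> sigma_fm (Ex \<phi>)"

inductive pi_fm :: "fm \<Rightarrow> bool" where
  "pi_fm (Mem (Var i) (Var j))"
| "pi_fm (NMem (Var i) (Var j))"
| "pi_fm (Eq (Var i) (Var j))"
| "pi_fm (NEq (Var i) (Var j))"
| "pi_fm \<phi> \<Longrightarrow> pi_fm \<psi> \<Longrightarrow> pi_fm (And \<phi> \<psi>)"
| "pi_fm \<phi> \<Longrightarrow> pi_fm \<psi> \<Longrightarrow> pi_fm (Or \<phi> \<psi>)"
| "pi_fm \<phi> \<Longrightarrow> pi_fm (All \<phi>)"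
| "pi_fm \<phi> \<Longrightarrow> pi_fm (BEx (Var i) \<phi>)"

text \<open>Relativization of all quantifiers to (the value of) a term.\<close>

primrec rel :: "trm \<Rightarrow> fm \<Rightarrow> fm" where
  "rel N (Mem s t) = Mem s t"
| "rel N (NMem s t) = NMem s t"
| "rel N (Eq s t) = Eq s t"
| "rel N (NEq s t) = NEq s t"
| "rel N (And \<phi> \<psi>) = And (rel N \<phi>) (rel N \<psi>)"
| "rel N (Or \<phi> \<psi>) = Or (rel N \<phi>) (rel N \<psi>)"
| "rel N (All \<phi>) = BAll N (rel (lift_trm N) \<phi>)"
| "rel N (Ex \<phi>) = BEx N (rel (lift_trm N) \<phi>)"


section \<open>Provability\<close>

text \<open>
  A one-sided sequent calculus for classical first order logic with equality. Sequents are read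
  disjunctively, and the members of \<open>T\<close> (sentences in all applications) serve as axioms.
\<close>

inductive derivable :: "fm set \<Rightarrow> fm list \<Rightarrow> bool" for T :: "fm set" where
  Ax: "\<phi> \<in> T \<Longrightarrow> derivable T [\<phi>]"
| Id: "wf_fm \<phi> \<Longrightarrow> derivable T [\<phi>, neg \<phi>]"
| Refl: "wf_trm t \<Longrightarrow> derivable T [Eq t t]"
| Repl: "wf_trm s \<Longrightarrow> wf_trm t \<Longrightarrow> wf_fm \<phi> \<Longrightarrow>
    derivable T [NEq s t, neg (inst \<phi> [s]), inst \<phi> [t]]"
| AndI: "derivable T (\<phi> # \<Gamma>) \<Longrightarrow> derivable T (\<psi> # \<Gamma>) \<Longrightarrow> derivable T (And \<phi> \<psi> # \<Gamma>)"
| OrI: "derivable T (\<phi> # \<psi> # \<Gamma>) \<Longrightarrow> derivable T (Or \<phi> \<psi> # \<Gamma>)"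
| AllI: "derivable T (\<phi> # map lift \<Gamma>) \<Longrightarrow> derivable T (All \<phi> # \<Gamma>)"
| ExI: "wf_trm t \<Longrightarrow> derivable T (inst \<phi> [t] # \<Gamma>) \<Longrightarrow> derivable T (Ex \<phi> # \<Gamma>)"
| Cut: "derivable T (\<phi> # \<Gamma>) \<Longrightarrow> derivable T (neg \<phi> # \<Gamma>) \<Longrightarrow> derivable T \<Gamma>"
| Weak: "derivable T \<Gamma> \<Longrightarrow> set \<Gamma> \<subseteq> set \<Delta> \<Longrightarrow> list_all wf_fm \<Delta> \<Longrightarrow> derivable T \<Delta>"

definition proves :: "fm set \<Rightarrow> fm \<Rightarrow> bool" (infix "\<turnstile>" 50) where
  "T \<turnstile> \<phi> \<longleftrightarrow> derivable T [\<phi>]"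


section \<open>Primitive recursive set theory with infinity\<close>

abbreviation zero :: trm where "zero \<equiv> Fn Zero []"

abbreviation omega :: trm where "omega \<equiv> Fn Omega []"

abbreviation adj :: "trm \<Rightarrow> trm \<Rightarrow> trm" where "adj s t \<equiv> Fn Adj [s, t]"

abbreviation succ :: "trm \<Rightarrow> trm" where "succ t \<equiv> adj t t"

abbreviation upair :: "trm \<Rightarrow> trm \<Rightarrow> trm" where "upair s t \<equiv> adj (adj zero s) t"

text \<open>Kuratowski pairs.\<close>

abbreviation pair :: "trm \<Rightarrow> trm \<Rightarrow> trm" where "pair s t \<equiv> upair (upair s s) (upair s t)"

definition Subset :: "trm \<Rightarrow> trm \<Rightarrow> fm" where
  "Subset s t = BAll s (Mem (Var 0) (lift_trm t))"

definition Transitive :: "trm \<Rightarrow> fm" where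
  "Transitive t = BAll t (Subset (Var 0) (lift_trm t))"

definition Inductive :: "trm \<Rightarrow> fm" where
  "Inductive t = And (Mem zero t) (BAll t (Mem (succ (Var 0)) (lift_trm t)))"

definition extensionality :: fm where
  "extensionality =
     All (All (Imp (All (Iff (Mem (Var 0) (Var 2)) (Mem (Var 0) (Var 1)))) (Eq (Var 1) (Var 0))))"

definition regularity :: fm where
  "regularity =
     All (Imp (NEq (Var 0) zero) (BEx (Var 0) (BAll (Var 1) (NMem (Var 0) (Var 1)))))"

definition infinity :: fm where
  "infinity = Ex (Inductive (Var 0))"

text \<open>
  Universal closures of the defining equations. Totality is built into the use of function symbols,
  except that in the case of \<open>F = Rec g\<close> the existence of \<open>w = \<Union>{F (u, x) | u \<in> z}\<close> has to be
  asserted.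
\<close>

primrec defining_axiom :: "psf \<Rightarrow> fm" where
  "defining_axiom Zero = All (NMem (Var 0) zero)"
| "defining_axiom Omega =
     And (Inductive omega) (All (Imp (Inductive (Var 0)) (Subset omega (Var 0))))"
| "defining_axiom (Proj n i) = Alls n (Eq (Fn (Proj n i) (map Var [0..<n])) (Var i))"
| "defining_axiom Adj =
     Alls 3 (Iff (Mem (Var 2) (adj (Var 0) (Var 1))) (Or (Mem (Var 2) (Var 0)) (Eq (Var 2) (Var 1))))"
| "defining_axiom Cond =
     Alls 4 (And
       (Imp (Mem (Var 2) (Var 3)) (Eq (Fn Cond [Var 0, Var 1, Var 2, Var 3]) (Var 0)))
       (Imp (NMem (Var 2) (Var 3)) (Eq (Fn Cond [Var 0, Var 1, Var 2, Var 3]) (Var 1))))"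
| "defining_axiom (Comp n g hs) =
     Alls n (Eq (Fn (Comp n g hs) (map Var [0..<n])) (Fn g (map (\<lambda>h. Fn h (map Var [0..<n])) hs)))"
| "defining_axiom (Rec g) =
     (let F = Rec g; n = arity F in
      Alls n (Ex (And
        (All (Iff (Mem (Var 0) (Var 1))
                  (BEx (Var 2) (Mem (Var 1) (Fn F (Var 0 # map Var [4..<n + 3]))))))
        (Eq (Fn F (map Var [1..<n + 1])) (Fn g (map Var [0..<n + 1]))))))"

definition PRS :: "fm set" where
  "PRS = {extensionality, regularity, infinity} \<union> {defining_axiom f | f. wf_psf f}"

text \<open>\<open>f\<close> is a function from \<open>D\<close> to \<open>A\<close>.\<close>

definition Function_to :: "trm \<Rightarrow> trm \<Rightarrow> trm \<Rightarrow> fm" where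
  "Function_to f D A =
     (let up1 = lift_trm; up2 = lift_trm \<circ> lift_trm; up3 = lift_trm \<circ> lift_trm \<circ> lift_trm in
      And (BAll f (BEx (up1 D) (BEx (up2 A) (Eq (Var 2) (pair (Var 1) (Var 0))))))
     (And (BAll D (BEx (up1 A) (Mem (pair (Var 1) (Var 0)) (up2 f))))
          (BAll D (BAll (up1 A) (BAll (up2 A)
            (Imp (And (Mem (pair (Var 2) (Var 1)) (up3 f)) (Mem (pair (Var 2) (Var 0)) (up3 f)))
                 (Eq (Var 1) (Var 0))))))))"

text \<open>
  For \<open>A \<noteq> \<emptyset>\<close> (\<open>Var 1\<close>) and \<open>R\<close> (\<open>Var 0\<close>) such that \<open>\<forall>x\<in>A. \<exists>y\<in>A. (x,y) \<in> R\<close>, there is a function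
  \<open>f : \<omega> \<rightarrow> A\<close> with \<open>(f n, f (n+1)) \<in> R\<close> for all \<open>n \<in> \<omega>\<close>.
\<close>

definition dependent_choice :: fm where
  "dependent_choice =
     All (All (Imp
       (And (NEq (Var 1) zero)
            (BAll (Var 1) (BEx (Var 2) (Mem (pair (Var 1) (Var 0)) (Var 2)))))
       (Ex (And (Function_to (Var 0) omega (Var 2))
                (BAll omega (BAll (Var 3) (BAll (Var 4)
                  (Imp (And (Mem (pair (Var 2) (Var 1)) (Var 3))
                            (Mem (pair (succ (Var 2)) (Var 0)) (Var 3)))
                       (Mem (pair (Var 1) (Var 0)) (Var 4))))))))))"

definition PRS_DC :: "fm set" where
  "PRS_DC = insert dependent_choice PRS"


section \<open>Reflection\<close>

definition reflection :: "fm \<Rightarrow> fm" where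
  "reflection \<psi> =
     All (Imp (Subset (Var 0) omega)
       (Imp (inst \<psi> [Var 0])
            (Ex (And (Transitive (Var 0)) (rel (Var 0) (inst \<psi> [Var 1]))))))"

definition Reflection :: "fm set" where
  "Reflection = {reflection \<psi> | \<psi>. set_fm \<psi> \<and> fv \<psi> \<subseteq> {0}}"


section \<open>Induction over well-founded classes\<close>

text \<open>
  In the formulas \<open>\<theta>(x, y, r)\<close>, the arguments \<open>x\<close>, \<open>y\<close>, \<open>r\<close> are \<open>Var 0\<close>, \<open>Var 1\<close>, \<open>Var 2\<close>.
  In \<open>\<phi>(x, z\<^sub>1, \<dots>, z\<^sub>k)\<close>, the argument \<open>x\<close> is \<open>Var 0\<close> and \<open>z\<^sub>i\<close> is \<open>Var i\<close>.
\<close>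

definition le_X :: "fm \<Rightarrow> trm \<Rightarrow> trm \<Rightarrow> trm \<Rightarrow> fm" where
  "le_X \<theta> r x y = inst \<theta> [x, y, r]"

definition in_X :: "fm \<Rightarrow> trm \<Rightarrow> trm \<Rightarrow> fm" where
  "in_X \<theta> r x = le_X \<theta> r x x"

definition less_X :: "fm \<Rightarrow> trm \<Rightarrow> trm \<Rightarrow> trm \<Rightarrow> fm" where
  "less_X \<theta> r x y = And (le_X \<theta> r x y) (NEq x y)"

text \<open>In the following three formulas, the parameter \<open>r\<close> is the free variable \<open>Var 0\<close>.\<close>

definition Delta_Rel :: "fm \<Rightarrow> fm \<Rightarrow> fm" where
  "Delta_Rel \<theta>\<^sub>\<Sigma> \<theta>\<^sub>\<Pi> =
     And (All (All (Imp (le_X \<theta>\<^sub>\<Sigma> (Var 2) (Var 1) (Var 0))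
                        (And (in_X \<theta>\<^sub>\<Sigma> (Var 2) (Var 1)) (in_X \<theta>\<^sub>\<Sigma> (Var 2) (Var 0))))))
         (All (All (Iff (inst \<theta>\<^sub>\<Sigma> [Var 1, Var 0, Var 2]) (inst \<theta>\<^sub>\<Pi> [Var 1, Var 0, Var 2]))))"

definition WF :: "fm \<Rightarrow> fm" where
  "WF \<theta> =
     All (Imp (NEq (Var 0) zero)
              (BEx (Var 0) (BAll (Var 1) (neg (less_X \<theta> (Var 3) (Var 0) (Var 1))))))"

text \<open>Inside the \<open>k\<close> quantifiers over \<open>z\<^sub>1, \<dots>, z\<^sub>k\<close>, the parameter \<open>r\<close> is \<open>Var k\<close>.\<close>

definition Ind :: "fm \<Rightarrow> nat \<Rightarrow> fm \<Rightarrow> fm" where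
  "Ind \<theta> k \<phi> =
     Alls k (Imp
       (All (Imp (in_X \<theta> (Var (k + 1)) (Var 0))
          (Imp (All (Imp (less_X \<theta> (Var (k + 2)) (Var 0) (Var 1))
                         (inst \<phi> (Var 0 # map Var [2..<k + 2]))))
               (inst \<phi> (Var 0 # map Var [1..<k + 1])))))
       (All (Imp (in_X \<theta> (Var (k + 1)) (Var 0))
                 (inst \<phi> (Var 0 # map Var [1..<k + 1])))))"

definition class_induction :: "fm \<Rightarrow> fm \<Rightarrow> nat \<Rightarrow> fm \<Rightarrow> fm" where
  "class_induction \<theta>\<^sub>\<Sigma> \<theta>\<^sub>\<Pi> k \<phi> =
     All (Imp (Subset (Var 0) omega)
              (Imp (And (Delta_Rel \<theta>\<^sub>\<Sigma> \<theta>\<^sub>\<Pi>) (WF \<theta>\<^sub>\<Sigma>)) (Ind \<theta>\<^sub>\<Sigma> k \<phi>)))"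

definition Class_Induction :: "fm set" where
  "Class_Induction = {class_induction \<theta>\<^sub>\<Sigma> \<theta>\<^sub>\<Pi> k \<phi> | \<theta>\<^sub>\<Sigma> \<theta>\<^sub>\<Pi> k \<phi>.
     sigma_fm \<theta>\<^sub>\<Sigma> \<and> fv \<theta>\<^sub>\<Sigma> \<subseteq> {0, 1, 2} \<and>
     pi_fm \<theta>\<^sub>\<Pi> \<and> fv \<theta>\<^sub>\<Pi> \<subseteq> {0, 1, 2} \<and>
     set_fm \<phi> \<and> fv \<phi> \<subseteq> {0..k}}"

end

theory Submission
  imports Defs "HOL-Library.Countable_Set" "HOL-Library.Omega_Words_Fun"
begin

text \<open>
  By completeness it suffices to argue in an arbitrary model of primitive recursive set theory.

  Reflection implies induction: if induction over \<open>X\<^sup>r\<close> fails for \<open>\<phi>\<close>, then it fails in some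
  transitive set \<open>N\<close> with \<open>r \<in> N\<close>. The counterexamples in \<open>N\<close> form a set, and an \<open>X\<^sup>r\<close>-minimal
  one contradicts progressiveness in \<open>N\<close>, because the \<open>\<Sigma>\<close>-formula defining the order is upward
  absolute.

  Induction implies reflection: assume \<open>\<psi>(r)\<close>. The nodes of a class \<open>X\<^sup>r\<close> are finite sequences
  of claims \<open>(\<phi>, c)\<close>, where \<open>\<phi>\<close> is a subformula of \<open>\<psi>\<close> (conjoined with extensionality) and \<open>c\<close>
  an assignment. A node lies below another if it extends it and contains the claims that are
  needed to verify all claims of the larger node (a disjunct, a witness, the instances for all
  elements mentioned so far). Truth itself does not occur in the definition, which is \<open>\<Delta>\<^sub>0\<close>. A
  node whose claims are all true has a node of this kind below it, so if \<open>X\<^sup>r\<close> were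
  well-founded, induction would show that the root claim \<open>\<psi>(r)\<close> is false. Hence \<open>X\<^sup>r\<close> is not
  well-founded, and dependent choice yields a branch. The elements mentioned along the branch
  form an extensional set in which \<open>\<psi>(r)\<close> holds; collapse it.
\<close>


section \<open>Syntax\<close>

instance psf :: countable by countable_datatype
instance trm :: countable by countable_datatype
instance fm :: countable by countable_datatype

lemma build_numeral [simp]: "(x ## e) (numeral k) = e (pred_numeral k)"
  by (simp add: numeral_eq_Suc)

lemma comp_build: "(\<lambda>i. f ((x ## e) i)) = f x ## (\<lambda>i. f (e i))"
proof
  show "f ((x ## e) i) = (f x ## (\<lambda>i. f (e i))) i" for i by (cases i) simp_all
qed

lemma build_eta [simp]: "e 0 ## (\<lambda>i. e (Suc i)) = e"
  using build_first[of e] by (simp add: suffix_def)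

lemma build_const [simp]: "x ## (\<lambda>_. x) = (\<lambda>_. x)"
  using build_eta[of "\<lambda>_. x"] .

lemma build_cong: "(\<And>i. Suc i \<in> A \<Longrightarrow> e i = e' i) \<Longrightarrow> j \<in> A \<Longrightarrow> (x ## e) j = (x ## e') j"
  by (cases j) auto

lemma map_conc_upt:
  "length xs = m \<Longrightarrow> length ys = n \<Longrightarrow> map (xs \<frown> ys \<frown> e) [m..<n + m] = ys"
  by (rule nth_equalityI) (simp_all del: conc_conc)


subsection \<open>Substitution\<close>

lemma sb_trm_sb_trm: "sb_trm \<sigma> (sb_trm \<tau> t) = sb_trm (\<lambda>i. sb_trm \<sigma> (\<tau> i)) t"
  by (induction t) auto

lemma sb_trm_cong: "(\<And>i. i \<in> fv_trm t \<Longrightarrow> \<sigma> i = \<tau> i) \<Longrightarrow> sb_trm \<sigma> t = sb_trm \<tau> t"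
  by (induction t) auto

lemma sb_trm_Var [simp]: "sb_trm Var t = t"
  by (induction t) (auto simp: map_idI)

lemma up_eq_build: "up \<sigma> = Var 0 ## (\<lambda>i. lift_trm (\<sigma> i))"
proof
  show "up \<sigma> i = (Var 0 ## (\<lambda>i. lift_trm (\<sigma> i))) i" for i by (cases i) (simp_all add: up_def)
qed

lemma lift_trm_Var [simp]: "lift_trm (Var i) = Var (Suc i)"
  and lift_trm_Fn [simp]: "lift_trm (Fn f ts) = Fn f (map lift_trm ts)"
  by (simp_all add: lift_trm_def)

lemma sb_trm_build_lift [simp]: "sb_trm (t ## \<sigma>) (lift_trm s) = sb_trm \<sigma> s"
  by (simp add: lift_trm_def sb_trm_sb_trm)

lemma lift_sb_trm: "lift_trm (sb_trm \<sigma> t) = sb_trm (\<lambda>i. lift_trm (\<sigma> i)) t"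
  by (simp add: lift_trm_def sb_trm_sb_trm)

lemma sb_trm_up_up: "(\<lambda>i. sb_trm (up \<sigma>) (up \<tau> i)) = up (\<lambda>i. sb_trm \<sigma> (\<tau> i))"
  by (simp add: up_eq_build comp_build[of "sb_trm _"] lift_sb_trm)

lemma sb_sb: "sb \<sigma> (sb \<tau> \<phi>) = sb (\<lambda>i. sb_trm \<sigma> (\<tau> i)) \<phi>"
  by (induction \<phi> arbitrary: \<sigma> \<tau>) (auto simp: sb_trm_sb_trm sb_trm_up_up)

lemma sb_cong: "(\<And>i. i \<in> fv \<phi> \<Longrightarrow> \<sigma> i = \<tau> i) \<Longrightarrow> sb \<sigma> \<phi> = sb \<tau> \<phi>"
proof (induction \<phi> arbitrary: \<sigma> \<tau>)
  case (All \<phi>)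
  have "sb (up \<sigma>) \<phi> = sb (up \<tau>) \<phi>"
    unfolding up_eq_build by (rule All.IH, rule build_cong[of "fv \<phi>"]) (use All.prems in auto)
  then show ?case by simp
next
  case (Ex \<phi>)
  have "sb (up \<sigma>) \<phi> = sb (up \<tau>) \<phi>"
    unfolding up_eq_build by (rule Ex.IH, rule build_cong[of "fv \<phi>"]) (use Ex.prems in auto)
  then show ?case by simp
next
  case (And \<phi> \<psi>) then show ?case by (metis UnCI fv.simps(5) sb.simps(5))
next
  case (Or \<phi> \<psi>) then show ?case by (metis UnCI fv.simps(6) sb.simps(6))
qed (auto intro: sb_trm_cong)

lemma up_Var [simp]: "up Var = Var"
  by (simp add: up_eq_build)

lemma sb_Var [simp]: "sb Var \<phi> = \<phi>"
  by (induction \<phi>) auto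

lemma sb_closed: "fv \<phi> = {} \<Longrightarrow> sb \<sigma> \<phi> = \<phi>"
  using sb_cong[of \<phi> \<sigma> Var] by simp

lemma neg_neg [simp]: "neg (neg \<phi>) = \<phi>"
  by (induction \<phi>) auto

lemma sb_neg [simp]: "sb \<sigma> (neg \<phi>) = neg (sb \<sigma> \<phi>)"
  by (induction \<phi> arbitrary: \<sigma>) auto

lemma inst_eq_sb: "inst \<phi> ts = sb (ts \<frown> Var) \<phi>"
  by (simp add: inst_def conc_def)

lemma inst_neg [simp]: "inst (neg \<phi>) ts = neg (inst \<phi> ts)"
  by (simp add: inst_def)

lemma inst_sb_up: "inst (sb (up \<sigma>) \<phi>) [t] = sb (t ## \<sigma>) \<phi>"
  by (simp add: inst_eq_sb sb_sb up_eq_build comp_build[of "sb_trm _"])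

lemma sb_inst_single: "sb \<sigma> (inst \<phi> [t]) = inst (sb (up \<sigma>) \<phi>) [sb_trm \<sigma> t]"
  unfolding inst_sb_up by (simp add: inst_eq_sb sb_sb comp_build[of "sb_trm _"])

lemma sb_up_lift: "sb (up \<sigma>) (lift \<phi>) = lift (sb \<sigma> \<phi>)"
  by (simp add: lift_def sb_sb up_eq_build lift_trm_def)


subsection \<open>Well-formedness\<close>

lemma wf_fm_neg [simp]: "wf_fm (neg \<phi>) \<longleftrightarrow> wf_fm \<phi>"
  by (induction \<phi>) auto

lemma wf_trm_lift [simp]: "wf_trm (lift_trm t) \<longleftrightarrow> wf_trm t"
  by (induction t) (auto simp: list_all_iff)

lemma wf_build: "wf_trm t \<Longrightarrow> (\<And>i. wf_trm (\<sigma> i)) \<Longrightarrow> wf_trm ((t ## \<sigma>) i)"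
  by (cases i) auto

lemma wf_up: "(\<And>i. wf_trm (\<sigma> i)) \<Longrightarrow> wf_trm (up \<sigma> i)"
  by (simp add: up_eq_build wf_build)

lemma wf_sb_trm: "(\<And>i. wf_trm (\<sigma> i)) \<Longrightarrow> wf_trm t \<Longrightarrow> wf_trm (sb_trm \<sigma> t)"
  by (induction t) (auto simp: list_all_iff)

lemma wf_sb: "(\<And>i. wf_trm (\<sigma> i)) \<Longrightarrow> wf_fm \<phi> \<Longrightarrow> wf_fm (sb \<sigma> \<phi>)"
  by (induction \<phi> arbitrary: \<sigma>) (simp_all add: wf_sb_trm wf_up)

lemma wf_inst: "wf_fm \<phi> \<Longrightarrow> list_all wf_trm ts \<Longrightarrow> wf_fm (inst \<phi> ts)"
  unfolding inst_def by (rule wf_sb) (auto simp: list_all_length)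

lemma wf_Imp [simp]: "wf_fm (Imp \<phi> \<psi>) \<longleftrightarrow> wf_fm \<phi> \<and> wf_fm \<psi>"
  and wf_Iff [simp]: "wf_fm (Iff \<phi> \<psi>) \<longleftrightarrow> wf_fm \<phi> \<and> wf_fm \<psi>"
  by (auto simp: Imp_def Iff_def)

lemma wf_BAll [simp]: "wf_fm (BAll t \<phi>) \<longleftrightarrow> wf_trm t \<and> wf_fm \<phi>"
  and wf_BEx [simp]: "wf_fm (BEx t \<phi>) \<longleftrightarrow> wf_trm t \<and> wf_fm \<phi>"
  by (auto simp: BAll_def BEx_def)

lemma wf_Alls [simp]: "wf_fm (Alls k \<phi>) \<longleftrightarrow> wf_fm \<phi>"
  by (induction k) (auto simp: Alls_def)

lemma wf_rel: "wf_fm \<phi> \<Longrightarrow> wf_trm N \<Longrightarrow> wf_fm (rel N \<phi>)"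
  by (induction \<phi> arbitrary: N) auto

lemma is_Var_iff: "is_Var t \<longleftrightarrow> (\<exists>i. t = Var i)"
  by (cases t) auto

lemma wf_set_fm: "set_fm \<phi> \<Longrightarrow> wf_fm \<phi>"
  by (induction \<phi>) (auto simp: is_Var_iff)


subsection \<open>Free variables\<close>

lemma fv_neg [simp]: "fv (neg \<phi>) = fv \<phi>"
  by (induction \<phi>) auto

lemma finite_fv_trm: "finite (fv_trm t)"
  by (induction t) auto

lemma finite_fv: "finite (fv \<phi>)"
  using finite_vimageI[of _ Suc] by (induction \<phi>) (auto simp: finite_fv_trm vimage_def)

definition fv_trm_below :: "nat \<Rightarrow> trm \<Rightarrow> bool" where
  "fv_trm_below n t \<longleftrightarrow> fv_trm t \<subseteq> {..<n}"

definition fv_below :: "nat \<Rightarrow> fm \<Rightarrow> bool" where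
  "fv_below n \<phi> \<longleftrightarrow> fv \<phi> \<subseteq> {..<n}"

lemma fv_empty_iff: "fv \<phi> = {} \<longleftrightarrow> fv_below 0 \<phi>"
  by (simp add: fv_below_def)

lemma fv_trm_below_simps [simp]:
  "fv_trm_below n (Var i) \<longleftrightarrow> i < n"
  "fv_trm_below n (Fn f ts) \<longleftrightarrow> list_all (fv_trm_below n) ts"
  by (auto simp: fv_trm_below_def list_all_iff)

lemma fv_trm_below_lift [simp]: "fv_trm_below (Suc n) (lift_trm t) \<longleftrightarrow> fv_trm_below n t"
  by (induction t) (auto simp: list_all_iff)

lemma vimage_Suc_subset_iff: "{i. Suc i \<in> A} \<subseteq> {..<n} \<longleftrightarrow> A \<subseteq> {..<Suc n}"
  by (auto simp: subset_iff less_Suc_eq_0_disj) (metis not0_implies_Suc)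

lemma fv_below_simps [simp]:
  "fv_below n (Mem s t) \<longleftrightarrow> fv_trm_below n s \<and> fv_trm_below n t"
  "fv_below n (NMem s t) \<longleftrightarrow> fv_trm_below n s \<and> fv_trm_below n t"
  "fv_below n (Eq s t) \<longleftrightarrow> fv_trm_below n s \<and> fv_trm_below n t"
  "fv_below n (NEq s t) \<longleftrightarrow> fv_trm_below n s \<and> fv_trm_below n t"
  "fv_below n (And \<phi> \<psi>) \<longleftrightarrow> fv_below n \<phi> \<and> fv_below n \<psi>"
  "fv_below n (Or \<phi> \<psi>) \<longleftrightarrow> fv_below n \<phi> \<and> fv_below n \<psi>"
  "fv_below n (All \<phi>) \<longleftrightarrow> fv_below (Suc n) \<phi>"
  "fv_below n (Ex \<phi>) \<longleftrightarrow> fv_below (Suc n) \<phi>"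
  "fv_below n (neg \<phi>) \<longleftrightarrow> fv_below n \<phi>"
  by (auto simp: fv_below_def fv_trm_below_def vimage_Suc_subset_iff)

lemma fv_below_derived [simp]:
  "fv_below n (Imp \<phi> \<psi>) \<longleftrightarrow> fv_below n \<phi> \<and> fv_below n \<psi>"
  "fv_below n (Iff \<phi> \<psi>) \<longleftrightarrow> fv_below n \<phi> \<and> fv_below n \<psi>"
  "fv_below n (BAll t \<phi>) \<longleftrightarrow> fv_trm_below n t \<and> fv_below (Suc n) \<phi>"
  "fv_below n (BEx t \<phi>) \<longleftrightarrow> fv_trm_below n t \<and> fv_below (Suc n) \<phi>"
  by (auto simp: Imp_def Iff_def BAll_def BEx_def)

lemma fv_below_Alls [simp]: "fv_below n (Alls k \<phi>) \<longleftrightarrow> fv_below (n + k) \<phi>"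
  by (induction k arbitrary: n) (auto simp: Alls_def)

lemma fv_trm_below_sb:
  "fv_trm_below m t \<Longrightarrow> (\<And>i. i < m \<Longrightarrow> fv_trm_below n (\<sigma> i)) \<Longrightarrow> fv_trm_below n (sb_trm \<sigma> t)"
  by (induction t) (auto simp: list_all_iff)

lemma fv_below_sb:
  "fv_below m \<phi> \<Longrightarrow> (\<And>i. i < m \<Longrightarrow> fv_trm_below n (\<sigma> i)) \<Longrightarrow> fv_below n (sb \<sigma> \<phi>)"
proof (induction \<phi> arbitrary: m n \<sigma>)
  case (All \<phi>)
  have "fv_trm_below (Suc n) (up \<sigma> i)" if "i < Suc m" for i
    using that All.prems by (cases i) (auto simp: up_eq_build)
  then show ?case using All.IH[of "Suc m"] All.prems by simp
next
  case (Ex \<phi>)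
  have "fv_trm_below (Suc n) (up \<sigma> i)" if "i < Suc m" for i
    using that Ex.prems by (cases i) (auto simp: up_eq_build)
  then show ?case using Ex.IH[of "Suc m"] Ex.prems by simp
qed (auto simp: fv_trm_below_sb)

lemma ex_fv_below: "\<exists>n. fv_below n \<phi>"
  using finite_nat_iff_bounded[of "fv \<phi>"] by (simp add: finite_fv fv_below_def)

lemma fv_below_mono: "fv_below m \<phi> \<Longrightarrow> m \<le> n \<Longrightarrow> fv_below n \<phi>"
  by (auto simp: fv_below_def)

lemma fv_below_rename: "(\<And>i. \<rho> i < n) \<Longrightarrow> fv_below n (sb (\<lambda>i. Var (\<rho> i)) \<phi>)"
  using ex_fv_below[of \<phi>] fv_below_sb by fastforce

lemma fv_below_inst:
  "fv_below (length ts) \<phi> \<Longrightarrow> list_all (fv_trm_below n) ts \<Longrightarrow> fv_below n (inst \<phi> ts)"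
  unfolding inst_eq_sb by (rule fv_below_sb) (auto simp: list_all_length)

lemma fv_below_rel: "fv_below n \<phi> \<Longrightarrow> fv_trm_below n N \<Longrightarrow> fv_below n (rel N \<phi>)"
  by (induction \<phi> arbitrary: n N) auto


subsection \<open>Formulas without function symbols\<close>

lemma up_rename: "up (\<lambda>i. Var (\<rho> i)) = (\<lambda>i. Var ((0 ## (\<lambda>i. Suc (\<rho> i))) i))"
  by (simp add: up_eq_build comp_build[of Var])

lemma set_fm_neg [simp]: "set_fm (neg \<phi>) \<longleftrightarrow> set_fm \<phi>"
  by (induction \<phi>) auto

lemma set_fm_rename: "set_fm \<phi> \<Longrightarrow> set_fm (sb (\<lambda>i. Var (\<rho> i)) \<phi>)"
  by (induction \<phi> arbitrary: \<rho>) (auto simp: up_rename is_Var_iff)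

lemma set_fm_inst:
  assumes "set_fm \<phi>" "list_all is_Var ts" shows "set_fm (inst \<phi> ts)"
proof -
  obtain js where "ts = map Var js"
    using assms(2) unfolding list_all_iff is_Var_iff by (metis ex_map_conv)
  then have "ts \<frown> Var = (\<lambda>i. Var ((js \<frown> id) i))" by (auto simp: conc_def)
  then show ?thesis using set_fm_rename[OF assms(1)] by (simp add: inst_eq_sb)
qed

lemma set_fm_Imp [simp]: "set_fm (Imp \<phi> \<psi>) \<longleftrightarrow> set_fm \<phi> \<and> set_fm \<psi>"
  by (simp add: Imp_def)

lemma set_fm_Alls [simp]: "set_fm (Alls k \<phi>) \<longleftrightarrow> set_fm \<phi>"
  by (induction k) (auto simp: Alls_def)

lemmas sigma_fm_induct =
  sigma_fm.induct[consumes 1, case_names Mem NMem Eq NEq And Or BAll Ex]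

lemma sigma_fm_set_fm: "sigma_fm \<phi> \<Longrightarrow> set_fm \<phi>"
  by (induction rule: sigma_fm.induct) (auto simp: BAll_def)

lemma sigma_fm_bounded_All: "sigma_fm \<phi> \<Longrightarrow> sigma_fm (All (Or (NMem (Var 0) (Var (Suc i))) \<phi>))"
  using sigma_fm.intros(7)[of \<phi> i] by (simp add: BAll_def)

lemma pi_fm_bounded_Ex: "pi_fm \<phi> \<Longrightarrow> pi_fm (Ex (And (Mem (Var 0) (Var (Suc i))) \<phi>))"
  using pi_fm.intros(8)[of \<phi> i] by (simp add: BEx_def)

lemma sigma_fm_neg: "sigma_fm \<phi> \<Longrightarrow> pi_fm (neg \<phi>)"
  by (induction rule: sigma_fm.induct)
    (auto intro: pi_fm.intros pi_fm_bounded_Ex simp: BAll_def)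

lemma pi_fm_neg: "pi_fm \<phi> \<Longrightarrow> sigma_fm (neg \<phi>)"
  by (induction rule: pi_fm.induct)
    (auto intro: sigma_fm.intros sigma_fm_bounded_All simp: BEx_def)

lemma pi_fm_And_iff [simp]: "pi_fm (And \<phi> \<psi>) \<longleftrightarrow> pi_fm \<phi> \<and> pi_fm \<psi>"
  and pi_fm_Or_iff [simp]: "pi_fm (Or \<phi> \<psi>) \<longleftrightarrow> pi_fm \<phi> \<and> pi_fm \<psi>"
  and pi_fm_All_iff [simp]: "pi_fm (All \<phi>) \<longleftrightarrow> pi_fm \<phi>"
  and pi_fm_Ex_iff: "pi_fm (Ex \<phi>) \<longleftrightarrow> (\<exists>i \<psi>. \<phi> = And (Mem (Var 0) (Var (Suc i))) \<psi> \<and> pi_fm \<psi>)"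
  by (auto simp: BEx_def elim: pi_fm.cases intro: pi_fm.intros(5-7) pi_fm_bounded_Ex)

lemma pi_fm_set_fm: "pi_fm \<phi> \<Longrightarrow> set_fm \<phi>"
  using sigma_fm_set_fm[OF pi_fm_neg] by simp

lemma sigma_fm_rename: "sigma_fm \<phi> \<Longrightarrow> sigma_fm (sb (\<lambda>i. Var (\<rho> i)) \<phi>)"
  by (induction arbitrary: \<rho> rule: sigma_fm.induct)
    (auto intro: sigma_fm.intros sigma_fm_bounded_All simp: BAll_def up_rename)

lemma pi_fm_rename: "pi_fm \<phi> \<Longrightarrow> pi_fm (sb (\<lambda>i. Var (\<rho> i)) \<phi>)"
  using pi_fm_neg[THEN sigma_fm_rename, THEN sigma_fm_neg] by simp


section \<open>Semantics\<close>

primrec val :: "(psf \<Rightarrow> 'a list \<Rightarrow> 'a) \<Rightarrow> (nat \<Rightarrow> 'a) \<Rightarrow> trm \<Rightarrow> 'a" where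
  "val F e (Var i) = e i"
| "val F e (Fn f ts) = F f (map (val F e) ts)"

text \<open>Quantifiers range over \<open>U\<close>, which covers both truth and relativized truth.\<close>

primrec sat :: "('a \<Rightarrow> 'a \<Rightarrow> bool) \<Rightarrow> (psf \<Rightarrow> 'a list \<Rightarrow> 'a) \<Rightarrow> 'a set \<Rightarrow> (nat \<Rightarrow> 'a) \<Rightarrow> fm \<Rightarrow> bool"
where
  "sat E F U e (Mem s t) \<longleftrightarrow> E (val F e s) (val F e t)"
| "sat E F U e (NMem s t) \<longleftrightarrow> \<not> E (val F e s) (val F e t)"
| "sat E F U e (Eq s t) \<longleftrightarrow> val F e s = val F e t"
| "sat E F U e (NEq s t) \<longleftrightarrow> val F e s \<noteq> val F e t"
| "sat E F U e (And \<phi> \<psi>) \<longleftrightarrow> sat E F U e \<phi> \<and> sat E F U e \<psi>"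
| "sat E F U e (Or \<phi> \<psi>) \<longleftrightarrow> sat E F U e \<phi> \<or> sat E F U e \<psi>"
| "sat E F U e (All \<phi>) \<longleftrightarrow> (\<forall>x\<in>U. sat E F U (x ## e) \<phi>)"
| "sat E F U e (Ex \<phi>) \<longleftrightarrow> (\<exists>x\<in>U. sat E F U (x ## e) \<phi>)"

lemma sat_neg [simp]: "sat E F U e (neg \<phi>) \<longleftrightarrow> \<not> sat E F U e \<phi>"
  by (induction \<phi> arbitrary: e) auto

lemma sat_Imp [simp]: "sat E F U e (Imp \<phi> \<psi>) \<longleftrightarrow> (sat E F U e \<phi> \<longrightarrow> sat E F U e \<psi>)"
  and sat_Iff [simp]: "sat E F U e (Iff \<phi> \<psi>) \<longleftrightarrow> (sat E F U e \<phi> \<longleftrightarrow> sat E F U e \<psi>)"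
  by (auto simp: Imp_def Iff_def)

lemma val_sb_trm [simp]: "val F e (sb_trm \<sigma> t) = val F (\<lambda>i. val F e (\<sigma> i)) t"
  by (induction t) (auto simp: o_def cong: map_cong)

lemma val_lift_trm [simp]: "val F (x ## e) (lift_trm t) = val F e t"
  by (simp add: lift_trm_def)

lemma sat_sb [simp]: "sat E F U e (sb \<sigma> \<phi>) \<longleftrightarrow> sat E F U (\<lambda>i. val F e (\<sigma> i)) \<phi>"
  by (induction \<phi> arbitrary: e \<sigma>) (simp_all add: up_eq_build comp_build[of "val _ _"])

lemma val_cong: "(\<And>i. i \<in> fv_trm t \<Longrightarrow> e i = e' i) \<Longrightarrow> val F e t = val F e' t"
proof (induction t)
  case (Fn f ts)
  then have "map (val F e) ts = map (val F e') ts" by auto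
  then show ?case by (simp only: val.simps)
qed simp

lemma sat_cong: "(\<And>i. i \<in> fv \<phi> \<Longrightarrow> e i = e' i) \<Longrightarrow> sat E F U e \<phi> \<longleftrightarrow> sat E F U e' \<phi>"
proof (induction \<phi> arbitrary: e e')
  case (All \<phi>)
  have "sat E F U (x ## e) \<phi> \<longleftrightarrow> sat E F U (x ## e') \<phi>" for x
    by (rule All.IH, rule build_cong[of "fv \<phi>"]) (use All.prems in auto)
  then show ?case by simp
next
  case (Ex \<phi>)
  have "sat E F U (x ## e) \<phi> \<longleftrightarrow> sat E F U (x ## e') \<phi>" for x
    by (rule Ex.IH, rule build_cong[of "fv \<phi>"]) (use Ex.prems in auto)
  then show ?case by simp
next
  case (And \<phi> \<psi>) then show ?case by (metis UnCI fv.simps(5) sat.simps(5))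
next
  case (Or \<phi> \<psi>) then show ?case by (metis UnCI fv.simps(6) sat.simps(6))
qed (simp_all, (metis val_cong)+)

lemma sat_conc_cong:
  assumes "fv_below (length xs) \<phi>"
  shows "sat E F U (xs \<frown> e) \<phi> \<longleftrightarrow> sat E F U (xs \<frown> e') \<phi>"
  by (rule sat_cong) (use assms in \<open>auto simp: fv_below_def\<close>)

lemma sat_sentence: "fv \<phi> = {} \<Longrightarrow> sat E F U e \<phi> \<longleftrightarrow> sat E F U e' \<phi>"
  by (rule sat_cong) simp

lemma sat_inst: "sat E F U e (inst \<phi> ts) \<longleftrightarrow> sat E F U (map (val F e) ts \<frown> e) \<phi>"
proof -
  have "(\<lambda>i. val F e ((ts \<frown> Var) i)) = map (val F e) ts \<frown> e" by (auto simp: conc_def)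
  then show ?thesis by (simp add: inst_eq_sb)
qed

lemma sat_BAll [simp]:
  "sat E F U e (BAll t \<phi>) \<longleftrightarrow> (\<forall>x\<in>U. E x (val F e t) \<longrightarrow> sat E F U (x ## e) \<phi>)"
  and sat_BEx [simp]:
  "sat E F U e (BEx t \<phi>) \<longleftrightarrow> (\<exists>x\<in>U. E x (val F e t) \<and> sat E F U (x ## e) \<phi>)"
  by (auto simp: BAll_def BEx_def)

lemma sat_rel: "sat E F UNIV e (rel N \<phi>) \<longleftrightarrow> sat E F {x. E x (val F e N)} e \<phi>"
  by (induction \<phi> arbitrary: e N) auto

lemma sat_Alls:
  "sat E F U e (Alls n \<phi>) \<longleftrightarrow> (\<forall>xs. length xs = n \<and> set xs \<subseteq> U \<longrightarrow> sat E F U (xs \<frown> e) \<phi>)"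
proof (induction n arbitrary: e)
  case 0
  then show ?case by (simp add: Alls_def)
next
  case (Suc n)
  have "sat E F U e (Alls (Suc n) \<phi>) \<longleftrightarrow>
      (\<forall>x\<in>U. \<forall>xs. length xs = n \<and> set xs \<subseteq> U \<longrightarrow> sat E F U ((xs @ [x]) \<frown> e) \<phi>)"
    using Suc.IH by (simp add: Alls_def)
  also have "\<dots> \<longleftrightarrow> (\<forall>xs. length xs = Suc n \<and> set xs \<subseteq> U \<longrightarrow> sat E F U (xs \<frown> e) \<phi>)"
    by (auto simp: length_Suc_conv_rev simp del: build_append)
  finally show ?case .
qed


section \<open>Completeness\<close>

subsection \<open>Substitution in derivations\<close>

lemma derivable_sb:
  assumes "derivable T \<Gamma>" "\<forall>\<phi>\<in>T. fv \<phi> = {}" "\<And>i. wf_trm (\<sigma> i)"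
  shows "derivable T (map (sb \<sigma>) \<Gamma>)"
  using assms(1,3)
proof (induction arbitrary: \<sigma>)
  case (Ax \<phi>)
  then show ?case using assms(2) by (simp add: sb_closed derivable.Ax)
next
  case (AllI \<phi> \<Gamma>)
  have "derivable T (map (sb (up \<sigma>)) (\<phi> # map lift \<Gamma>))"
    by (rule AllI.IH) (simp add: AllI.prems wf_up)
  then have "derivable T (sb (up \<sigma>) \<phi> # map lift (map (sb \<sigma>) \<Gamma>))"
    by (simp add: sb_up_lift o_def)
  then show ?case by (simp add: derivable.AllI)
next
  case (ExI t \<phi> \<Gamma>)
  have "derivable T (inst (sb (up \<sigma>) \<phi>) [sb_trm \<sigma> t] # map (sb \<sigma>) \<Gamma>)"
    using ExI.IH[of \<sigma>] ExI.prems by (simp add: sb_inst_single)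
  then show ?case using ExI by (simp add: derivable.ExI[of "sb_trm \<sigma> t"] wf_sb_trm)
next
  case (Cut \<phi> \<Gamma>)
  show ?case by (rule derivable.Cut[of T "sb \<sigma> \<phi>"]) (use Cut.IH[of \<sigma>] Cut.prems in simp_all)
next
  case (Weak \<Gamma> \<Delta>)
  show ?case
    by (rule derivable.Weak[OF Weak.IH[of \<sigma>]]) (use Weak in \<open>auto simp: list_all_iff intro: wf_sb\<close>)
qed (simp_all add: sb_inst_single wf_sb_trm wf_sb wf_up
    derivable.Id derivable.Refl derivable.Repl derivable.AndI derivable.OrI)

lemma derivable_generalize:
  assumes "derivable T (inst \<phi> [Var n] # \<Gamma>)" "\<forall>\<phi>\<in>T. fv \<phi> = {}"
    and fresh: "n \<notin> fv (All \<phi>)" "\<forall>\<gamma>\<in>set \<Gamma>. n \<notin> fv \<gamma>"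
  shows "derivable T (All \<phi> # \<Gamma>)"
proof -
  define \<sigma> where "\<sigma> i = (if i = n then Var 0 else Var (Suc i))" for i
  have "\<sigma> n = Var 0" by (simp add: \<sigma>_def)
  then have "sb \<sigma> (inst \<phi> [Var n]) = sb (Var 0 ## \<sigma>) \<phi>"
    by (simp add: inst_eq_sb sb_sb comp_build[of "sb_trm _"])
  also have "\<dots> = sb Var \<phi>"
  proof (rule sb_cong)
    show "(Var 0 ## \<sigma>) i = Var i" if "i \<in> fv \<phi>" for i
      using that fresh by (cases i) (auto simp: \<sigma>_def)
  qed
  finally have "sb \<sigma> (inst \<phi> [Var n]) = \<phi>" by simp
  moreover have "map (sb \<sigma>) \<Gamma> = map lift \<Gamma>"
    unfolding lift_def by (rule map_cong, simp, rule sb_cong) (use fresh in \<open>auto simp: \<sigma>_def\<close>)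
  moreover have "derivable T (map (sb \<sigma>) (inst \<phi> [Var n] # \<Gamma>))"
    by (rule derivable_sb[OF assms(1,2)]) (simp add: \<sigma>_def)
  ultimately have "derivable T (\<phi> # map lift \<Gamma>)" by (simp del: map_eq_conv)
  then show ?thesis by (rule derivable.AllI)
qed


subsection \<open>Henkin sets\<close>

definition consistent :: "fm set \<Rightarrow> fm list \<Rightarrow> bool" where
  "consistent T \<Gamma> \<longleftrightarrow> list_all wf_fm \<Gamma> \<and> \<not> derivable T (map neg \<Gamma>)"

lemma consistent_subset: "consistent T \<Delta> \<Longrightarrow> set \<Gamma> \<subseteq> set \<Delta> \<Longrightarrow> consistent T \<Gamma>"
  using derivable.Weak[of T "map neg \<Gamma>" "map neg \<Delta>"]
  by (auto simp: consistent_def list_all_iff)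

lemma consistent_Cons_or_neg:
  assumes "consistent T \<Gamma>" "wf_fm \<phi>"
  shows "consistent T (\<phi> # \<Gamma>) \<or> consistent T (neg \<phi> # \<Gamma>)"
  using assms derivable.Cut[of T \<phi> "map neg \<Gamma>"] by (auto simp: consistent_def)

locale henkin =
  fixes T H :: "fm set"
  assumes consistent: "set \<Gamma> \<subseteq> H \<Longrightarrow> consistent T \<Gamma>"
    and complete: "wf_fm \<phi> \<Longrightarrow> \<phi> \<in> H \<or> neg \<phi> \<in> H"
    and witness: "Ex \<phi> \<in> H \<Longrightarrow> \<exists>n. inst \<phi> [Var n] \<in> H"
begin

lemma derivable_mem:
  assumes "derivable T (\<phi> # map neg \<Gamma>)" "set \<Gamma> \<subseteq> H" "wf_fm \<phi>"
  shows "\<phi> \<in> H"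
  using complete[OF assms(3)] consistent[of "neg \<phi> # \<Gamma>"] assms by (auto simp: consistent_def)

lemma axiom_mem: "\<phi> \<in> T \<Longrightarrow> wf_fm \<phi> \<Longrightarrow> \<phi> \<in> H"
  using derivable_mem[of \<phi> "[]"] by (simp add: derivable.Ax)

lemma neg_mem_iff: "wf_fm \<phi> \<Longrightarrow> neg \<phi> \<in> H \<longleftrightarrow> \<phi> \<notin> H"
  using complete[of \<phi>] consistent[of "[neg \<phi>, \<phi>]"] derivable.Id[of \<phi> T]
  by (auto simp: consistent_def)

lemma And_mem_iff:
  assumes [simp]: "wf_fm \<phi>" "wf_fm \<psi>"
  shows "And \<phi> \<psi> \<in> H \<longleftrightarrow> \<phi> \<in> H \<and> \<psi> \<in> H"
proof -
  have id: "derivable T [\<chi>, neg \<phi>, neg \<psi>]" if "\<chi> \<in> {\<phi>, \<psi>}" for \<chi>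
    by (rule derivable.Weak[OF derivable.Id[of \<chi>]]) (use that in auto)
  have conjunct: "\<chi> \<in> H" if "And \<phi> \<psi> \<in> H" "\<chi> \<in> {\<phi>, \<psi>}" for \<chi>
  proof -
    have "derivable T [neg \<phi>, neg \<psi>, \<chi>]"
      by (rule derivable.Weak[OF id[OF that(2)]]) (use that(2) in auto)
    then have "derivable T [neg (And \<phi> \<psi>), \<chi>]" by (simp add: derivable.OrI)
    then have "derivable T (\<chi> # map neg [And \<phi> \<psi>])"
      by (rule derivable.Weak) (use that(2) in auto)
    then show ?thesis by (rule derivable_mem) (use that in auto)
  qed
  have "derivable T (And \<phi> \<psi> # map neg [\<phi>, \<psi>])"
    using derivable.AndI[OF id id] by simp
  then have "\<phi> \<in> H \<Longrightarrow> \<psi> \<in> H \<Longrightarrow> And \<phi> \<psi> \<in> H" by (rule derivable_mem) simp_all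
  then show ?thesis using conjunct by blast
qed

lemma Or_mem_iff: "wf_fm \<phi> \<Longrightarrow> wf_fm \<psi> \<Longrightarrow> Or \<phi> \<psi> \<in> H \<longleftrightarrow> \<phi> \<in> H \<or> \<psi> \<in> H"
  using And_mem_iff[of "neg \<phi>" "neg \<psi>"] neg_mem_iff[of "Or \<phi> \<psi>"] neg_mem_iff[of \<phi>]
    neg_mem_iff[of \<psi>] by auto

lemma Ex_memI:
  assumes "wf_fm \<phi>" "wf_trm t" "inst \<phi> [t] \<in> H"
  shows "Ex \<phi> \<in> H"
proof -
  have "derivable T [inst \<phi> [t], neg (inst \<phi> [t])]"
    by (rule derivable.Id) (use assms in \<open>simp add: wf_inst\<close>)
  then have "derivable T (Ex \<phi> # map neg [inst \<phi> [t]])"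
    using assms by (auto intro: derivable.ExI)
  then show ?thesis by (rule derivable_mem) (use assms in auto)
qed

lemma Ex_mem_iff: "wf_fm \<phi> \<Longrightarrow> Ex \<phi> \<in> H \<longleftrightarrow> (\<exists>n. inst \<phi> [Var n] \<in> H)"
  using witness[of \<phi>] Ex_memI[of \<phi> "Var _"] by auto

lemma All_mem_iff:
  assumes "wf_fm \<phi>"
  shows "All \<phi> \<in> H \<longleftrightarrow> (\<forall>n. inst \<phi> [Var n] \<in> H)"
proof -
  have "All \<phi> \<in> H \<longleftrightarrow> Ex (neg \<phi>) \<notin> H" using neg_mem_iff[of "All \<phi>"] assms by simp
  also have "\<dots> \<longleftrightarrow> (\<forall>n. neg (inst \<phi> [Var n]) \<notin> H)" using Ex_mem_iff[of "neg \<phi>"] assms by simp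
  also have "\<dots> \<longleftrightarrow> (\<forall>n. inst \<phi> [Var n] \<in> H)" using neg_mem_iff assms by (simp add: wf_inst)
  finally show ?thesis .
qed

lemma Eq_refl_mem: "wf_trm t \<Longrightarrow> Eq t t \<in> H"
  using derivable_mem[of "Eq t t" "[]"] by (simp add: derivable.Refl)

lemma replacement_mem:
  assumes "wf_trm s" "wf_trm t" "wf_fm \<phi>" "Eq s t \<in> H" "inst \<phi> [s] \<in> H"
  shows "inst \<phi> [t] \<in> H"
proof -
  have "derivable T (inst \<phi> [t] # map neg [Eq s t, inst \<phi> [s]])"
    by (rule derivable.Weak[OF derivable.Repl[of s t \<phi>]]) (use assms in \<open>auto simp: wf_inst\<close>)
  then show ?thesis by (rule derivable_mem) (use assms in \<open>simp_all add: wf_inst\<close>)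
qed

lemma Eq_sym_mem:
  assumes "wf_trm s" "wf_trm t" "Eq s t \<in> H" shows "Eq t s \<in> H"
  using replacement_mem[of s t "Eq (Var 0) (lift_trm s)"] assms
  by (simp add: inst_eq_sb Eq_refl_mem)

lemma Eq_trans_mem:
  assumes "wf_trm s" "wf_trm t" "wf_trm u" "Eq s t \<in> H" "Eq t u \<in> H" shows "Eq s u \<in> H"
  using replacement_mem[of t u "Eq (lift_trm s) (Var 0)"] assms by (simp add: inst_eq_sb)

lemma Mem_cong_mem:
  assumes "wf_trm s" "wf_trm t" "wf_trm s'" "wf_trm t'" "Eq s s' \<in> H" "Eq t t' \<in> H" "Mem s t \<in> H"
  shows "Mem s' t' \<in> H"
  using replacement_mem[of s s' "Mem (Var 0) (lift_trm t)"]
    replacement_mem[of t t' "Mem (lift_trm s') (Var 0)"] assms by (simp add: inst_eq_sb)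

lemma Fn_cong_mem:
  assumes "list_all2 (\<lambda>s t. wf_trm s \<and> wf_trm t \<and> Eq s t \<in> H) ss ts"
    and "wf_psf f" "list_all wf_trm us" "length us + length ss = arity f"
  shows "Eq (Fn f (us @ ss)) (Fn f (us @ ts)) \<in> H"
  using assms
proof (induction ss ts arbitrary: us rule: list_all2_induct)
  case Nil
  then show ?case by (simp add: Eq_refl_mem)
next
  case (Cons s ss t ts)
  have wf: "list_all wf_trm ss" "list_all wf_trm ts" "length ts = length ss"
    using Cons.hyps by (auto simp: list_all2_conv_all_nth list_all_length)
  let ?\<phi> = "Eq (Fn f (map lift_trm (us @ s # ss)))
    (Fn f (map lift_trm us @ Var 0 # map lift_trm ss))"
  have inst: "inst ?\<phi> [v] = Eq (Fn f (us @ s # ss)) (Fn f (us @ v # ss))" for v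
    by (simp add: inst_eq_sb o_def)
  have "wf_fm ?\<phi>"
    using Cons.prems Cons.hyps wf by (simp add: list_all_iff ball_Un)
  moreover have "Eq (Fn f (us @ s # ss)) (Fn f (us @ s # ss)) \<in> H"
    using Cons.prems Cons.hyps wf by (simp add: Eq_refl_mem)
  ultimately have "Eq (Fn f (us @ s # ss)) (Fn f (us @ t # ss)) \<in> H"
    using replacement_mem[of s t ?\<phi>] Cons.hyps inst by simp
  moreover have "Eq (Fn f ((us @ [t]) @ ss)) (Fn f ((us @ [t]) @ ts)) \<in> H"
    by (rule Cons.IH) (use Cons.prems Cons.hyps in auto)
  ultimately show ?case
    using Eq_trans_mem[of "Fn f (us @ s # ss)" "Fn f (us @ t # ss)" "Fn f (us @ t # ts)"]
      Cons.prems Cons.hyps wf by simp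
qed

lemma Eq_variable_mem:
  assumes "wf_trm t"
  shows "\<exists>n. Eq t (Var n) \<in> H"
proof -
  have "Ex (Eq (lift_trm t) (Var 0)) \<in> H"
    by (rule Ex_memI[of _ t]) (use assms in \<open>simp_all add: inst_eq_sb Eq_refl_mem\<close>)
  then show ?thesis using witness[of "Eq (lift_trm t) (Var 0)"] by (simp add: inst_eq_sb)
qed

end


subsection \<open>The canonical structure of a Henkin set\<close>

text \<open>Every term is provably equal to a variable, so the denotations of variables form a structure.\<close>

locale henkin_denotation = henkin +
  fixes den :: "trm \<Rightarrow> 'd"
  assumes den_eq_iff: "wf_trm s \<Longrightarrow> wf_trm t \<Longrightarrow> den s = den t \<longleftrightarrow> Eq s t \<in> H"
begin

definition universe :: "'d set" where
  "universe = range (\<lambda>n. den (Var n))"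

definition name :: "'d \<Rightarrow> trm" where
  "name d = Var (SOME n. den (Var n) = d)"

definition den_mem :: "'d \<Rightarrow> 'd \<Rightarrow> bool" where
  "den_mem d d' \<longleftrightarrow> Mem (name d) (name d') \<in> H"

definition den_fun :: "psf \<Rightarrow> 'd list \<Rightarrow> 'd" where
  "den_fun f ds = den (Fn f (map name ds))"

lemma wf_name: "wf_trm (name d)"
  by (simp add: name_def)

lemma den_in_universe: "wf_trm t \<Longrightarrow> den t \<in> universe"
  using Eq_variable_mem[of t] den_eq_iff[of t "Var _"] by (auto simp: universe_def)

lemma den_name: "d \<in> universe \<Longrightarrow> den (name d) = d"
  using someI_ex[of "\<lambda>n. den (Var n) = d"] by (auto simp: universe_def name_def)

lemma Eq_name_mem:
  assumes "wf_trm t" shows "Eq (name (den t)) t \<in> H" "Eq t (name (den t)) \<in> H"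
  using den_name[OF den_in_universe[OF assms]] den_eq_iff wf_name assms by metis+

lemma den_mem_iff:
  assumes "wf_trm s" "wf_trm t"
  shows "den_mem (den s) (den t) \<longleftrightarrow> Mem s t \<in> H"
  unfolding den_mem_def
  using Mem_cong_mem[OF wf_name wf_name assms Eq_name_mem(1)[OF assms(1)]
      Eq_name_mem(1)[OF assms(2)]]
    Mem_cong_mem[OF assms wf_name wf_name Eq_name_mem(2)[OF assms(1)] Eq_name_mem(2)[OF assms(2)]]
  by blast

lemma den_fun_in_universe: "wf_psf f \<Longrightarrow> length ds = arity f \<Longrightarrow> den_fun f ds \<in> universe"
  unfolding den_fun_def by (rule den_in_universe) (auto simp: list_all_iff wf_name)

lemma val_den:
  assumes "\<And>i. wf_trm (\<sigma> i)" "wf_trm t"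
  shows "val den_fun (\<lambda>i. den (\<sigma> i)) t = den (sb_trm \<sigma> t)"
  using assms(2)
proof (induction t)
  case (Fn f ts)
  let ?names = "map (\<lambda>t. name (den (sb_trm \<sigma> t))) ts" and ?ts = "map (sb_trm \<sigma>) ts"
  have wf: "list_all wf_trm ?names" "list_all wf_trm ?ts"
    using Fn.prems assms(1) by (auto simp: list_all_iff wf_name wf_sb_trm)
  have "Eq (Fn f ([] @ ?names)) (Fn f ([] @ ?ts)) \<in> H"
    by (rule Fn_cong_mem) (use Fn.prems assms(1) in
      \<open>auto simp: list_all2_conv_all_nth list_all_length wf_name wf_sb_trm Eq_name_mem\<close>)
  then have "den (Fn f ?names) = den (Fn f ?ts)"
    using den_eq_iff[of "Fn f ?names" "Fn f ?ts"] Fn.prems wf by simp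
  moreover have "map (val den_fun (\<lambda>i. den (\<sigma> i))) ts = map (\<lambda>t. den (sb_trm \<sigma> t)) ts"
    using Fn by (auto simp: list_all_iff)
  ultimately show ?case by (simp only: val.simps sb_trm.simps den_fun_def[of f] map_map o_def)
qed simp

lemma sat_den_iff:
  assumes "\<And>i. wf_trm (\<sigma> i)" "wf_fm \<phi>"
  shows "sat den_mem den_fun universe (\<lambda>i. den (\<sigma> i)) \<phi> \<longleftrightarrow> sb \<sigma> \<phi> \<in> H"
  using assms
proof (induction \<phi> arbitrary: \<sigma>)
  case (All \<phi>)
  have "sat den_mem den_fun universe (den (Var n) ## (\<lambda>i. den (\<sigma> i))) \<phi> \<longleftrightarrow>
      inst (sb (up \<sigma>) \<phi>) [Var n] \<in> H" for n
    using All.IH[of "Var n ## \<sigma>"] All.prems by (simp add: inst_sb_up comp_build[of den] wf_build)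
  then show ?case using All.prems by (simp add: All_mem_iff wf_sb wf_up universe_def)
next
  case (Ex \<phi>)
  have "sat den_mem den_fun universe (den (Var n) ## (\<lambda>i. den (\<sigma> i))) \<phi> \<longleftrightarrow>
      inst (sb (up \<sigma>) \<phi>) [Var n] \<in> H" for n
    using Ex.IH[of "Var n ## \<sigma>"] Ex.prems by (simp add: inst_sb_up comp_build[of den] wf_build)
  then show ?case using Ex.prems by (simp add: Ex_mem_iff wf_sb wf_up universe_def)
next
  case (NMem s t)
  then show ?case using neg_mem_iff[of "Mem (sb_trm \<sigma> s) (sb_trm \<sigma> t)"]
    by (simp add: val_den den_mem_iff wf_sb_trm)
next
  case (NEq s t)
  then show ?case using neg_mem_iff[of "Eq (sb_trm \<sigma> s) (sb_trm \<sigma> t)"]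
    by (simp add: val_den den_eq_iff wf_sb_trm)
qed (simp_all add: And_mem_iff Or_mem_iff val_den den_mem_iff den_eq_iff wf_sb_trm wf_sb)

lemma sat_den_Var_iff:
  "wf_fm \<phi> \<Longrightarrow> sat den_mem den_fun universe (\<lambda>i. den (Var i)) \<phi> \<longleftrightarrow> \<phi> \<in> H"
  using sat_den_iff[of Var \<phi>] by simp

end

text \<open>A finite structure would have an element containing all others, against regularity.\<close>

lemma infinite_structure:
  assumes sat: "sat E F U e regularity" "sat E F U e (defining_axiom Zero)"
      "sat E F U e (defining_axiom Adj)"
    and zero: "F Zero [] \<in> U" and adj: "\<And>x y. x \<in> U \<Longrightarrow> y \<in> U \<Longrightarrow> F Adj [x, y] \<in> U"
  shows "infinite U"
proof
  assume "finite U"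
  let ?z = "F Zero []" and ?a = "\<lambda>x y. F Adj [x, y]"
  have E_zero: "\<not> E x ?z" if "x \<in> U" for x
    using sat(2) that by simp
  have E_adj: "E u (?a x y) \<longleftrightarrow> E u x \<or> u = y" if "u \<in> U" "x \<in> U" "y \<in> U" for u x y
    using sat(3) that by (auto simp: Alls_def numeral_3_eq_3)
  have regular: "\<exists>x\<in>U. E x y \<and> (\<forall>v\<in>U. E v y \<longrightarrow> \<not> E v x)" if "y \<in> U" "y \<noteq> ?z" for y
    using sat(1) that by (auto simp: regularity_def)
  have "\<exists>u\<in>U. \<forall>x\<in>A. E x u" if "finite A" "A \<subseteq> U" for A
    using that
  proof (induction A)
    case empty
    then show ?case using zero by auto
  next
    case (insert y A)
    then obtain u where "u \<in> U" "\<forall>x\<in>A. E x u" by auto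
    then have "\<forall>x\<in>insert y A. E x (?a u y)" "?a u y \<in> U"
      using E_adj[of _ u y] adj insert.prems by auto
    then show ?case by blast
  qed
  then obtain u where u: "u \<in> U" "\<forall>x\<in>U. E x u" using \<open>finite U\<close> by blast
  let ?s = "?a ?z u"
  have "E x ?s \<longleftrightarrow> x = u" if "x \<in> U" for x using E_adj[OF that zero u(1)] E_zero[OF that] by simp
  then show False using regular[of ?s] adj[OF zero u(1)] E_zero u by metis
qed


subsection \<open>Existence of Henkin sets\<close>

definition fresh_var :: "fm list \<Rightarrow> nat" where
  "fresh_var \<Gamma> = (LEAST n. \<forall>\<gamma>\<in>set \<Gamma>. n \<notin> fv \<gamma>)"

lemma fresh_var:
  assumes "\<gamma> \<in> set \<Gamma>" shows "fresh_var \<Gamma> \<notin> fv \<gamma>"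
proof -
  have "finite (\<Union>\<gamma>\<in>set \<Gamma>. fv \<gamma>)" by (simp add: finite_fv)
  then have "\<exists>n. \<forall>\<gamma>\<in>set \<Gamma>. n \<notin> fv \<gamma>"
    using ex_new_if_finite[OF infinite_UNIV_nat] by blast
  from LeastI_ex[OF this] show ?thesis using assms by (simp add: fresh_var_def)
qed

definition add_witnessed :: "fm \<Rightarrow> fm list \<Rightarrow> fm list" where
  "add_witnessed \<phi> \<Gamma> =
     (case \<phi> of Ex \<psi> \<Rightarrow> inst \<psi> [Var (fresh_var (\<phi> # \<Gamma>))] # \<phi> # \<Gamma> | _ \<Rightarrow> \<phi> # \<Gamma>)"

lemma set_add_witnessed: "insert \<phi> (set \<Gamma>) \<subseteq> set (add_witnessed \<phi> \<Gamma>)"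
  by (auto simp: add_witnessed_def split: fm.split)

lemma consistent_add_witness:
  assumes T: "\<forall>\<phi>\<in>T. fv \<phi> = {}" and "consistent T \<Gamma>" "Ex \<psi> \<in> set \<Gamma>"
  shows "consistent T (inst \<psi> [Var (fresh_var \<Gamma>)] # \<Gamma>)"
proof (rule ccontr)
  have wf: "list_all wf_fm \<Gamma>" "wf_fm \<psi>"
    using assms(2,3) by (auto simp: consistent_def list_all_iff)
  assume "\<not> ?thesis"
  then have "derivable T (inst (neg \<psi>) [Var (fresh_var \<Gamma>)] # map neg \<Gamma>)"
    using wf by (simp add: consistent_def wf_inst)
  then have "derivable T (All (neg \<psi>) # map neg \<Gamma>)"
    by (rule derivable_generalize[OF _ T]) (use fresh_var[of _ \<Gamma>] fresh_var[OF assms(3)] in auto)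
  then have "derivable T (map neg \<Gamma>)"
    by (rule derivable.Weak)
      (use wf assms(3) in \<open>auto simp: list_all_iff image_iff intro!: bexI[of _ "Ex \<psi>"]\<close>)
  then show False using assms(2) by (simp add: consistent_def)
qed

lemma consistent_add_witnessed:
  "\<forall>\<phi>\<in>T. fv \<phi> = {} \<Longrightarrow> consistent T (\<phi> # \<Gamma>) \<Longrightarrow> consistent T (add_witnessed \<phi> \<Gamma>)"
  using consistent_add_witness[of T "\<phi> # \<Gamma>"] by (auto simp: add_witnessed_def split: fm.split)

primrec lindenbaum :: "fm set \<Rightarrow> fm list \<Rightarrow> nat \<Rightarrow> fm list" where
  "lindenbaum T \<Gamma> 0 = \<Gamma>"
| "lindenbaum T \<Gamma> (Suc k) =
     (let \<Delta> = lindenbaum T \<Gamma> k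
      in if consistent T (from_nat k # \<Delta>) then add_witnessed (from_nat k) \<Delta> else \<Delta>)"

context
  fixes T :: "fm set" and \<Gamma> :: "fm list"
  assumes closed: "\<forall>\<phi>\<in>T. fv \<phi> = {}" and consistent: "consistent T \<Gamma>"
begin

lemma consistent_lindenbaum: "consistent T (lindenbaum T \<Gamma> k)"
  by (induction k) (simp_all add: Let_def consistent consistent_add_witnessed closed)

lemma lindenbaum_mono: "k \<le> l \<Longrightarrow> set (lindenbaum T \<Gamma> k) \<subseteq> set (lindenbaum T \<Gamma> l)"
  by (rule lift_Suc_mono_le[of "\<lambda>k. set (lindenbaum T \<Gamma> k)"])
    (use set_add_witnessed in \<open>auto simp: Let_def\<close>)

lemma add_witnessed_lindenbaum:
  "consistent T (\<phi> # lindenbaum T \<Gamma> (to_nat \<phi>)) \<Longrightarrow>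
    lindenbaum T \<Gamma> (Suc (to_nat \<phi>)) = add_witnessed \<phi> (lindenbaum T \<Gamma> (to_nat \<phi>))"
  by simp

lemma consistent_Union_lindenbaum:
  assumes "set \<Delta> \<subseteq> (\<Union>k. set (lindenbaum T \<Gamma> k))"
  shows "consistent T \<Delta>"
proof -
  have "\<exists>k. A \<subseteq> set (lindenbaum T \<Gamma> k)" if "finite A" "A \<subseteq> (\<Union>k. set (lindenbaum T \<Gamma> k))" for A
    using that
  proof (induction A)
    case (insert \<phi> A)
    then obtain k l where "A \<subseteq> set (lindenbaum T \<Gamma> k)" "\<phi> \<in> set (lindenbaum T \<Gamma> l)" by auto
    then have "insert \<phi> A \<subseteq> set (lindenbaum T \<Gamma> (max k l))"
      using lindenbaum_mono[of k "max k l"] lindenbaum_mono[of l "max k l"] by auto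
    then show ?case by blast
  qed simp
  then show ?thesis using assms consistent_subset[OF consistent_lindenbaum] by blast
qed

lemma henkin_Union_lindenbaum: "henkin T (\<Union>k. set (lindenbaum T \<Gamma> k))" (is "henkin T ?H")
proof
  show "consistent T \<Delta>" if "set \<Delta> \<subseteq> ?H" for \<Delta>
    using that by (rule consistent_Union_lindenbaum)
next
  have added: "set (add_witnessed \<phi> (lindenbaum T \<Gamma> (to_nat \<phi>))) \<subseteq> ?H"
    if "consistent T (\<phi> # lindenbaum T \<Gamma> k)" "to_nat \<phi> \<le> k" for \<phi> k
  proof -
    have "consistent T (\<phi> # lindenbaum T \<Gamma> (to_nat \<phi>))"
      by (rule consistent_subset[OF that(1)]) (use lindenbaum_mono[OF that(2)] in auto)
    from add_witnessed_lindenbaum[OF this] show ?thesis by (metis UN_upper UNIV_I)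
  qed
  show "\<phi> \<in> ?H \<or> neg \<phi> \<in> ?H" if "wf_fm \<phi>" for \<phi>
    using consistent_Cons_or_neg[OF consistent_lindenbaum that,
        of "max (to_nat \<phi>) (to_nat (neg \<phi>))"]
      added[of \<phi>] added[of "neg \<phi>"] set_add_witnessed by fastforce
  show "\<exists>n. inst \<phi> [Var n] \<in> ?H" if "Ex \<phi> \<in> ?H" for \<phi>
  proof -
    have "consistent T (Ex \<phi> # lindenbaum T \<Gamma> (to_nat (Ex \<phi>)))"
      by (rule consistent_Union_lindenbaum) (use that in auto)
    from added[OF this] show ?thesis by (auto simp: add_witnessed_def)
  qed
qed

end

lemma ex_henkin:
  assumes "\<forall>\<phi>\<in>T. fv \<phi> = {}" "consistent T [\<phi>]"
  shows "\<exists>H. henkin T H \<and> \<phi> \<in> H"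
proof (intro exI conjI)
  show "henkin T (\<Union>k. set (lindenbaum T [\<phi>] k))" by (rule henkin_Union_lindenbaum[OF assms])
  show "\<phi> \<in> (\<Union>k. set (lindenbaum T [\<phi>] k))" by (rule UN_I[of 0]) simp_all
qed


subsection \<open>Completeness for structures on the natural numbers\<close>

lemma (in henkin) ex_denotation:
  assumes T: "regularity \<in> T" "defining_axiom Zero \<in> T" "defining_axiom Adj \<in> T"
    and wf: "\<forall>\<phi>\<in>T. wf_fm \<phi>"
  shows "\<exists>den :: trm \<Rightarrow> nat. henkin_denotation T H den \<and> range (\<lambda>n. den (Var n)) = UNIV"
proof -
  define cls where "cls t = {n. Eq t (Var n) \<in> H}" for t
  interpret cls: henkin_denotation T H cls
  proof
    fix s t assume wf: "wf_trm s" "wf_trm t"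
    show "cls s = cls t \<longleftrightarrow> Eq s t \<in> H"
    proof
      assume "cls s = cls t"
      moreover obtain n where "Eq s (Var n) \<in> H" using Eq_variable_mem wf by blast
      ultimately have "Eq s (Var n) \<in> H" "Eq t (Var n) \<in> H" by (auto simp: cls_def)
      then show "Eq s t \<in> H" using Eq_sym_mem Eq_trans_mem wf by (meson wf_trm.simps(1))
    next
      assume "Eq s t \<in> H"
      then have "Eq s t \<in> H" "Eq t s \<in> H" using Eq_sym_mem wf by blast+
      then show "cls s = cls t"
        using Eq_trans_mem wf unfolding cls_def by (metis wf_trm.simps(1))
    qed
  qed
  have "sat cls.den_mem cls.den_fun cls.universe (\<lambda>i. cls (Var i)) \<phi>" if "\<phi> \<in> T" for \<phi>
    using cls.sat_den_Var_iff axiom_mem wf that by blast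
  note sat = this
  have "infinite cls.universe"
    by (rule infinite_structure[OF sat[OF T(1)] sat[OF T(2)] sat[OF T(3)]])
      (auto intro: cls.den_fun_in_universe)
  moreover have "countable cls.universe" by (simp add: cls.universe_def)
  ultimately have bij: "bij_betw (to_nat_on cls.universe) cls.universe UNIV"
    by (rule to_nat_on_infinite[rotated])
  define den where "den t = to_nat_on cls.universe (cls t)" for t
  have "henkin_denotation T H den"
    by unfold_locales
      (metis den_def cls.den_eq_iff cls.den_in_universe inj_on_eq_iff bij_betw_imp_inj_on bij)
  moreover have "range (\<lambda>n. den (Var n)) = UNIV"
    using bij by (auto simp: den_def bij_betw_def cls.universe_def image_image)
  ultimately show ?thesis by blast
qed

theorem completeness:
  assumes T: "regularity \<in> T" "defining_axiom Zero \<in> T" "defining_axiom Adj \<in> T"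
    and closed: "\<forall>\<phi>\<in>T. wf_fm \<phi> \<and> fv \<phi> = {}"
    and \<chi>: "wf_fm \<chi>"
    and valid: "\<And>(E :: nat \<Rightarrow> nat \<Rightarrow> bool) F e.
      (\<And>\<phi> e. \<phi> \<in> T \<Longrightarrow> sat E F UNIV e \<phi>) \<Longrightarrow> sat E F UNIV e \<chi>"
  shows "T \<turnstile> \<chi>"
proof (rule ccontr)
  assume "\<not> T \<turnstile> \<chi>"
  then have "consistent T [neg \<chi>]" using \<chi> by (simp add: consistent_def proves_def)
  then obtain H where "henkin T H" "neg \<chi> \<in> H" using ex_henkin closed by blast
  interpret henkin T H by fact
  obtain den :: "trm \<Rightarrow> nat" where "henkin_denotation T H den"
    and univ: "range (\<lambda>n. den (Var n)) = UNIV"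
    using ex_denotation[OF T] closed by blast
  interpret henkin_denotation T H den by fact
  have sat_iff: "sat den_mem den_fun UNIV (\<lambda>i. den (Var i)) \<phi> \<longleftrightarrow> \<phi> \<in> H" if "wf_fm \<phi>" for \<phi>
    using sat_den_Var_iff[OF that] univ by (simp add: universe_def)
  have "sat den_mem den_fun UNIV e \<phi>" if "\<phi> \<in> T" for e \<phi>
    using sat_iff axiom_mem sat_sentence that closed by blast
  then have "\<chi> \<in> H" using valid sat_iff \<chi> by blast
  then show False using \<open>neg \<chi> \<in> H\<close> neg_mem_iff \<chi> by blast
qed


section \<open>Models of primitive recursive set theory\<close>

locale prs_model =
  fixes E :: "'a \<Rightarrow> 'a \<Rightarrow> bool" (infix "\<epsilon>" 50) and F :: "psf \<Rightarrow> 'a list \<Rightarrow> 'a"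
  assumes PRS: "\<phi> \<in> PRS \<Longrightarrow> sat E F UNIV e \<phi>"
begin

abbreviation emp :: 'a where "emp \<equiv> F Zero []"
abbreviation om :: 'a where "om \<equiv> F Omega []"
abbreviation ins :: "'a \<Rightarrow> 'a \<Rightarrow> 'a" where "ins x y \<equiv> F Adj [x, y]"
abbreviation suc :: "'a \<Rightarrow> 'a" where "suc n \<equiv> ins n n"
abbreviation upr :: "'a \<Rightarrow> 'a \<Rightarrow> 'a" where "upr x y \<equiv> ins (ins emp x) y"

abbreviation incl :: "'a \<Rightarrow> 'a \<Rightarrow> bool" (infix "\<sqsubseteq>" 50) where
  "a \<sqsubseteq> b \<equiv> \<forall>x. x \<epsilon> a \<longrightarrow> x \<epsilon> b"

definition transitive_set :: "'a \<Rightarrow> bool" where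
  "transitive_set a \<longleftrightarrow> (\<forall>x. x \<epsilon> a \<longrightarrow> x \<sqsubseteq> a)"


subsection \<open>The axioms\<close>

lemma defining_axiom: "wf_psf f \<Longrightarrow> sat E F UNIV e (defining_axiom f)"
  by (rule PRS) (auto simp: PRS_def)

lemma ext: "(\<And>x. x \<epsilon> a \<longleftrightarrow> x \<epsilon> b) \<Longrightarrow> a = b"
  using PRS[of extensionality undefined] by (simp add: PRS_def extensionality_def)

lemma not_in_emp [simp]: "\<not> x \<epsilon> emp"
  using defining_axiom[of Zero undefined] by simp

lemma in_ins [simp]: "u \<epsilon> ins x y \<longleftrightarrow> u \<epsilon> x \<or> u = y"
  using defining_axiom[of Adj undefined] by (simp add: Alls_def numeral_3_eq_3)

lemma nonempty: "a \<noteq> emp \<longleftrightarrow> (\<exists>x. x \<epsilon> a)"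
  using ext[of a emp] by auto

lemma regular: "x \<epsilon> a \<Longrightarrow> \<exists>y. y \<epsilon> a \<and> (\<forall>z. z \<epsilon> a \<longrightarrow> \<not> z \<epsilon> y)"
  using PRS[of regularity undefined] nonempty[of a] by (auto simp: PRS_def regularity_def)

lemma mem_irrefl: "\<not> x \<epsilon> x"
  using regular[of x "ins emp x"] by auto

lemma sat_Subset [simp]: "sat E F UNIV e (Subset s t) \<longleftrightarrow> val F e s \<sqsubseteq> val F e t"
  by (simp add: Subset_def)

lemma om_axiom:
  "emp \<epsilon> om \<and> (\<forall>n. n \<epsilon> om \<longrightarrow> suc n \<epsilon> om) \<and>
   (\<forall>a. emp \<epsilon> a \<and> (\<forall>n. n \<epsilon> a \<longrightarrow> suc n \<epsilon> a) \<longrightarrow> om \<sqsubseteq> a)"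
proof -
  have sat_Inductive: "sat E F UNIV e (Inductive t) \<longleftrightarrow>
      emp \<epsilon> val F e t \<and> (\<forall>n. n \<epsilon> val F e t \<longrightarrow> suc n \<epsilon> val F e t)" for e t
    by (simp add: Inductive_def del: in_ins)
  have "sat E F UNIV undefined (defining_axiom Omega)" by (rule defining_axiom) simp
  then show ?thesis
    unfolding defining_axiom.simps sat.simps sat_Imp sat_Subset sat_Inductive val.simps list.map
      build.simps ball_UNIV conj_assoc .
qed

lemma emp_om: "emp \<epsilon> om" and suc_om: "n \<epsilon> om \<Longrightarrow> suc n \<epsilon> om"
  and om_least: "emp \<epsilon> a \<Longrightarrow> (\<And>n. n \<epsilon> a \<Longrightarrow> suc n \<epsilon> a) \<Longrightarrow> n \<epsilon> om \<Longrightarrow> n \<epsilon> a"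
  using om_axiom by blast+

lemma cond: "F Cond [x, y, u, v] = (if u \<epsilon> v then x else y)"
  using defining_axiom[of Cond undefined, unfolded defining_axiom.simps sat_Alls, THEN spec,
      of "[x, y, u, v]"] by simp

lemma proj: "i < length xs \<Longrightarrow> F (Proj (length xs) i) xs = xs ! i"
  using defining_axiom[of "Proj (length xs) i" undefined]
  using map_conc_upt[of "[]" 0 xs] by (auto simp: sat_Alls o_def dest!: spec[of _ xs])

lemma comp:
  "wf_psf (Comp (length xs) g hs) \<Longrightarrow> F (Comp (length xs) g hs) xs = F g (map (\<lambda>h. F h xs) hs)"
  using defining_axiom[of "Comp (length xs) g hs" undefined]
  using map_conc_upt[of "[]" 0 xs] by (auto simp: sat_Alls o_def dest!: spec[of _ xs])

lemma rec:
  assumes "wf_psf g" "arity g = length xs + 2"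
  shows "\<exists>w. (\<forall>v. v \<epsilon> w \<longleftrightarrow> (\<exists>u. u \<epsilon> z \<and> v \<epsilon> F (Rec g) (u # xs))) \<and>
    F (Rec g) (z # xs) = F g (w # z # xs)"
proof -
  let ?n = "length xs + 1"
  have params: "map (u ## v ## w ## z ## xs \<frown> e) [4..<?n + 3] = xs" for u v w e
    using map_conc_upt[of "[u, v, w, z]" 4 xs "length xs"]
    by (simp del: upt_Suc add: numeral_eq_Suc)
  have args: "map (w ## z ## xs \<frown> e) [1..<?n + 1] = z # xs"
      "map (w ## z ## xs \<frown> e) [0..<?n + 1] = w # z # xs" for w e
    using map_conc_upt[of "[w]" 1 "z # xs"] map_conc_upt[of "[]" 0 "w # z # xs"]
    by (simp_all del: upt_Suc)
  have "sat E F UNIV undefined (defining_axiom (Rec g))"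
    by (rule defining_axiom) (use assms in simp)
  then have "sat E F UNIV ((z # xs) \<frown> undefined) (Ex (And
        (All (Iff (Mem (Var 0) (Var 1))
                  (BEx (Var 2) (Mem (Var 1) (Fn (Rec g) (Var 0 # map Var [4..<?n + 3]))))))
        (Eq (Fn (Rec g) (map Var [1..<?n + 1])) (Fn g (map Var [0..<?n + 1])))))"
    unfolding defining_axiom.simps Let_def sat_Alls arity.simps assms(2)
    by (elim allE[of _ "z # xs"]) simp
  then show ?thesis
    unfolding build_cons sat.simps sat_Iff sat_BEx val.simps list.map map_map o_def params args
    by (simp add: numeral_2_eq_2)
qed


subsection \<open>Primitive recursive functions and predicates\<close>

inductive prim_rec :: "((nat \<Rightarrow> 'a) \<Rightarrow> 'a) \<Rightarrow> bool" where
  prim_rec_var: "prim_rec (\<lambda>e. e i)"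
| prim_rec_const: "prim_rec (\<lambda>e. a)"
| prim_rec_app: "wf_psf g \<Longrightarrow> length hs = arity g \<Longrightarrow> (\<And>h. h \<in> set hs \<Longrightarrow> prim_rec h) \<Longrightarrow>
    prim_rec (\<lambda>e. F g (map (\<lambda>h. h e) hs))"

lemma prim_rec_subst:
  assumes "prim_rec f" "\<And>i. prim_rec (g i)"
  shows "prim_rec (\<lambda>e. f (\<lambda>i. g i e))"
  using assms(1)
proof induction
  case (prim_rec_app k hs)
  have "prim_rec (\<lambda>e. F k (map (\<lambda>h. h e) (map (\<lambda>h e. h (\<lambda>i. g i e)) hs)))"
    by (rule prim_rec.prim_rec_app) (use prim_rec_app in auto)
  then show ?case by (simp add: o_def)
qed (auto intro: assms(2) prim_rec_const)

lemma prim_rec_ins: "prim_rec f \<Longrightarrow> prim_rec g \<Longrightarrow> prim_rec (\<lambda>e. ins (f e) (g e))"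
  using prim_rec_app[of Adj "[f, g]"] by auto

lemma prim_rec_if_mem:
  "prim_rec f \<Longrightarrow> prim_rec g \<Longrightarrow> prim_rec h \<Longrightarrow> prim_rec k \<Longrightarrow>
    prim_rec (\<lambda>e. if h e \<epsilon> k e then f e else g e)"
  using prim_rec_app[of Cond "[f, g, h, k]"] by (auto simp: cond)

end

definition argument :: "'a set \<Rightarrow> ((nat \<Rightarrow> 'a) \<Rightarrow> 'a) \<Rightarrow> bool" where
  "argument A f \<longleftrightarrow> (\<exists>i. f = (\<lambda>e. e i)) \<or> (\<exists>a\<in>A. f = (\<lambda>e. a))"

named_theorems argument_intros

lemma argument_var [argument_intros]: "argument A (\<lambda>e. e i)"
  and argument_parameter [argument_intros]: "argument (insert a A) (\<lambda>e. a)"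
  and argument_parameter_UNIV [argument_intros]: "argument UNIV (\<lambda>e. a)"
  by (auto simp: argument_def)

lemma argument_cases [consumes 1, case_names variable parameter]:
  assumes "argument A f"
  obtains i where "f = (\<lambda>e. e i)" | a where "a \<in> A" "f = (\<lambda>e. a)"
  using assms unfolding argument_def by blast

context prs_model
begin

lemma prim_rec_argument: "argument A f \<Longrightarrow> prim_rec f"
  by (cases rule: argument_cases) (auto intro: prim_rec_var prim_rec_const)

definition computes :: "((nat \<Rightarrow> 'a) \<Rightarrow> 'a) list \<Rightarrow> psf \<Rightarrow> ((nat \<Rightarrow> 'a) \<Rightarrow> 'a) \<Rightarrow> bool" where
  "computes gs p f \<longleftrightarrow> wf_psf p \<and> arity p = length gs \<and> (\<forall>e. F p (map (\<lambda>g. g e) gs) = f e)"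

lemma computes_Proj:
  assumes "f \<in> set gs" shows "\<exists>p. computes gs p f"
proof -
  obtain j where "j < length gs" "gs ! j = f" using assms by (auto simp: in_set_conv_nth)
  then have "computes gs (Proj (length gs) j) f"
    using proj[of j "map (\<lambda>g. g _) gs"] by (simp add: computes_def)
  then show ?thesis ..
qed

lemma computes_Comp:
  assumes "wf_psf k" "length hs = arity k" "\<And>h. h \<in> set hs \<Longrightarrow> \<exists>p. computes gs p h"
  shows "\<exists>p. computes gs p (\<lambda>e. F k (map (\<lambda>h. h e) hs))"
proof -
  obtain p where p: "\<And>h. h \<in> set hs \<Longrightarrow> computes gs (p h) h" using assms(3) by metis
  have "computes gs (Comp (length gs) k (map p hs)) (\<lambda>e. F k (map (\<lambda>h. h e) hs))"
    using assms(1,2) p comp[of "map (\<lambda>g. g _) gs" k "map p hs"]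
    by (simp add: computes_def list_all_iff o_def cong: map_cong)
  then show ?thesis ..
qed

text \<open>Quantifying over all lists that contain the required arguments provides common arities.\<close>

lemma prim_rec_computes:
  assumes "prim_rec f"
  shows "\<exists>G. finite G \<and> (\<forall>g\<in>G. argument UNIV g) \<and> (\<forall>gs. G \<subseteq> set gs \<longrightarrow> (\<exists>p. computes gs p f))"
  using assms
proof induction
  case (prim_rec_var i)
  show ?case by (rule exI[of _ "{\<lambda>e. e i}"]) (auto intro: argument_intros computes_Proj)
next
  case (prim_rec_const a)
  show ?case by (rule exI[of _ "{\<lambda>e. a}"]) (auto intro: argument_intros computes_Proj)
next
  case (prim_rec_app k hs)
  then obtain G where G: "\<And>h. h \<in> set hs \<Longrightarrow> finite (G h) \<and> (\<forall>g\<in>G h. argument UNIV g) \<and>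
      (\<forall>gs. G h \<subseteq> set gs \<longrightarrow> (\<exists>p. computes gs p h))"
    by metis
  have "\<exists>p. computes gs p (\<lambda>e. F k (map (\<lambda>h. h e) hs))" if "(\<Union>h\<in>set hs. G h) \<subseteq> set gs" for gs
    by (rule computes_Comp[OF prim_rec_app.hyps(1,2)]) (use G that in blast)
  then show ?case using G by (intro exI[of _ "\<Union>h\<in>set hs. G h"]) auto
qed

lemma prim_rec_binary_symbol:
  assumes "prim_rec (\<lambda>e. h (e 0) (e 1) (\<lambda>i. e (Suc (Suc i))))"
  shows "\<exists>p gs. wf_psf p \<and> arity p = length gs + 2 \<and> (\<forall>g\<in>set gs. prim_rec g) \<and>
    (\<forall>w z e. F p (w # z # map (\<lambda>g. g e) gs) = h w z e)"
proof -
  obtain G where G: "finite G" "\<And>g. g \<in> G \<Longrightarrow> argument UNIV g" and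
    symbol: "\<And>gs. G \<subseteq> set gs \<Longrightarrow> \<exists>p. computes gs p (\<lambda>e. h (e 0) (e 1) (\<lambda>i. e (Suc (Suc i))))"
    using prim_rec_computes[OF assms] by blast
  obtain gs where gs: "set gs = G - {\<lambda>e. e 0, \<lambda>e. e 1}"
    using finite_list[of "G - _"] G(1) by blast
  then obtain p where p: "wf_psf p" "arity p = length gs + 2"
    "\<And>e. F p (e 0 # e 1 # map (\<lambda>g. g e) gs) = h (e 0) (e 1) (\<lambda>i. e (Suc (Suc i)))"
    using symbol[of "(\<lambda>e. e 0) # (\<lambda>e. e 1) # gs"] unfolding computes_def by force
  have independent: "g (w ## z ## e) = g (emp ## emp ## e)" if g: "g \<in> set gs" for g w z e
  proof -
    have "argument UNIV g" using g G(2) gs by blast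
    then show ?thesis
    proof (cases rule: argument_cases)
      case (variable i)
      have "g \<noteq> (\<lambda>e. e 0)" "g \<noteq> (\<lambda>e. e 1)" using g gs by simp_all
      then have "i \<noteq> 0" "i \<noteq> Suc 0" using variable by auto
      then show ?thesis using variable by (cases i; cases "i - 1") simp_all
    qed simp
  qed
  show ?thesis
  proof (intro exI[of _ p] exI[of _ "map (\<lambda>g e. g (emp ## emp ## e)) gs"] conjI ballI allI p(1))
    have args: "prim_rec (\<lambda>e. (emp ## emp ## e) j)" for j
      by (cases j; cases "j - 1") (auto intro: prim_rec_var prim_rec_const)
    have "prim_rec (\<lambda>e. g (emp ## emp ## e))" if "g \<in> set gs" for g
      using prim_rec_subst[OF prim_rec_argument[OF G(2)], of g "\<lambda>j e. (emp ## emp ## e) j"]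
        that gs args by simp
    then show "prim_rec g" if "g \<in> set (map (\<lambda>g e. g (emp ## emp ## e)) gs)" for g
      using that by auto
    show "F p (w # z # map (\<lambda>g. g e) (map (\<lambda>g e. g (emp ## emp ## e)) gs)) = h w z e" for w z e
    proof -
      have "map (\<lambda>g. g (w ## z ## e)) gs = map (\<lambda>g. g (emp ## emp ## e)) gs"
        by (rule map_cong) (simp_all add: independent[of _ w z e])
      then show ?thesis using p(3)[of "w ## z ## e"] by (simp add: o_def del: map_eq_conv)
    qed
  qed (simp add: p(2))
qed

lemma prim_rec_recursion:
  assumes "prim_rec (\<lambda>e. h (e 0) (e 1) (\<lambda>i. e (Suc (Suc i))))"
  obtains R where "prim_rec (\<lambda>e. R (e 0) (\<lambda>i. e (Suc i)))"
    "\<And>z e. \<exists>w. (\<forall>v. v \<epsilon> w \<longleftrightarrow> (\<exists>u. u \<epsilon> z \<and> v \<epsilon> R u e)) \<and> R z e = h w z e"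
proof -
  obtain p gs where p: "wf_psf p" "arity p = length gs + 2" and gs: "\<forall>g\<in>set gs. prim_rec g"
    and p_eq: "\<forall>w z e. F p (w # z # map (\<lambda>g. g e) gs) = h w z e"
    using prim_rec_binary_symbol[of h, OF assms] by blast
  define R where "R z e = F (Rec p) (z # map (\<lambda>g. g e) gs)" for z e
  show ?thesis
  proof (rule that[of R])
    have "prim_rec (\<lambda>e. F (Rec p) (map (\<lambda>h. h e)
        ((\<lambda>e. e 0) # map (\<lambda>g e. g (\<lambda>i. e (Suc i))) gs)))"
      by (intro prim_rec_app)
        (use p gs in \<open>auto intro: prim_rec_var prim_rec_subst[OF _ prim_rec_var]\<close>)
    then show "prim_rec (\<lambda>e. R (e 0) (\<lambda>i. e (Suc i)))" by (simp add: R_def o_def)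
    show "\<exists>w. (\<forall>v. v \<epsilon> w \<longleftrightarrow> (\<exists>u. u \<epsilon> z \<and> v \<epsilon> R u e)) \<and> R z e = h w z e" for z e
      using rec[OF p(1), of "map (\<lambda>g. g e) gs" z] p(2) p_eq by (simp add: R_def)
  qed
qed

text \<open>
  The recursion \<open>R(z, y) = (if z \<epsilon> y then h(z) else \<Union>u\<epsilon>z. R(u, y))\<close> turns the union over values of
  \<open>R\<close> itself into a union over values of \<open>h\<close>, by taking \<open>z = y\<close>.
\<close>

lemma prim_rec_Union:
  assumes f: "prim_rec f" and h: "prim_rec (\<lambda>e. h (e 0) (\<lambda>i. e (Suc i)))"
  obtains g where "prim_rec g" "\<And>e v. v \<epsilon> g e \<longleftrightarrow> (\<exists>u. u \<epsilon> f e \<and> v \<epsilon> h u e)"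
proof -
  let ?H = "\<lambda>w z e. if z \<epsilon> e 0 then h z (\<lambda>i. e (Suc i)) else w"
  let ?shift = "(\<lambda>e. e 1) ## (\<lambda>i e. e (Suc (Suc (Suc i))))"
  have "prim_rec (?shift i)" for i by (cases i) (auto intro: prim_rec_var)
  with prim_rec_subst[OF h, of ?shift] have "prim_rec (\<lambda>e. h (e 1) (\<lambda>i. e (Suc (Suc (Suc i)))))"
    by simp
  then have "prim_rec (\<lambda>e. ?H (e 0) (e 1) (\<lambda>i. e (Suc (Suc i))))"
    by (intro prim_rec_if_mem prim_rec_var)
  then obtain R where R: "prim_rec (\<lambda>e. R (e 0) (\<lambda>i. e (Suc i)))"
    "\<And>z e. \<exists>w. (\<forall>v. v \<epsilon> w \<longleftrightarrow> (\<exists>u. u \<epsilon> z \<and> v \<epsilon> R u e)) \<and> R z e = ?H w z e"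
    using prim_rec_recursion[of ?H] by blast
  show ?thesis
  proof (rule that)
    let ?args = "f ## f ## (\<lambda>i e. e i)"
    have "prim_rec (?args i)" for i by (cases i; cases "i - 1") (auto intro: f prim_rec_var)
    with prim_rec_subst[OF R(1), of ?args] show "prim_rec (\<lambda>e. R (f e) (f e ## e))"
      by (simp add: comp_build[of "\<lambda>f. f _"])
    have "R u (y ## e) = h u e" if "u \<epsilon> y" for u y e using R(2)[of u "y ## e"] that by simp
    then show "v \<epsilon> R (f e) (f e ## e) \<longleftrightarrow> (\<exists>u. u \<epsilon> f e \<and> v \<epsilon> h u e)" for e v
      using R(2)[of "f e" "f e ## e"] mem_irrefl[of "f e"] by auto
  qed
qed

definition prim_rec_pred :: "((nat \<Rightarrow> 'a) \<Rightarrow> bool) \<Rightarrow> bool" where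
  "prim_rec_pred P \<longleftrightarrow> prim_rec (\<lambda>e. if P e then ins emp emp else emp)"

lemma prim_rec_If:
  assumes "prim_rec_pred P" "prim_rec f" "prim_rec g"
  shows "prim_rec (\<lambda>e. if P e then f e else g e)"
proof -
  have "emp \<epsilon> (if P e then ins emp emp else emp) \<longleftrightarrow> P e" for e by simp
  then show ?thesis
    using prim_rec_if_mem[OF assms(2,3) prim_rec_const[of emp] assms(1)[unfolded prim_rec_pred_def]]
    by (simp only:)
qed

lemma prim_rec_pred_mem: "prim_rec f \<Longrightarrow> prim_rec g \<Longrightarrow> prim_rec_pred (\<lambda>e. f e \<epsilon> g e)"
  unfolding prim_rec_pred_def by (intro prim_rec_if_mem prim_rec_const)

lemma prim_rec_pred_eq: "prim_rec f \<Longrightarrow> prim_rec g \<Longrightarrow> prim_rec_pred (\<lambda>e. f e = g e)"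
  using prim_rec_pred_mem[of f "\<lambda>e. ins emp (g e)"] by (simp add: prim_rec_ins prim_rec_const)

lemma prim_rec_pred_not:
  assumes "prim_rec_pred P" shows "prim_rec_pred (\<lambda>e. \<not> P e)"
proof -
  have "prim_rec (\<lambda>e. if P e then emp else ins emp emp)"
    using assms by (intro prim_rec_If prim_rec_const)
  moreover have "(if P e then emp else ins emp emp) = (if \<not> P e then ins emp emp else emp)" for e
    by simp
  ultimately show ?thesis by (simp only: prim_rec_pred_def)
qed

lemma prim_rec_pred_conj:
  assumes "prim_rec_pred P" "prim_rec_pred Q" shows "prim_rec_pred (\<lambda>e. P e \<and> Q e)"
proof -
  have "prim_rec (\<lambda>e. if P e then if Q e then ins emp emp else emp else emp)"
    using assms by (intro prim_rec_If prim_rec_const)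
  moreover have "(if P e then if Q e then ins emp emp else emp else emp) =
      (if P e \<and> Q e then ins emp emp else emp)" for e
    by simp
  ultimately show ?thesis by (simp add: prim_rec_pred_def)
qed

lemma prim_rec_pred_disj:
  "prim_rec_pred P \<Longrightarrow> prim_rec_pred Q \<Longrightarrow> prim_rec_pred (\<lambda>e. P e \<or> Q e)"
  using prim_rec_pred_not[OF prim_rec_pred_conj[OF prim_rec_pred_not[of P] prim_rec_pred_not[of Q]]]
  by simp

lemma prim_rec_pred_bex:
  assumes "prim_rec f" "prim_rec_pred (\<lambda>e. P (e 0) (\<lambda>i. e (Suc i)))"
  shows "prim_rec_pred (\<lambda>e. \<exists>u. u \<epsilon> f e \<and> P u e)"
proof -
  obtain g where g: "prim_rec g"
    "\<And>e v. v \<epsilon> g e \<longleftrightarrow> (\<exists>u. u \<epsilon> f e \<and> v \<epsilon> (if P u e then ins emp emp else emp))"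
    using prim_rec_Union[of f "\<lambda>u e. if P u e then ins emp emp else emp"] assms
    unfolding prim_rec_pred_def by blast
  have "prim_rec_pred (\<lambda>e. emp \<epsilon> g e)" by (intro prim_rec_pred_mem prim_rec_const g(1))
  moreover have "emp \<epsilon> g e \<longleftrightarrow> (\<exists>u. u \<epsilon> f e \<and> P u e)" for e unfolding g(2) by auto
  ultimately show ?thesis by simp
qed

lemma prim_rec_pred_ball:
  assumes "prim_rec f" "prim_rec_pred (\<lambda>e. P (e 0) (\<lambda>i. e (Suc i)))"
  shows "prim_rec_pred (\<lambda>e. \<forall>u. u \<epsilon> f e \<longrightarrow> P u e)"
  using prim_rec_pred_not[OF prim_rec_pred_bex[of f "\<lambda>u e. \<not> P u e"]]
    assms(1) prim_rec_pred_not[OF assms(2)] by simp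

lemma prim_rec_pred_subst:
  "prim_rec_pred P \<Longrightarrow> (\<And>i. prim_rec (g i)) \<Longrightarrow> prim_rec_pred (\<lambda>e. P (\<lambda>i. g i e))"
  unfolding prim_rec_pred_def by (rule prim_rec_subst)


subsection \<open>Existence of sets\<close>

definition is_set :: "('a \<Rightarrow> bool) \<Rightarrow> bool" where
  "is_set P \<longleftrightarrow> (\<exists>b. \<forall>v. v \<epsilon> b \<longleftrightarrow> P v)"

lemma is_set_Union:
  assumes "prim_rec (\<lambda>e. h (e 0))"
  shows "is_set (\<lambda>v. \<exists>u. u \<epsilon> a \<and> v \<epsilon> h u)"
  using prim_rec_Union[of "\<lambda>_. a" "\<lambda>u _. h u"] prim_rec_const assms
  unfolding is_set_def by metis

lemma is_set_image:
  assumes "prim_rec (\<lambda>e. h (e 0))"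
  shows "is_set (\<lambda>v. \<exists>u. u \<epsilon> a \<and> v = h u)"
  using is_set_Union[of "\<lambda>u. ins emp (h u)" a] assms by (simp add: prim_rec_ins prim_rec_const)

lemma separation:
  assumes "prim_rec_pred (\<lambda>e. P (e 0))"
  shows "is_set (\<lambda>v. v \<epsilon> a \<and> P v)"
proof -
  have "is_set (\<lambda>v. \<exists>u. u \<epsilon> a \<and> v \<epsilon> (if P u then ins emp u else emp))"
    by (intro is_set_Union prim_rec_If assms prim_rec_ins prim_rec_const prim_rec_var)
  moreover have "(\<exists>u. u \<epsilon> a \<and> v \<epsilon> (if P u then ins emp u else emp)) \<longleftrightarrow> v \<epsilon> a \<and> P v" for v
    by (auto split: if_splits)
  ultimately show ?thesis by simp
qed

lemma ex_minimal:
  assumes "prim_rec_pred (\<lambda>e. P (e 0))" "x \<epsilon> a" "P x"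
  shows "\<exists>y. y \<epsilon> a \<and> P y \<and> (\<forall>z. z \<epsilon> a \<longrightarrow> P z \<longrightarrow> \<not> z \<epsilon> y)"
proof -
  obtain b where "\<And>v. v \<epsilon> b \<longleftrightarrow> v \<epsilon> a \<and> P v"
    using separation[OF assms(1)] unfolding is_set_def by blast
  then show ?thesis using regular[of x b] assms by auto
qed

text \<open>The sets \<open>F(n) = \<Union>({a} \<union> \<Union>m\<epsilon>n. F(m))\<close> for \<open>n \<epsilon> \<omega>\<close> exhaust the transitive closure of \<open>a\<close>.\<close>

lemma ex_transitive_superset: "\<exists>t. a \<sqsubseteq> t \<and> transitive_set t"
proof -
  obtain g where g: "prim_rec g" "\<And>e v. v \<epsilon> g e \<longleftrightarrow> (\<exists>u. u \<epsilon> ins (e 0) a \<and> v \<epsilon> u)"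
    using prim_rec_Union[of "\<lambda>e. ins (e 0) a" "\<lambda>u _. u",
        OF prim_rec_ins[OF prim_rec_var prim_rec_const] prim_rec_var] by blast
  have "prim_rec (\<lambda>e. g (\<lambda>i. e 0))" by (rule prim_rec_subst[OF g(1) prim_rec_var])
  then obtain R where R: "prim_rec (\<lambda>e. R (e 0) (\<lambda>i. e (Suc i)))"
    "\<And>n e. \<exists>w. (\<forall>v. v \<epsilon> w \<longleftrightarrow> (\<exists>m. m \<epsilon> n \<and> v \<epsilon> R m e)) \<and> R n e = g (\<lambda>i. w)"
    using prim_rec_recursion[of "\<lambda>w z e. g (\<lambda>i. w)"] by blast
  define f where "f n = R n (\<lambda>_. emp)" for n
  have f: "v \<epsilon> f n \<longleftrightarrow> v \<epsilon> a \<or> (\<exists>m u. m \<epsilon> n \<and> u \<epsilon> f m \<and> v \<epsilon> u)" for v n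
  proof -
    obtain w where w: "\<forall>v. v \<epsilon> w \<longleftrightarrow> (\<exists>m. m \<epsilon> n \<and> v \<epsilon> f m)" "f n = g (\<lambda>i. w)"
      using R(2)[of n "\<lambda>_. emp"] unfolding f_def by blast
    have "v \<epsilon> f n \<longleftrightarrow> (\<exists>u. u \<epsilon> ins w a \<and> v \<epsilon> u)" unfolding w(2) g(2) ..
    also have "\<dots> \<longleftrightarrow> v \<epsilon> a \<or> (\<exists>m u. m \<epsilon> n \<and> u \<epsilon> f m \<and> v \<epsilon> u)"
      unfolding in_ins w(1)[rule_format] by blast
    finally show ?thesis .
  qed
  let ?args = "(\<lambda>e. e 0) ## (\<lambda>_ _. emp)"
  have "prim_rec (?args i)" for i by (cases i) (auto intro: prim_rec_var prim_rec_const)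
  with prim_rec_subst[OF R(1), of ?args] have "prim_rec (\<lambda>e. f (e 0))" by (simp add: f_def)
  then obtain t where t: "\<And>v. v \<epsilon> t \<longleftrightarrow> (\<exists>n. n \<epsilon> om \<and> v \<epsilon> f n)"
    using is_set_Union unfolding is_set_def by blast
  have "a \<sqsubseteq> t" using t f emp_om by blast
  moreover have "y \<epsilon> t" if "x \<epsilon> t" "y \<epsilon> x" for x y
  proof -
    obtain n where "n \<epsilon> om" "x \<epsilon> f n" using t \<open>x \<epsilon> t\<close> by blast
    then have "suc n \<epsilon> om" "y \<epsilon> f (suc n)" using suc_om f[of y "suc n"] \<open>y \<epsilon> x\<close> by auto
    then show ?thesis using t by blast
  qed
  ultimately show ?thesis unfolding transitive_set_def by blast
qed

end


section \<open>Definability\<close>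

subsection \<open>Definable predicates\<close>

definition Delta0_fms :: "fm set" where
  "Delta0_fms = {\<phi>. sigma_fm \<phi> \<and> pi_fm \<phi>}"

definition set_fms :: "fm set" where
  "set_fms = {\<phi>. set_fm \<phi>}"

definition formula_class :: "fm set \<Rightarrow> bool" where
  "formula_class K \<longleftrightarrow> (\<forall>i j. Mem (Var i) (Var j) \<in> K \<and> Eq (Var i) (Var j) \<in> K) \<and>
    (\<forall>\<phi>\<in>K. neg \<phi> \<in> K \<and> (\<forall>\<psi>\<in>K. And \<phi> \<psi> \<in> K) \<and> (\<forall>i. BEx (Var i) \<phi> \<in> K) \<and>
      (\<forall>\<rho>. sb (\<lambda>i. Var (\<rho> i)) \<phi> \<in> K))"

lemma formula_classD:
  assumes "formula_class K"
  shows "Mem (Var i) (Var j) \<in> K" and "Eq (Var i) (Var j) \<in> K"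
    and "\<phi> \<in> K \<Longrightarrow> neg \<phi> \<in> K" and "\<phi> \<in> K \<Longrightarrow> \<psi> \<in> K \<Longrightarrow> And \<phi> \<psi> \<in> K"
    and "\<phi> \<in> K \<Longrightarrow> BEx (Var i) \<phi> \<in> K" and "\<phi> \<in> K \<Longrightarrow> sb (\<lambda>i. Var (\<rho> i)) \<phi> \<in> K"
  using assms by (simp_all add: formula_class_def)

named_theorems definable_intros

lemma formula_class_set_fms [definable_intros]: "formula_class set_fms"
  by (auto simp: formula_class_def set_fms_def set_fm_rename BEx_def)

lemma formula_class_Delta0_fms [definable_intros]: "formula_class Delta0_fms"
proof -
  have "sigma_fm (BEx (Var i) \<phi>)" if "sigma_fm \<phi>" for i \<phi>
    unfolding BEx_def using that by (auto intro!: sigma_fm.intros)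
  then show ?thesis
    unfolding formula_class_def Delta0_fms_def
    by (auto intro: sigma_fm.intros pi_fm.intros sigma_fm_neg pi_fm_neg sigma_fm_rename
        pi_fm_rename)
qed

lemma Delta0_fms_subset: "Delta0_fms \<subseteq> set_fms"
  by (auto simp: Delta0_fms_def set_fms_def sigma_fm_set_fm)

lemma argument_mono: "argument A f \<Longrightarrow> A \<subseteq> B \<Longrightarrow> argument B f"
  by (auto simp: argument_def)

lemma argument_Suc: "argument A f \<Longrightarrow> argument A (\<lambda>e. f (\<lambda>i. e (Suc i)))"
  by (auto simp: argument_def)

lemma argument_build: "argument A f \<Longrightarrow> (\<And>i. argument A (g i)) \<Longrightarrow> argument A ((f ## g) i)"
  by (cases i) simp_all

context prs_model
begin

definition definable :: "fm set \<Rightarrow> 'a set \<Rightarrow> ((nat \<Rightarrow> 'a) \<Rightarrow> bool) \<Rightarrow> bool" where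
  "definable K A P \<longleftrightarrow>
    (\<exists>\<phi>\<in>K. \<exists>g. (\<forall>i. argument A (g i)) \<and> (\<forall>e. P e \<longleftrightarrow> sat E F UNIV (\<lambda>i. g i e) \<phi>))"

abbreviation Delta0 :: "'a set \<Rightarrow> ((nat \<Rightarrow> 'a) \<Rightarrow> bool) \<Rightarrow> bool" where
  "Delta0 \<equiv> definable Delta0_fms"

abbreviation first_order :: "((nat \<Rightarrow> 'a) \<Rightarrow> bool) \<Rightarrow> bool" where
  "first_order \<equiv> definable set_fms UNIV"

lemma definableI:
  "\<phi> \<in> K \<Longrightarrow> (\<And>i. argument A (g i)) \<Longrightarrow> (\<And>e. P e \<longleftrightarrow> sat E F UNIV (\<lambda>i. g i e) \<phi>) \<Longrightarrow>
    definable K A P"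
  unfolding definable_def by blast

lemma definableE:
  assumes "definable K A P"
  obtains \<phi> g where "\<phi> \<in> K" "\<And>i. argument A (g i)" "\<And>e. P e \<longleftrightarrow> sat E F UNIV (\<lambda>i. g i e) \<phi>"
  using assms unfolding definable_def by blast

lemma definable_mono: "definable K A P \<Longrightarrow> K \<subseteq> K' \<Longrightarrow> A \<subseteq> A' \<Longrightarrow> definable K' A' P"
  unfolding definable_def using argument_mono by (meson subsetD)

lemma definable_subst:
  assumes "definable K A P" "\<And>i. argument A (g i)"
  shows "definable K A (\<lambda>e. P (\<lambda>i. g i e))"
proof -
  obtain \<phi> k where k: "\<phi> \<in> K" "\<And>i. argument A (k i)" "\<And>e. P e \<longleftrightarrow> sat E F UNIV (\<lambda>i. k i e) \<phi>"
    using definableE[OF assms(1)] by blast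
  have "argument A (\<lambda>e. k i (\<lambda>j. g j e))" for i
    using k(2)[of i] assms(2) by (cases rule: argument_cases) (auto simp: argument_def)
  then show ?thesis using k(1,3) by (intro definableI[of \<phi>])
qed

lemma definable_subst1:
  "definable K A (\<lambda>e. P (e 0)) \<Longrightarrow> argument A f \<Longrightarrow> definable K A (\<lambda>e. P (f e))"
  using definable_subst[of K A "\<lambda>e. P (e 0)" "\<lambda>_. f"] by simp

lemma definable_subst2:
  "definable K A (\<lambda>e. P (e 0) (e 1)) \<Longrightarrow> argument A f \<Longrightarrow> argument A g \<Longrightarrow>
    definable K A (\<lambda>e. P (f e) (g e))"
  using definable_subst[of K A "\<lambda>e. P (e 0) (e 1)" "f ## (\<lambda>_. g)"] by (simp add: argument_build)

lemma definable_subst3: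
  "definable K A (\<lambda>e. P (e 0) (e 1) (e 2)) \<Longrightarrow> argument A f \<Longrightarrow> argument A g \<Longrightarrow> argument A h \<Longrightarrow>
    definable K A (\<lambda>e. P (f e) (g e) (h e))"
  using definable_subst[of K A "\<lambda>e. P (e 0) (e 1) (e 2)" "f ## g ## (\<lambda>_. h)"]
  by (simp add: argument_build)

lemma definable_subst4:
  "definable K A (\<lambda>e. P (e 0) (e 1) (e 2) (e 3)) \<Longrightarrow> argument A f \<Longrightarrow> argument A g \<Longrightarrow>
    argument A h \<Longrightarrow> argument A k \<Longrightarrow> definable K A (\<lambda>e. P (f e) (g e) (h e) (k e))"
  using definable_subst[of K A "\<lambda>e. P (e 0) (e 1) (e 2) (e 3)" "f ## g ## h ## (\<lambda>_. k)"]
  by (simp add: argument_build)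

lemma definable_mem_argument:
  "formula_class K \<Longrightarrow> argument A f \<Longrightarrow> argument A g \<Longrightarrow> definable K A (\<lambda>e. f e \<epsilon> g e)"
  by (rule definableI[of "Mem (Var 0) (Var 1)" _ _ "f ## (\<lambda>_. g)"])
    (auto simp: formula_class_def argument_build)

lemma definable_eq_argument:
  "formula_class K \<Longrightarrow> argument A f \<Longrightarrow> argument A g \<Longrightarrow> definable K A (\<lambda>e. f e = g e)"
  by (rule definableI[of "Eq (Var 0) (Var 1)" _ _ "f ## (\<lambda>_. g)"])
    (auto simp: formula_class_def argument_build)

lemma definable_not [definable_intros]:
  "formula_class K \<Longrightarrow> definable K A P \<Longrightarrow> definable K A (\<lambda>e. \<not> P e)"
  unfolding definable_def formula_class_def by (metis sat_neg)

lemma definable_conj [definable_intros]: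
  assumes "formula_class K" "definable K A P" "definable K A Q"
  shows "definable K A (\<lambda>e. P e \<and> Q e)"
proof -
  obtain \<phi> g where g: "\<phi> \<in> K" "\<And>i. argument A (g i)" "\<And>e. P e \<longleftrightarrow> sat E F UNIV (\<lambda>i. g i e) \<phi>"
    using definableE[OF assms(2)] by blast
  obtain \<psi> h where h: "\<psi> \<in> K" "\<And>i. argument A (h i)" "\<And>e. Q e \<longleftrightarrow> sat E F UNIV (\<lambda>i. h i e) \<psi>"
    using definableE[OF assms(3)] by blast
  let ?k = "\<lambda>i. if even i then g (i div 2) else h (i div 2)"
  show ?thesis
  proof (rule definableI[of _ _ _ ?k])
    show "And (sb (\<lambda>i. Var (2 * i)) \<phi>) (sb (\<lambda>i. Var (2 * i + 1)) \<psi>) \<in> K"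
      by (intro formula_classD assms(1) g(1) h(1))
    show "argument A (?k i)" for i using g(2) h(2) by simp
  qed (simp add: g(3) h(3))
qed

lemma definable_disj [definable_intros]:
  "formula_class K \<Longrightarrow> definable K A P \<Longrightarrow> definable K A Q \<Longrightarrow> definable K A (\<lambda>e. P e \<or> Q e)"
  using definable_not[OF _ definable_conj[OF _ definable_not[of K A P] definable_not[of K A Q]]]
  by simp

lemma definable_imp [definable_intros]:
  "formula_class K \<Longrightarrow> definable K A P \<Longrightarrow> definable K A Q \<Longrightarrow> definable K A (\<lambda>e. P e \<longrightarrow> Q e)"
  unfolding imp_conv_disj by (intro definable_disj definable_not)

lemma definable_const: "formula_class K \<Longrightarrow> definable K A (\<lambda>e. b)"
  using definable_eq_argument[OF _ argument_var argument_var, of K A 0 0] definable_not[of K A]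
  by (cases b) fastforce+

lemma definable_finite_ball [definable_intros]:
  "finite S \<Longrightarrow> formula_class K \<Longrightarrow> (\<And>a. a \<in> S \<Longrightarrow> definable K A (P a)) \<Longrightarrow>
    definable K A (\<lambda>e. \<forall>a\<in>S. P a e)"
  by (induction S rule: finite_induct) (auto intro: definable_const definable_conj)

lemma definable_finite_bex [definable_intros]:
  "finite S \<Longrightarrow> formula_class K \<Longrightarrow> (\<And>a. a \<in> S \<Longrightarrow> definable K A (P a)) \<Longrightarrow>
    definable K A (\<lambda>e. \<exists>a\<in>S. P a e)"
  by (induction S rule: finite_induct) (auto intro: definable_const definable_disj)

lemma definable_matrix:
  assumes "formula_class K" "definable K A (\<lambda>e. P (e 0) (\<lambda>i. e (Suc i)))"
  shows "\<exists>\<phi>\<in>K. \<exists>g. (\<forall>i. argument A (g i)) \<and>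
    (\<forall>u e. P u e \<longleftrightarrow> sat E F UNIV (u ## (\<lambda>i. g i e)) \<phi>)"
proof -
  obtain \<phi> h where h: "\<phi> \<in> K" "\<And>i. argument A (h i)"
    "\<And>e. P (e 0) (\<lambda>i. e (Suc i)) \<longleftrightarrow> sat E F UNIV (\<lambda>i. h i e) \<phi>"
    using definableE[OF assms(2)] by blast
  define bound where "bound i \<longleftrightarrow> h i = (\<lambda>e. e 0)" for i
  define \<rho> where "\<rho> i = (if bound i then 0 else Suc i)" for i
  define g where "g i = (if bound i then (\<lambda>e. e 0) else (\<lambda>e. h i (emp ## e)))" for i
  have g: "argument A (g i) \<and> h i (u ## e) = (u ## (\<lambda>i. g i e)) (\<rho> i)" for i u e
  proof (cases "bound i")
    case True
    then show ?thesis by (simp add: g_def \<rho>_def bound_def argument_var)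
  next
    case False
    with h(2)[of i] show ?thesis
    proof (cases rule: argument_cases)
      case (variable j)
      then show ?thesis
        using False by (cases j) (auto simp: g_def \<rho>_def bound_def intro: argument_var)
    qed (auto simp: g_def \<rho>_def argument_def)
  qed
  show ?thesis
  proof (intro bexI exI conjI allI)
    show "sb (\<lambda>i. Var (\<rho> i)) \<phi> \<in> K" using assms(1) h(1) by (simp add: formula_class_def)
    show "P u e \<longleftrightarrow> sat E F UNIV (u ## (\<lambda>i. g i e)) (sb (\<lambda>i. Var (\<rho> i)) \<phi>)" for u e
      using h(3)[of "u ## e"] g by simp
  qed (use g in blast)
qed

lemma definable_bex [definable_intros]:
  assumes "formula_class K" "argument A f" "definable K A (\<lambda>e. P (e 0) (\<lambda>i. e (Suc i)))"
  shows "definable K A (\<lambda>e. \<exists>u. u \<epsilon> f e \<and> P u e)"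
proof -
  obtain \<phi> g where g: "\<phi> \<in> K" "\<And>i. argument A (g i)"
      "\<And>u e. P u e \<longleftrightarrow> sat E F UNIV (u ## (\<lambda>i. g i e)) \<phi>"
    using definable_matrix[OF assms(1,3)] by blast
  show ?thesis
  proof (rule definableI[of _ _ _ "f ## g"])
    show "BEx (Var 0) (sb (\<lambda>i. Var ((0 ## (\<lambda>i. Suc (Suc i))) i)) \<phi>) \<in> K"
      by (intro formula_classD assms(1) g(1))
    show "argument A ((f ## g) i)" for i using assms(2) g(2) by (rule argument_build)
  qed (simp add: g(3) comp_build[of "\<lambda>f. f _"] comp_build[of "_ ## _"])
qed

lemma definable_ball [definable_intros]:
  assumes "formula_class K" "argument A f" "definable K A (\<lambda>e. P (e 0) (\<lambda>i. e (Suc i)))"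
  shows "definable K A (\<lambda>e. \<forall>u. u \<epsilon> f e \<longrightarrow> P u e)"
  using definable_not[OF assms(1) definable_bex[OF assms(1,2), of "\<lambda>u e. \<not> P u e"]]
    definable_not[OF assms(1,3)] by simp

lemma definable_ex [definable_intros]:
  assumes "definable set_fms A (\<lambda>e. P (e 0) (\<lambda>i. e (Suc i)))"
  shows "definable set_fms A (\<lambda>e. \<exists>u. P u e)"
proof -
  obtain \<phi> g where g: "\<phi> \<in> set_fms" "\<And>i. argument A (g i)"
      "\<And>u e. P u e \<longleftrightarrow> sat E F UNIV (u ## (\<lambda>i. g i e)) \<phi>"
    using definable_matrix[OF formula_class_set_fms assms] by blast
  show ?thesis by (rule definableI[of "Ex \<phi>" _ _ g]) (use g in \<open>auto simp: set_fms_def\<close>)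
qed

lemma definable_all [definable_intros]:
  assumes "definable set_fms A (\<lambda>e. P (e 0) (\<lambda>i. e (Suc i)))"
  shows "definable set_fms A (\<lambda>e. \<forall>u. P u e)"
  using definable_not[OF formula_class_set_fms definable_ex[of A "\<lambda>u e. \<not> P u e"]]
    definable_not[OF formula_class_set_fms assms] by simp

lemma definable_binary_formula:
  assumes "formula_class K" "definable K {r} (\<lambda>e. R (e 0) (e 1))"
  shows "\<exists>\<theta>\<in>K. fv_below 3 \<theta> \<and> (\<forall>x y. sat E F UNIV (x ## y ## (\<lambda>_. r)) \<theta> \<longleftrightarrow> R x y)"
proof -
  obtain \<phi> g where g: "\<phi> \<in> K" "\<And>i. argument {r} (g i)"
    "\<And>e. R (e 0) (e 1) \<longleftrightarrow> sat E F UNIV (\<lambda>i. g i e) \<phi>"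
    using definableE[OF assms(2)] by blast
  have "\<exists>k<3. \<forall>x y. g i (x ## y ## (\<lambda>_. r)) = (x ## y ## (\<lambda>_. r)) k" for i
    using g(2)[of i]
  proof (cases rule: argument_cases)
    case (variable j)
    then show ?thesis by (intro exI[of _ "min j 2"]) (cases j; cases "j - 1"; simp)
  next
    case (parameter a)
    then show ?thesis by (intro exI[of _ 2]) simp
  qed
  then obtain \<rho> where \<rho>: "\<And>i. \<rho> i < 3" "\<And>i x y. g i (x ## y ## (\<lambda>_. r)) = (x ## y ## (\<lambda>_. r)) (\<rho> i)"
    by metis
  have "sat E F UNIV (x ## y ## (\<lambda>_. r)) (sb (\<lambda>i. Var (\<rho> i)) \<phi>) \<longleftrightarrow> R x y" for x y
    by (simp flip: \<rho>(2) g(3))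
  moreover have "fv_below 3 (sb (\<lambda>i. Var (\<rho> i)) \<phi>)" by (rule fv_below_rename[OF \<rho>(1)])
  ultimately show ?thesis using formula_classD(6)[OF assms(1) g(1)] by blast
qed

lemma definable_unary_formula:
  assumes "formula_class K" "definable K A (\<lambda>e. P (e 0))"
  shows "\<exists>\<phi>\<in>K. \<exists>zs. fv_below (Suc (length zs)) \<phi> \<and>
    (\<forall>x e. sat E F UNIV (x ## zs \<frown> e) \<phi> \<longleftrightarrow> P x)"
proof -
  obtain \<phi> g where \<phi>: "\<phi> \<in> K" "\<forall>i. argument A (g i)"
    and g: "\<And>u e. P u \<longleftrightarrow> sat E F UNIV (u ## (\<lambda>i. g i e)) \<phi>"
    using definable_matrix[of K A "\<lambda>u _. P u", OF assms] by auto
  obtain m where "fv_below m \<phi>" using ex_fv_below by blast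
  then have m: "fv_below (Suc m) \<phi>" by (rule fv_below_mono) simp
  define d where "d = (\<lambda>i. g i (\<lambda>_. emp))"
  have "sat E F UNIV (x ## map d [0..<m] \<frown> e) \<phi> \<longleftrightarrow> P x" for x e
  proof -
    have "(x ## map d [0..<m] \<frown> e) i = (x ## d) i" if "i < Suc m" for i
      using that by (cases i) simp_all
    then have "sat E F UNIV (x ## map d [0..<m] \<frown> e) \<phi> \<longleftrightarrow> sat E F UNIV (x ## d) \<phi>"
      using m by (intro sat_cong) (auto simp: fv_below_def)
    then show ?thesis by (simp add: g[of x "\<lambda>_. emp"] d_def)
  qed
  then show ?thesis using \<phi>(1) m by (intro bexI[of _ \<phi>] exI[of _ "map d [0..<m]"]) simp_all
qed


subsection \<open>Definable terms\<close>

definition definable_term :: "fm set \<Rightarrow> 'a set \<Rightarrow> ((nat \<Rightarrow> 'a) \<Rightarrow> 'a) \<Rightarrow> bool" where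
  "definable_term K A t \<longleftrightarrow> definable K A (\<lambda>e. e 0 = t (\<lambda>i. e (Suc i)))"

lemma definable_term_argument:
  "formula_class K \<Longrightarrow> argument A f \<Longrightarrow> definable_term K A f"
  unfolding definable_term_def by (intro definable_eq_argument argument_var argument_Suc)

lemmas definable_term_arguments [definable_intros] =
  argument_intros[THEN definable_term_argument[rotated]]

lemma definable_eq [definable_intros]:
  "argument A f \<Longrightarrow> definable_term K A t \<Longrightarrow> definable K A (\<lambda>e. f e = t e)"
  unfolding definable_term_def
  using definable_subst[of K A "\<lambda>e. e 0 = t (\<lambda>i. e (Suc i))" "f ## (\<lambda>i e. e i)"]
  by (simp add: argument_build argument_var)

lemma definable_term_subst:
  "definable_term K A t \<Longrightarrow> (\<And>i. argument A (g i)) \<Longrightarrow> definable_term K A (\<lambda>e. t (\<lambda>i. g i e))"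
  unfolding definable_term_def
  using definable_subst[of K A "\<lambda>e. e 0 = t (\<lambda>i. e (Suc i))"
      "(\<lambda>e. e 0) ## (\<lambda>i e. g i (\<lambda>i. e (Suc i)))"]
  by (simp add: argument_build argument_var argument_Suc)

lemma definable_mem [definable_intros]:
  assumes "formula_class K" "definable_term K A t" "argument A g"
  shows "definable K A (\<lambda>e. t e \<epsilon> g e)"
proof -
  have "definable K A (\<lambda>e. \<exists>p. p \<epsilon> g e \<and> p = t e)"
    using assms unfolding definable_term_def by (intro definable_bex)
  then show ?thesis by simp
qed

lemma definable_term_emp [definable_intros]:
  assumes "formula_class K" shows "definable_term K A (\<lambda>e. emp)"
proof -
  have "definable K A (\<lambda>e. \<forall>u. u \<epsilon> e 0 \<longrightarrow> False)"
    by (intro definable_ball definable_const argument_intros assms)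
  moreover have "(\<forall>u. u \<epsilon> x \<longrightarrow> False) \<longleftrightarrow> x = emp" for x using nonempty[of x] by auto
  ultimately show ?thesis by (simp add: definable_term_def)
qed

lemma eq_upr_iff:
  "x = upr y z \<longleftrightarrow>
    (\<exists>a. a \<epsilon> x \<and> a = y \<and> (\<exists>b. b \<epsilon> x \<and> b = z \<and> (\<forall>u. u \<epsilon> x \<longrightarrow> u = a \<or> u = b)))"
  using ext[of x "upr y z"] by auto

lemma definable_term_upr [definable_intros]:
  assumes "formula_class K" "definable_term K A s" "definable_term K A t"
  shows "definable_term K A (\<lambda>e. upr (s e) (t e))"
proof -
  have "definable_term K A (\<lambda>e. s (\<lambda>i. e (Suc (Suc i))))"
      "definable_term K A (\<lambda>e. t (\<lambda>i. e (Suc (Suc (Suc i)))))"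
    using definable_term_subst[OF assms(2) argument_var]
      definable_term_subst[OF assms(3) argument_var] by auto
  then show ?thesis
    unfolding definable_term_def[of K A "\<lambda>e. upr (s e) (t e)"] eq_upr_iff
    by (intro definable_intros argument_intros assms(1))
qed

lemma eq_suc_iff:
  "x = suc y \<longleftrightarrow> (\<exists>a. a \<epsilon> x \<and> a = y \<and> a \<sqsubseteq> x \<and> (\<forall>u. u \<epsilon> x \<longrightarrow> u \<epsilon> a \<or> u = a))"
  using ext[of x "suc y"] by auto

lemma definable_term_suc [definable_intros]:
  assumes "formula_class K" "definable_term K A t"
  shows "definable_term K A (\<lambda>e. suc (t e))"
proof -
  have "definable_term K A (\<lambda>e. t (\<lambda>i. e (Suc (Suc i))))"
    by (rule definable_term_subst[OF assms(2) argument_var])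
  then show ?thesis
    unfolding definable_term_def[of K A "\<lambda>e. suc (t e)"] eq_suc_iff
    by (intro definable_intros argument_intros assms(1))
qed


subsection \<open>Pairs, numerals and codes of formulas\<close>

definition opr :: "'a \<Rightarrow> 'a \<Rightarrow> 'a" where
  "opr a b = upr (upr a a) (upr a b)"

lemma opr_inject [simp]: "opr a b = opr c d \<longleftrightarrow> a = c \<and> b = d"
proof -
  have "upr a b = upr c d \<longleftrightarrow> a = c \<and> b = d \<or> a = d \<and> b = c" for a b c d
    unfolding eq_upr_iff[of "upr a b"] by auto
  then show ?thesis by (auto simp: opr_def)
qed

lemma components_in_upr: "upr a b \<epsilon> opr a b" "a \<epsilon> upr a b" "b \<epsilon> upr a b"
  by (simp_all add: opr_def)

lemma definable_term_opr [definable_intros]: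
  "formula_class K \<Longrightarrow> definable_term K A s \<Longrightarrow> definable_term K A t \<Longrightarrow>
    definable_term K A (\<lambda>e. opr (s e) (t e))"
  unfolding opr_def by (intro definable_term_upr)

lemma definable_ex_opr [definable_intros]:
  assumes K: "formula_class K" and f: "argument A f"
    and P: "definable K A (\<lambda>e. P (e 0) (e 1) (\<lambda>i. e (Suc (Suc i))))"
  shows "definable K A (\<lambda>e. \<exists>x y. f e = opr x y \<and> P x y e)"
proof -
  let ?g = "(\<lambda>e. e 1) ## (\<lambda>e. e 0) ## (\<lambda>i e. e (Suc (Suc (Suc i))))"
  have "argument A (?g i)" for i by (intro argument_build argument_var)
  with definable_subst[OF P, of ?g]
  have "definable K A (\<lambda>e. P (e 1) (e 0) (\<lambda>i. e (Suc (Suc (Suc i)))))" by simp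
  then have "definable K A
      (\<lambda>e. \<exists>q. q \<epsilon> f e \<and> (\<exists>x. x \<epsilon> q \<and> (\<exists>y. y \<epsilon> q \<and> (f e = opr x y \<and> P x y e))))"
    by (intro definable_intros K f argument_intros argument_Suc) simp
  moreover have "(\<exists>q. q \<epsilon> z \<and> (\<exists>x. x \<epsilon> q \<and> (\<exists>y. y \<epsilon> q \<and> (z = opr x y \<and> P x y e)))) \<longleftrightarrow>
      (\<exists>x y. z = opr x y \<and> P x y e)" for z e
    using components_in_upr by blast
  ultimately show ?thesis by simp
qed

lemma definable_all_opr [definable_intros]:
  assumes "formula_class K" "argument A f" "definable K A (\<lambda>e. P (e 0) (e 1) (\<lambda>i. e (Suc (Suc i))))"
  shows "definable K A (\<lambda>e. \<forall>x y. f e = opr x y \<longrightarrow> P x y e)"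
  using definable_not[OF assms(1) definable_ex_opr[OF assms(1,2), of "\<lambda>x y e. \<not> P x y e"]]
    definable_not[OF assms(1,3)] by simp

lemma definable_ex_opr_mem [definable_intros]:
  assumes K: "formula_class K" and f: "argument A f"
    and P: "definable K A (\<lambda>e. P (e 0) (e 1) (\<lambda>i. e (Suc (Suc i))))"
  shows "definable K A (\<lambda>e. \<exists>x y. opr x y \<epsilon> f e \<and> P x y e)"
proof -
  let ?g = "(\<lambda>e. e 0) ## (\<lambda>e. e 1) ## (\<lambda>i e. e (Suc (Suc (Suc i))))"
  have "argument A (?g i)" for i by (intro argument_build argument_var)
  with definable_subst[OF P, of ?g]
  have "definable K A (\<lambda>e. P (e 0) (e 1) (\<lambda>i. e (Suc (Suc (Suc i)))))" by simp
  then have "definable K A (\<lambda>e. \<exists>p. p \<epsilon> f e \<and> (\<exists>x y. p = opr x y \<and> P x y e))"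
    by (intro definable_bex definable_ex_opr K f argument_var)
  moreover have "(\<exists>p. p \<epsilon> z \<and> (\<exists>x y. p = opr x y \<and> P x y e)) \<longleftrightarrow>
      (\<exists>x y. opr x y \<epsilon> z \<and> P x y e)" for z e
    by blast
  ultimately show ?thesis by simp
qed

lemma definable_all_opr_mem [definable_intros]:
  assumes "formula_class K" "argument A f" "definable K A (\<lambda>e. P (e 0) (e 1) (\<lambda>i. e (Suc (Suc i))))"
  shows "definable K A (\<lambda>e. \<forall>x y. opr x y \<epsilon> f e \<longrightarrow> P x y e)"
  using definable_not[OF assms(1) definable_ex_opr_mem[OF assms(1,2), of "\<lambda>x y e. \<not> P x y e"]]
    definable_not[OF assms(1,3)] by simp

primrec num :: "nat \<Rightarrow> 'a" where
  "num 0 = emp"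
| "num (Suc n) = suc (num n)"

lemma num_less: "m < n \<Longrightarrow> num m \<epsilon> num n"
  by (induction n) (auto simp: less_Suc_eq)

lemma num_inject: "num m = num n \<longleftrightarrow> m = n"
  using num_less mem_irrefl by (metis linorder_neqE_nat)

definition code :: "fm \<Rightarrow> 'a" where
  "code \<phi> = num (to_nat \<phi>)"

lemma code_inject [simp]: "code \<phi> = code \<psi> \<longleftrightarrow> \<phi> = \<psi>"
  by (simp add: code_def num_inject)

lemma definable_term_code [definable_intros]:
  assumes "formula_class K" shows "definable_term K A (\<lambda>e. code \<phi>)"
proof -
  have "definable_term K A (\<lambda>e. num n)" for n
    by (induction n) (simp_all add: definable_term_emp definable_term_suc assms)
  then show ?thesis by (simp add: code_def)
qed


subsection \<open>Assignments coded by iterated pairs\<close>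

definition opr_fst :: "'a \<Rightarrow> 'a" where
  "opr_fst c = (if \<exists>x y. c = opr x y then THE x. \<exists>y. c = opr x y else c)"

definition opr_snd :: "'a \<Rightarrow> 'a" where
  "opr_snd c = (if \<exists>x y. c = opr x y then THE y. \<exists>x. c = opr x y else c)"

lemma opr_fst_opr [simp]: "opr_fst (opr x y) = x"
  and opr_snd_opr [simp]: "opr_snd (opr x y) = y"
  by (auto simp: opr_fst_def opr_snd_def)

primrec decode :: "'a \<Rightarrow> nat \<Rightarrow> 'a" where
  "decode c 0 = opr_fst c"
| "decode c (Suc i) = decode (opr_snd c) i"

lemma decode_opr [simp]: "decode (opr x c) = x ## decode c"
proof
  show "decode (opr x c) i = (x ## decode c) i" for i by (cases i) simp_all
qed

lemma
  assumes "formula_class K" "argument A f" "definable K A (\<lambda>e. P (e 0) (\<lambda>i. e (Suc i)))"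
  shows definable_opr_fst: "definable K A (\<lambda>e. P (opr_fst (f e)) e)"
    and definable_opr_snd: "definable K A (\<lambda>e. P (opr_snd (f e)) e)"
proof -
  have P_subst: "definable K A (\<lambda>e. P (g e) (\<lambda>i. h i e))"
    if "argument A g" "\<And>i. argument A (h i)" for g h
    using definable_subst[OF assms(3), of "g ## h"] that by (simp add: argument_build)
  have not_opr: "definable K A (\<lambda>e. \<not> (\<exists>x y. f e = opr x y \<and> True) \<and> P (f e) e)"
    by (intro definable_intros assms(1,2) definable_const P_subst argument_var)
  have "definable K A (\<lambda>e. (\<exists>x y. f e = opr x y \<and> P x e) \<or>
      \<not> (\<exists>x y. f e = opr x y \<and> True) \<and> P (f e) e)"
    by (intro definable_disj definable_ex_opr not_opr assms(1,2) P_subst argument_var)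
  moreover have "P (opr_fst c) e \<longleftrightarrow>
      (\<exists>x y. c = opr x y \<and> P x e) \<or> \<not> (\<exists>x y. c = opr x y \<and> True) \<and> P c e" for c e
    by (cases "\<exists>x y. c = opr x y") (auto simp: opr_fst_def)
  ultimately show "definable K A (\<lambda>e. P (opr_fst (f e)) e)" by simp
  have "definable K A (\<lambda>e. (\<exists>x y. f e = opr x y \<and> P y e) \<or>
      \<not> (\<exists>x y. f e = opr x y \<and> True) \<and> P (f e) e)"
    by (intro definable_disj definable_ex_opr not_opr assms(1,2) P_subst argument_var)
  moreover have "P (opr_snd c) e \<longleftrightarrow>
      (\<exists>x y. c = opr x y \<and> P y e) \<or> \<not> (\<exists>x y. c = opr x y \<and> True) \<and> P c e" for c e
    by (cases "\<exists>x y. c = opr x y") (auto simp: opr_snd_def)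
  ultimately show "definable K A (\<lambda>e. P (opr_snd (f e)) e)" by simp
qed

lemma definable_decode:
  assumes "formula_class K" "argument A f" "definable K A (\<lambda>e. P (e 0) (\<lambda>i. e (Suc i)))"
  shows "definable K A (\<lambda>e. P (decode (f e) i) e)"
  using assms(2,3)
proof (induction i arbitrary: f P)
  case 0
  then show ?case using definable_opr_fst[OF assms(1)] by simp
next
  case (Suc i)
  let ?g = "(\<lambda>e. e 0) ## (\<lambda>i e. e (Suc (Suc i)))"
  have "argument A (?g j)" for j by (intro argument_build argument_var)
  with definable_subst[OF Suc.prems(2), of ?g]
  have "definable K A (\<lambda>e. P (e 0) (\<lambda>i. e (Suc (Suc i))))" by simp
  from Suc.IH[of "\<lambda>e. e 0" "\<lambda>u e. P u (\<lambda>i. e (Suc i))", OF argument_var this]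
  show ?case
    using definable_opr_snd[OF assms(1) Suc.prems(1), of "\<lambda>c. P (decode c i)"] by simp
qed

lemma definable_decode2:
  assumes K: "formula_class K" and P: "definable K A (\<lambda>e. P (e 0) (e 1))" and f: "argument A f"
  shows "definable K A (\<lambda>e. P (decode (f e) i) (decode (f e) j))"
proof -
  have "definable K A (\<lambda>e. P (e 1) (e 0))"
    by (rule definable_subst2[OF P argument_var argument_var])
  then have "definable K A (\<lambda>e. P (e 0) (decode (e 1) j))"
    using definable_decode[OF K argument_var, of A "\<lambda>y e. P (e 0) y"] by simp
  then have "definable K A (\<lambda>e. P (decode (e 0) i) (decode (e 0) j))"
    using definable_decode[OF K argument_var, of A "\<lambda>x e. P x (decode (e 0) j)"] by simp
  then show ?thesis by (rule definable_subst1[OF _ f])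
qed

lemma definable_sat_relative:
  assumes K: "formula_class K" and "set_fm \<phi>" "\<And>i. argument UNIV (g i)"
  shows "definable K UNIV (\<lambda>e. sat E F {x. x \<epsilon> a} (\<lambda>i. g i e) \<phi>)"
  using assms(2,3)
proof (induction \<phi> arbitrary: g)
  case (All \<phi>)
  let ?g = "(\<lambda>e. e 0) ## (\<lambda>i e. g i (\<lambda>i. e (Suc i)))"
  have "definable K UNIV (\<lambda>e. sat E F {x. x \<epsilon> a} (\<lambda>i. ?g i e) \<phi>)"
    using All.prems by (intro All.IH argument_build argument_var argument_Suc) simp
  then have "definable K UNIV (\<lambda>e. \<forall>u. u \<epsilon> a \<longrightarrow> sat E F {x. x \<epsilon> a} (u ## (\<lambda>i. g i e)) \<phi>)"
    by (intro definable_ball K argument_intros) (simp add: comp_build[of "\<lambda>f. f _"])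
  then show ?case by simp
next
  case (Ex \<phi>)
  let ?g = "(\<lambda>e. e 0) ## (\<lambda>i e. g i (\<lambda>i. e (Suc i)))"
  have "definable K UNIV (\<lambda>e. sat E F {x. x \<epsilon> a} (\<lambda>i. ?g i e) \<phi>)"
    using Ex.prems by (intro Ex.IH argument_build argument_var argument_Suc) simp
  then have "definable K UNIV (\<lambda>e. \<exists>u. u \<epsilon> a \<and> sat E F {x. x \<epsilon> a} (u ## (\<lambda>i. g i e)) \<phi>)"
    by (intro definable_bex K argument_intros) (simp add: comp_build[of "\<lambda>f. f _"])
  then show ?case by simp
qed (auto simp: is_Var_iff K intro!: definable_not[OF K] definable_conj[OF K] definable_disj[OF K]
    definable_mem_argument definable_eq_argument)

lemma definable_sat_decode_atomic [definable_intros]: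
  assumes K: "formula_class K" and f: "argument A f" and "is_Var s" "is_Var t"
  shows "definable K A (\<lambda>e. sat E F UNIV (decode (f e)) (Mem s t))"
    and "definable K A (\<lambda>e. sat E F UNIV (decode (f e)) (NMem s t))"
    and "definable K A (\<lambda>e. sat E F UNIV (decode (f e)) (Eq s t))"
    and "definable K A (\<lambda>e. sat E F UNIV (decode (f e)) (NEq s t))"
proof -
  obtain i j where st: "s = Var i" "t = Var j" using assms(3,4) by (auto simp: is_Var_iff)
  have "definable K A (\<lambda>e. decode (f e) i \<epsilon> decode (f e) j)"
    by (rule definable_decode2[OF K _ f, of "\<lambda>x y. x \<epsilon> y"])
      (intro definable_mem_argument K argument_var)
  then show "definable K A (\<lambda>e. sat E F UNIV (decode (f e)) (Mem s t))"
      "definable K A (\<lambda>e. sat E F UNIV (decode (f e)) (NMem s t))"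
    using definable_not[OF K] by (simp_all add: st)
  have "definable K A (\<lambda>e. decode (f e) i = decode (f e) j)"
    by (rule definable_decode2[OF K _ f, of "\<lambda>x y. x = y"])
      (intro definable_eq_argument K argument_var)
  then show "definable K A (\<lambda>e. sat E F UNIV (decode (f e)) (Eq s t))"
      "definable K A (\<lambda>e. sat E F UNIV (decode (f e)) (NEq s t))"
    using definable_not[OF K] by (simp_all add: st)
qed

lemma definable_sat_decode [definable_intros]:
  assumes "set_fm \<phi>" "argument A f"
  shows "definable set_fms A (\<lambda>e. sat E F UNIV (decode (f e)) \<phi>)"
proof -
  have "definable set_fms A (\<lambda>e. sat E F UNIV (decode (e k)) \<phi>)" for k
    using assms(1)
  proof (induction \<phi> arbitrary: k)
    case (All \<phi>)
    have "definable set_fms A (\<lambda>e. \<forall>x. \<forall>z. z = opr x (e k) \<longrightarrow> sat E F UNIV (decode z) \<phi>)"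
      using All.prems by (intro definable_intros argument_intros All.IH) simp
    then show ?case by simp
  next
    case (Ex \<phi>)
    have "definable set_fms A (\<lambda>e. \<exists>x. \<exists>z. z = opr x (e k) \<and> sat E F UNIV (decode z) \<phi>)"
      using Ex.prems by (intro definable_intros argument_intros Ex.IH) simp
    then show ?case by simp
  next
    case (And \<phi> \<psi>)
    then show ?case by (simp add: definable_conj formula_class_set_fms)
  next
    case (Or \<phi> \<psi>)
    then show ?case by (simp add: definable_disj formula_class_set_fms)
  qed (intro definable_sat_decode_atomic formula_class_set_fms argument_var; simp)+
  then show ?thesis by (rule definable_subst1[OF _ assms(2)])
qed


subsection \<open>\<open>\<Delta>\<^sub>0\<close>-predicates are primitive recursive\<close>

lemma prim_rec_pred_sat_Delta0:
  "sigma_fm \<phi> \<Longrightarrow> pi_fm \<phi> \<Longrightarrow> prim_rec_pred (\<lambda>e. sat E F UNIV e \<phi>)"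
proof (induction rule: sigma_fm_induct)
  case (BAll \<phi> i)
  then have "prim_rec_pred (\<lambda>e. sat E F UNIV (e 0 ## (\<lambda>i. e (Suc i))) \<phi>)" by (simp add: BAll_def)
  then show ?case
    using prim_rec_pred_ball[of "\<lambda>e. e i" "\<lambda>u e. sat E F UNIV (u ## e) \<phi>"]
    by (simp add: prim_rec_var)
next
  case (Ex \<phi>)
  then obtain i where mem: "\<exists>\<psi>. \<phi> = And (Mem (Var 0) (Var (Suc i))) \<psi>" and "pi_fm \<phi>"
    by (auto simp: pi_fm_Ex_iff intro: pi_fm.intros)
  then have "prim_rec_pred (\<lambda>e. sat E F UNIV (e 0 ## (\<lambda>i. e (Suc i))) \<phi>)" using Ex by simp
  then have "prim_rec_pred (\<lambda>e. \<exists>u. u \<epsilon> e i \<and> sat E F UNIV (u ## e) \<phi>)"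
    by (rule prim_rec_pred_bex[OF prim_rec_var])
  moreover have "(\<exists>u. u \<epsilon> e i \<and> sat E F UNIV (u ## e) \<phi>) \<longleftrightarrow> sat E F UNIV e (Ex \<phi>)" for e
    using mem by auto
  ultimately show ?case by simp
qed (auto intro!: prim_rec_pred_conj prim_rec_pred_disj prim_rec_pred_mem prim_rec_pred_eq
    prim_rec_pred_not prim_rec_var)

lemma prim_rec_pred_Delta0:
  assumes "Delta0 A P"
  shows "prim_rec_pred P"
proof -
  obtain \<phi> g where g: "\<phi> \<in> Delta0_fms" "\<And>i. argument A (g i)" "\<And>e. P e \<longleftrightarrow> sat E F UNIV (\<lambda>i. g i e) \<phi>"
    using definableE[OF assms] by blast
  then have "prim_rec_pred (\<lambda>e. sat E F UNIV e \<phi>)"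
    by (auto simp: Delta0_fms_def intro: prim_rec_pred_sat_Delta0)
  then have "prim_rec_pred (\<lambda>e. sat E F UNIV (\<lambda>i. g i e) \<phi>)"
    by (rule prim_rec_pred_subst) (rule prim_rec_argument[OF g(2)])
  then show ?thesis by (simp flip: g(3))
qed

end


section \<open>The two schemas\<close>

subsection \<open>The axioms are sentences\<close>

definition sentence :: "fm \<Rightarrow> bool" where
  "sentence \<phi> \<longleftrightarrow> wf_fm \<phi> \<and> fv_below 0 \<phi>"

lemma sentence_defining_axiom: "wf_psf f \<Longrightarrow> sentence (defining_axiom f)"
  by (cases f)
    (auto simp: sentence_def Subset_def Inductive_def Let_def list_all_iff simp del: upt_Suc)

lemma sentence_PRS_DC: "\<phi> \<in> PRS_DC \<Longrightarrow> sentence \<phi>"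
  using sentence_defining_axiom
  by (auto simp: sentence_def PRS_DC_def PRS_def extensionality_def regularity_def infinity_def
      Inductive_def dependent_choice_def Function_to_def)

lemma sentence_reflection:
  assumes "set_fm \<psi>" "fv_below 1 \<psi>" shows "sentence (reflection \<psi>)"
  using assms by (simp add: sentence_def reflection_def Subset_def Transitive_def wf_rel wf_inst
      wf_set_fm fv_below_rel fv_below_inst)

lemma fv_below_Ind:
  "fv_below 3 \<theta> \<Longrightarrow> fv_below (Suc k) \<phi> \<Longrightarrow> fv_below 1 (Ind \<theta> k \<phi>)"
  by (simp add: Ind_def in_X_def less_X_def le_X_def fv_below_inst list_all_iff numeral_3_eq_3
      del: upt_Suc)

lemma fv_below_WF: "fv_below 3 \<theta> \<Longrightarrow> fv_below 1 (WF \<theta>)"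
  by (simp add: WF_def less_X_def le_X_def fv_below_inst numeral_3_eq_3)

lemma fv_below_Delta_Rel: "fv_below 3 \<theta> \<Longrightarrow> fv_below 3 \<theta>' \<Longrightarrow> fv_below 1 (Delta_Rel \<theta> \<theta>')"
  by (simp add: Delta_Rel_def in_X_def le_X_def fv_below_inst numeral_3_eq_3)

lemma sentence_class_induction:
  assumes "sigma_fm \<theta>" "fv_below 3 \<theta>" "pi_fm \<theta>'" "fv_below 3 \<theta>'" "set_fm \<phi>" "fv_below (Suc k) \<phi>"
  shows "sentence (class_induction \<theta> \<theta>' k \<phi>)"
proof -
  have "fv_below 0 (class_induction \<theta> \<theta>' k \<phi>)"
    using fv_below_Ind[of \<theta> k \<phi>] fv_below_WF[of \<theta>] fv_below_Delta_Rel[of \<theta> \<theta>'] assms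
    by (simp add: class_induction_def Subset_def)
  moreover have "wf_fm (class_induction \<theta> \<theta>' k \<phi>)"
    using assms sigma_fm_set_fm pi_fm_set_fm
    by (simp add: class_induction_def Subset_def Delta_Rel_def WF_def Ind_def in_X_def less_X_def
        le_X_def wf_inst wf_set_fm list_all_iff)
  ultimately show ?thesis by (simp add: sentence_def)
qed

lemma Reflection_iff: "\<chi> \<in> Reflection \<longleftrightarrow> (\<exists>\<psi>. \<chi> = reflection \<psi> \<and> set_fm \<psi> \<and> fv_below 1 \<psi>)"
  by (auto simp: Reflection_def fv_below_def lessThan_Suc)

lemma Class_Induction_iff:
  "\<chi> \<in> Class_Induction \<longleftrightarrow> (\<exists>\<theta> \<theta>' k \<phi>. \<chi> = class_induction \<theta> \<theta>' k \<phi> \<and> sigma_fm \<theta> \<and> fv_below 3 \<theta> \<and>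
     pi_fm \<theta>' \<and> fv_below 3 \<theta>' \<and> set_fm \<phi> \<and> fv_below (Suc k) \<phi>)"
proof -
  have "{0, 1, 2} = {..<3::nat}" by auto
  then show ?thesis
    by (simp add: Class_Induction_def fv_below_def atLeast0AtMost lessThan_Suc_atMost)
qed


subsection \<open>Semantics of induction\<close>

definition induction_on :: "'a set \<Rightarrow> ('a \<Rightarrow> 'a \<Rightarrow> bool) \<Rightarrow> ('a \<Rightarrow> bool) \<Rightarrow> bool" where
  "induction_on U L P \<longleftrightarrow>
    (\<forall>x\<in>U. L x x \<longrightarrow> (\<forall>y\<in>U. L y x \<and> y \<noteq> x \<longrightarrow> P y) \<longrightarrow> P x) \<longrightarrow> (\<forall>x\<in>U. L x x \<longrightarrow> P x)"

definition reflexive_on_field :: "'a set \<Rightarrow> ('a \<Rightarrow> 'a \<Rightarrow> bool) \<Rightarrow> bool" where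
  "reflexive_on_field U L \<longleftrightarrow> (\<forall>x\<in>U. \<forall>y\<in>U. L x y \<longrightarrow> L x x \<and> L y y)"

lemma sat_inst_triple:
  assumes "fv_below 3 \<theta>"
  shows "sat E F U e (inst \<theta> [s, t, u]) \<longleftrightarrow>
    sat E F U (val F e s ## val F e t ## (\<lambda>_. val F e u)) \<theta>"
  using sat_conc_cong[of "[val F e s, val F e t, val F e u]" \<theta> E F U e "\<lambda>_. val F e u"] assms
  by (simp add: sat_inst numeral_3_eq_3)

lemma sat_inst_tail:
  assumes "fv_below (Suc (length zs)) \<phi>"
  shows "sat E F U (x ## ys \<frown> zs \<frown> e)
      (inst \<phi> (Var 0 # map Var [Suc (length ys)..<length zs + Suc (length ys)])) \<longleftrightarrow>
    sat E F U (x ## zs \<frown> e) \<phi>"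
  using map_conc_upt[of "x # ys" "Suc (length ys)" zs "length zs" e]
    sat_conc_cong[of "x # zs"] assms
  by (simp add: sat_inst o_def del: upt_Suc conc_conc)

definition Field_Rel :: "fm \<Rightarrow> fm" where
  "Field_Rel \<theta> = All (All (Imp (le_X \<theta> (Var 2) (Var 1) (Var 0))
     (And (in_X \<theta> (Var 2) (Var 1)) (in_X \<theta> (Var 2) (Var 0)))))"

lemma sat_Field_Rel:
  assumes "fv_below 3 \<theta>"
  shows "sat E F U e (Field_Rel \<theta>) \<longleftrightarrow>
    reflexive_on_field U (\<lambda>x y. sat E F U (x ## y ## (\<lambda>_. e 0)) \<theta>)"
  by (simp add: Field_Rel_def in_X_def le_X_def sat_inst_triple[OF assms] reflexive_on_field_def)

lemma sat_Delta_Rel: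
  assumes "fv_below 3 \<theta>" "fv_below 3 \<theta>'"
  shows "sat E F UNIV e (Delta_Rel \<theta> \<theta>') \<longleftrightarrow>
    reflexive_on_field UNIV (\<lambda>x y. sat E F UNIV (x ## y ## (\<lambda>_. e 0)) \<theta>) \<and>
    (\<forall>x y. sat E F UNIV (x ## y ## (\<lambda>_. e 0)) \<theta> \<longleftrightarrow> sat E F UNIV (x ## y ## (\<lambda>_. e 0)) \<theta>')"
  unfolding Delta_Rel_def Field_Rel_def[symmetric]
  by (simp add: sat_Field_Rel sat_inst_triple assms)

lemma sat_Ind:
  assumes \<theta>: "fv_below 3 \<theta>" and \<phi>: "fv_below (Suc k) \<phi>"
  shows "sat E F U e (Ind \<theta> k \<phi>) \<longleftrightarrow> (\<forall>zs. length zs = k \<and> set zs \<subseteq> U \<longrightarrow>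
    induction_on U (\<lambda>x y. sat E F U (x ## y ## (\<lambda>_. e 0)) \<theta>) (\<lambda>x. sat E F U (x ## zs \<frown> e) \<phi>))"
proof -
  have "sat E F U (x ## zs \<frown> e) (inst \<phi> (Var 0 # map Var [1..<k + 1])) \<longleftrightarrow> sat E F U (x ## zs \<frown> e) \<phi>"
      "sat E F U (y ## x ## zs \<frown> e) (inst \<phi> (Var 0 # map Var [2..<k + 2])) \<longleftrightarrow>
        sat E F U (y ## zs \<frown> e) \<phi>" if "length zs = k" for x y zs
    using sat_inst_tail[of zs \<phi> E F U x "[]" e] sat_inst_tail[of zs \<phi> E F U y "[x]" e] \<phi> that
    by (simp_all add: numeral_2_eq_2 del: upt_Suc)
  then show ?thesis
    unfolding Ind_def sat_Alls induction_on_def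
    by (simp add: in_X_def less_X_def le_X_def sat_inst_triple[OF \<theta>] del: upt_Suc
        cong: conj_cong imp_cong)
qed

context prs_model
begin

definition well_founded :: "('a \<Rightarrow> 'a \<Rightarrow> bool) \<Rightarrow> bool" where
  "well_founded L \<longleftrightarrow> (\<forall>w. w \<noteq> emp \<longrightarrow> (\<exists>x. x \<epsilon> w \<and> (\<forall>y. y \<epsilon> w \<longrightarrow> L y x \<longrightarrow> y = x)))"

lemma sat_WF:
  assumes "fv_below 3 \<theta>"
  shows "sat E F UNIV e (WF \<theta>) \<longleftrightarrow> well_founded (\<lambda>x y. sat E F UNIV (x ## y ## (\<lambda>_. e 0)) \<theta>)"
  by (simp add: WF_def less_X_def le_X_def sat_inst_triple[OF assms] well_founded_def)

lemma sat_class_induction: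
  assumes \<theta>: "fv_below 3 \<theta>" and \<theta>': "fv_below 3 \<theta>'" and \<phi>: "fv_below (Suc k) \<phi>"
  shows "sat E F UNIV e (class_induction \<theta> \<theta>' k \<phi>) \<longleftrightarrow> (\<forall>r. r \<sqsubseteq> om \<longrightarrow>
    sat E F UNIV (\<lambda>_. r) (Delta_Rel \<theta> \<theta>') \<and> sat E F UNIV (\<lambda>_. r) (WF \<theta>) \<longrightarrow>
    sat E F UNIV (\<lambda>_. r) (Ind \<theta> k \<phi>))"
proof -
  have "sat E F UNIV (r ## e) \<chi> \<longleftrightarrow> sat E F UNIV (\<lambda>_. r) \<chi>" if "fv_below 1 \<chi>" for r \<chi>
    using sat_conc_cong[of "[r]" \<chi> E F UNIV e "\<lambda>_. r"] that by simp
  then show ?thesis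
    using fv_below_Ind[OF \<theta> \<phi>] fv_below_WF[OF \<theta>] fv_below_Delta_Rel[OF \<theta> \<theta>']
    by (simp add: class_induction_def)
qed

lemma sat_reflection:
  assumes "fv_below 1 \<psi>"
  shows "sat E F UNIV e (reflection \<psi>) \<longleftrightarrow> (\<forall>r. r \<sqsubseteq> om \<longrightarrow> sat E F UNIV (\<lambda>_. r) \<psi> \<longrightarrow>
    (\<exists>N. transitive_set N \<and> sat E F {x. x \<epsilon> N} (\<lambda>_. r) \<psi>))"
proof -
  have "sat E F U e (inst \<psi> [t]) \<longleftrightarrow> sat E F U (\<lambda>_. val F e t) \<psi>" for U e t
    using sat_conc_cong[of "[val F e t]" \<psi> E F U e "\<lambda>_. val F e t"] assms by (simp add: sat_inst)
  then show ?thesis by (simp add: reflection_def sat_rel Transitive_def transitive_set_def)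
qed

end


section \<open>Reflection implies induction\<close>

lemma sat_sigma_fm_upward:
  assumes "sigma_fm \<theta>" "\<And>x y. E x y \<Longrightarrow> E y N \<Longrightarrow> E x N" "\<And>i. E (e i) N"
    and "sat E F {x. E x N} e \<theta>"
  shows "sat E F UNIV e \<theta>"
  using assms(1,3,4)
proof (induction arbitrary: e rule: sigma_fm_induct)
  case (BAll \<phi> i)
  have "sat E F UNIV (x ## e) \<phi>" if "E x (e i)" for x
  proof (rule BAll.IH)
    have "E x N" using that assms(2) BAll.prems(1) by blast
    then show "E ((x ## e) j) N" for j using BAll.prems(1) by (cases j) auto
    show "sat E F {x. E x N} (x ## e) \<phi>" using BAll.prems(2) that \<open>E x N\<close> by simp
  qed
  then show ?case by simp
next
  case (Ex \<phi>)
  then obtain x where x: "E x N" "sat E F {x. E x N} (x ## e) \<phi>" by auto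
  have "E ((x ## e) j) N" for j using x(1) Ex.prems(1) by (cases j) auto
  then show ?case using Ex.IH[of "x ## e"] x(2) by auto
qed auto

lemma (in prs_model) induction_in_transitive_set:
  assumes \<theta>: "sigma_fm \<theta>" and \<phi>: "set_fm \<phi>" and N: "transitive_set N" "r \<epsilon> N"
    and wf: "well_founded (\<lambda>x y. sat E F UNIV (x ## y ## (\<lambda>_. r)) \<theta>)"
    and field: "reflexive_on_field {x. x \<epsilon> N} (\<lambda>x y. sat E F {x. x \<epsilon> N} (x ## y ## (\<lambda>_. r)) \<theta>)"
      (is "reflexive_on_field ?N ?L")
  shows "induction_on ?N ?L (\<lambda>x. sat E F ?N (x ## e) \<phi>)"
  unfolding induction_on_def
proof (rule impI, rule ccontr)
  let ?P = "\<lambda>x. sat E F ?N (x ## e) \<phi>"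
  assume progressive: "\<forall>x\<in>?N. ?L x x \<longrightarrow> (\<forall>y\<in>?N. ?L y x \<and> y \<noteq> x \<longrightarrow> ?P y) \<longrightarrow> ?P x"
    and "\<not> (\<forall>x\<in>?N. ?L x x \<longrightarrow> ?P x)"
  then obtain x\<^sub>0 where x\<^sub>0: "x\<^sub>0 \<epsilon> N" "?L x\<^sub>0 x\<^sub>0" "\<not> ?P x\<^sub>0" by blast
  have "Delta0 UNIV (\<lambda>f. sat E F ?N (\<lambda>i. ((\<lambda>f. f 0) ## (\<lambda>f. f 0) ## (\<lambda>_ _. r)) i f) \<theta>)"
    "Delta0 UNIV (\<lambda>f. sat E F ?N (\<lambda>i. ((\<lambda>f. f 0) ## (\<lambda>i _. e i)) i f) \<phi>)"
    by (intro definable_sat_relative formula_class_Delta0_fms sigma_fm_set_fm \<theta> \<phi> argument_build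
        argument_intros)+
  then have "Delta0 UNIV (\<lambda>f. ?L (f 0) (f 0))" "Delta0 UNIV (\<lambda>f. ?P (f 0))"
    by (simp_all add: comp_build[of "\<lambda>f. f _"])
  then have "Delta0 UNIV (\<lambda>f. ?L (f 0) (f 0) \<and> \<not> ?P (f 0))"
    by (intro definable_intros)
  from separation[OF prim_rec_pred_Delta0[OF this]]
  obtain w where w: "\<And>v. v \<epsilon> w \<longleftrightarrow> v \<epsilon> N \<and> ?L v v \<and> \<not> ?P v"
    unfolding is_set_def by blast
  then have "w \<noteq> emp" using x\<^sub>0 nonempty by blast
  then obtain x where x: "x \<epsilon> w"
    and minimal: "\<And>y. y \<epsilon> w \<Longrightarrow> sat E F UNIV (y ## x ## (\<lambda>_. r)) \<theta> \<Longrightarrow> y = x"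
    using wf unfolding well_founded_def by blast
  have "?P y" if "y \<epsilon> N" "?L y x" "y \<noteq> x" for y
  proof (rule ccontr)
    assume "\<not> ?P y"
    then have "y \<epsilon> w" using that w x field unfolding reflexive_on_field_def by blast
    have "(y ## x ## (\<lambda>_. r)) i \<epsilon> N" for i
      using that(1) x w N(2) by (cases i; cases "i - 1") auto
    then have "sat E F UNIV (y ## x ## (\<lambda>_. r)) \<theta>"
      using sat_sigma_fm_upward[OF \<theta> _ _ that(2)] N(1) unfolding transitive_set_def by blast
    then show False using minimal \<open>y \<epsilon> w\<close> that(3) by blast
  qed
  then show False using progressive x w by blast
qed

text \<open>Relativization does not put the parameter into \<open>N\<close>; the first conjunct does.\<close>

definition failure :: "fm \<Rightarrow> nat \<Rightarrow> fm \<Rightarrow> fm" where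
  "failure \<theta> k \<phi> = And (Ex (Eq (Var 0) (Var 1))) (And (Field_Rel \<theta>) (neg (Ind \<theta> k \<phi>)))"

lemma sat_failure:
  "sat E F U (\<lambda>_. r) (failure \<theta> k \<phi>) \<longleftrightarrow>
    r \<in> U \<and> sat E F U (\<lambda>_. r) (Field_Rel \<theta>) \<and> \<not> sat E F U (\<lambda>_. r) (Ind \<theta> k \<phi>)"
  by (auto simp: failure_def)

lemma reflection_failure_in_Reflection:
  assumes "set_fm \<theta>" "fv_below 3 \<theta>" "set_fm \<phi>" "fv_below (Suc k) \<phi>"
  shows "reflection (failure \<theta> k \<phi>) \<in> Reflection" "fv_below 1 (failure \<theta> k \<phi>)"
proof -
  have "set_fm (failure \<theta> k \<phi>)"
    using assms by (simp add: failure_def Field_Rel_def Ind_def in_X_def less_X_def le_X_def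
        set_fm_inst list_all_iff)
  moreover show "fv_below 1 (failure \<theta> k \<phi>)"
    using fv_below_Ind assms by (simp add: failure_def Field_Rel_def in_X_def le_X_def
        fv_below_inst numeral_3_eq_3)
  ultimately show "reflection (failure \<theta> k \<phi>) \<in> Reflection" by (auto simp: Reflection_iff)
qed

locale reflecting_model = prs_model +
  assumes Reflection: "\<chi> \<in> Reflection \<Longrightarrow> sat E F UNIV e \<chi>"
begin

theorem Class_Induction:
  assumes "\<chi> \<in> Class_Induction"
  shows "sat E F UNIV e \<chi>"
proof -
  obtain \<theta> \<theta>' k \<phi> where \<chi>: "\<chi> = class_induction \<theta> \<theta>' k \<phi>" and \<theta>: "sigma_fm \<theta>" "fv_below 3 \<theta>"
    and \<theta>': "fv_below 3 \<theta>'" and \<phi>: "set_fm \<phi>" "fv_below (Suc k) \<phi>"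
    using assms Class_Induction_iff by blast
  have "sat E F UNIV (\<lambda>_. r) (Ind \<theta> k \<phi>)" if r: "r \<sqsubseteq> om"
    and \<Delta>: "sat E F UNIV (\<lambda>_. r) (Delta_Rel \<theta> \<theta>')" and wf: "sat E F UNIV (\<lambda>_. r) (WF \<theta>)" for r
  proof (rule ccontr)
    assume "\<not> ?thesis"
    with \<Delta> have "sat E F UNIV (\<lambda>_. r) (failure \<theta> k \<phi>)"
      by (simp add: sat_failure Delta_Rel_def Field_Rel_def)
    moreover note failure = reflection_failure_in_Reflection[OF sigma_fm_set_fm[OF \<theta>(1)] \<theta>(2) \<phi>]
    ultimately obtain N where N: "transitive_set N" "sat E F {x. x \<epsilon> N} (\<lambda>_. r) (failure \<theta> k \<phi>)"
      using Reflection[OF failure(1)] r unfolding sat_reflection[OF failure(2)] by blast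
    then have "sat E F {x. x \<epsilon> N} (\<lambda>_. r) (Ind \<theta> k \<phi>)"
      using induction_in_transitive_set[OF \<theta>(1) \<phi>(1) N(1)] wf
      by (simp add: sat_failure sat_Field_Rel sat_WF sat_Ind \<theta> \<phi>)
    then show False using N(2) by (simp add: sat_failure)
  qed
  then show ?thesis by (simp add: \<chi> sat_class_induction \<theta> \<theta>' \<phi>)
qed

end


section \<open>Models of class induction\<close>

locale inductive_model = prs_model +
  assumes Class_Induction: "\<chi> \<in> Class_Induction \<Longrightarrow> sat E F UNIV e \<chi>"
    and dependent_choice: "sat E F UNIV e dependent_choice"
begin

subsection \<open>Induction principles\<close>

lemma class_induct:
  assumes L: "Delta0 {r} (\<lambda>e. L (e 0) (e 1))" and r: "r \<sqsubseteq> om"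
    and field: "reflexive_on_field UNIV L" and wf: "well_founded L"
    and P: "first_order (\<lambda>e. P (e 0))"
  shows "induction_on UNIV L P"
proof -
  obtain \<theta> where \<theta>: "sigma_fm \<theta>" "pi_fm \<theta>" "fv_below 3 \<theta>"
    and sat_\<theta>: "\<And>x y. sat E F UNIV (x ## y ## (\<lambda>_. r)) \<theta> \<longleftrightarrow> L x y"
    using definable_binary_formula[OF formula_class_Delta0_fms L] unfolding Delta0_fms_def by auto
  obtain \<phi> zs where \<phi>: "set_fm \<phi>" "fv_below (Suc (length zs)) \<phi>"
    and sat_\<phi>: "\<And>x e. sat E F UNIV (x ## zs \<frown> e) \<phi> \<longleftrightarrow> P x"
    using definable_unary_formula[OF formula_class_set_fms P] unfolding set_fms_def by auto
  have "class_induction \<theta> \<theta> (length zs) \<phi> \<in> Class_Induction"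
    using \<theta> \<phi> Class_Induction_iff by blast
  then have "sat E F UNIV undefined (class_induction \<theta> \<theta> (length zs) \<phi>)" by (rule Class_Induction)
  then have "sat E F UNIV (\<lambda>_. r) (Ind \<theta> (length zs) \<phi>)"
    using r field wf by (simp add: sat_class_induction sat_Delta_Rel sat_WF sat_\<theta> \<theta>(3) \<phi>(2))
  then have "induction_on UNIV L (\<lambda>x. sat E F UNIV (x ## zs \<frown> (\<lambda>_. r)) \<phi>)"
    by (simp add: sat_Ind \<theta>(3) \<phi>(2) sat_\<theta>)
  then show ?thesis by (simp add: sat_\<phi>)
qed

lemma mem_induct:
  assumes P: "first_order (\<lambda>e. P (e 0))" and step: "\<And>x. (\<And>y. y \<epsilon> x \<Longrightarrow> P y) \<Longrightarrow> P x"
  shows "P x"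
proof -
  let ?L = "\<lambda>x y. x \<epsilon> y \<or> x = y"
  have "induction_on UNIV ?L P"
  proof (rule class_induct[OF _ _ _ _ P])
    show "Delta0 {emp} (\<lambda>e. ?L (e 0) (e 1))" by (intro definable_intros argument_intros)
    show "well_founded ?L"
      unfolding well_founded_def
    proof (intro allI impI)
      fix w assume "w \<noteq> emp"
      then obtain x where "x \<epsilon> w" "\<forall>y. y \<epsilon> w \<longrightarrow> \<not> y \<epsilon> x" using nonempty regular by blast
      then show "\<exists>x. x \<epsilon> w \<and> (\<forall>y. y \<epsilon> w \<longrightarrow> ?L y x \<longrightarrow> y = x)" by blast
    qed
  qed (simp_all add: reflexive_on_field_def)
  then show ?thesis using step mem_irrefl unfolding induction_on_def by (metis UNIV_I)
qed

lemma om_cases: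
  assumes "n \<epsilon> om"
  shows "n = emp \<or> (\<exists>m. m \<epsilon> om \<and> n = suc m)"
proof -
  have "Delta0 UNIV (\<lambda>e. e 0 = emp \<or> (\<exists>m. m \<epsilon> om \<and> e 0 = suc m))"
    by (intro definable_intros argument_intros)
  then obtain a where a: "\<And>v. v \<epsilon> a \<longleftrightarrow> v \<epsilon> om \<and> (v = emp \<or> (\<exists>m. m \<epsilon> om \<and> v = suc m))"
    using separation[OF prim_rec_pred_Delta0, of UNIV "\<lambda>v. v = emp \<or> (\<exists>m. m \<epsilon> om \<and> v = suc m)"]
    unfolding is_set_def by blast
  have "n \<epsilon> a" by (rule om_least) (use a emp_om suc_om assms in auto)
  then show ?thesis using a by blast
qed

lemma om_induct [consumes 1, case_names definable zero suc]:
  assumes "n \<epsilon> om" and P: "first_order (\<lambda>e. P (e 0))"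
    and "P emp" "\<And>n. n \<epsilon> om \<Longrightarrow> P n \<Longrightarrow> P (suc n)"
  shows "P n"
proof -
  have "first_order (\<lambda>e. e 0 \<epsilon> om \<longrightarrow> P (e 0))" by (intro definable_intros argument_intros P)
  then have "n \<epsilon> om \<longrightarrow> P n"
  proof (rule mem_induct)
    show "n \<epsilon> om \<longrightarrow> P n" if "\<And>m. m \<epsilon> n \<Longrightarrow> m \<epsilon> om \<longrightarrow> P m" for n
      using that om_cases[of n] assms(3,4) by auto
  qed
  then show ?thesis using assms(1) by simp
qed


subsection \<open>Natural numbers\<close>

lemma om_transitive:
  assumes "n \<epsilon> om" shows "n \<sqsubseteq> om"
  using assms
proof (induction rule: om_induct)
  case definable
  show ?case by (intro definable_intros argument_intros)
qed auto

lemma nat_transitive: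
  assumes "n \<epsilon> om" shows "transitive_set n"
  using assms
proof (induction rule: om_induct)
  case definable
  show ?case unfolding transitive_set_def by (intro definable_intros argument_intros)
qed (auto simp: transitive_set_def)

lemma nat_emp_or_mem:
  assumes "n \<epsilon> om" shows "n = emp \<or> emp \<epsilon> n"
  using assms
proof (induction rule: om_induct)
  case definable
  show ?case by (intro definable_intros argument_intros)
qed auto

lemma nat_suc_le:
  assumes "m \<epsilon> om" "n \<epsilon> m" shows "suc n \<epsilon> m \<or> suc n = m"
proof -
  have "\<forall>n. n \<epsilon> m \<longrightarrow> suc n \<epsilon> m \<or> m = suc n"
    using assms(1)
  proof (induction rule: om_induct)
    case definable
    show ?case by (intro definable_intros argument_intros)
  qed auto
  then show ?thesis using assms(2) by auto
qed

lemma nat_linear: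
  assumes "m \<epsilon> om" "n \<epsilon> om" shows "m \<epsilon> n \<or> m = n \<or> n \<epsilon> m"
  using assms(2)
proof (induction rule: om_induct)
  case definable
  show ?case by (intro definable_intros argument_intros)
next
  case zero
  then show ?case using nat_emp_or_mem[OF assms(1)] by auto
next
  case (suc n)
  then show ?case using nat_suc_le[OF assms(1), of n] by auto
qed

text \<open>
  Unlike \<open>n \<in> \<omega>\<close>, this is \<open>\<Delta>\<^sub>0\<close> without the parameter \<open>\<omega>\<close>; the formulas defining \<open>X\<^sup>r\<close> admit
  only \<open>r\<close>.
\<close>

definition is_nat :: "'a \<Rightarrow> bool" where
  "is_nat n \<longleftrightarrow> (n = emp \<or> (\<exists>k. k \<epsilon> n \<and> n = suc k)) \<and>
    (\<forall>m. m \<epsilon> n \<longrightarrow> m = emp \<or> (\<exists>k. k \<epsilon> n \<and> m = suc k))"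

lemma definable_is_nat [definable_intros]:
  assumes "formula_class K" "argument A f" shows "definable K A (\<lambda>e. is_nat (f e))"
proof -
  have "definable K A (\<lambda>e. is_nat (e 0))"
    unfolding is_nat_def by (intro definable_intros argument_intros assms(1))
  then show ?thesis using assms(2) by (rule definable_subst1)
qed

lemma is_nat_iff: "is_nat n \<longleftrightarrow> n \<epsilon> om"
proof
  assume n: "is_nat n"
  show "n \<epsilon> om"
  proof (rule ccontr)
    assume "\<not> n \<epsilon> om"
    have "Delta0 UNIV (\<lambda>e. \<not> e 0 \<epsilon> om)" by (intro definable_intros argument_intros)
    from ex_minimal[OF prim_rec_pred_Delta0[OF this], of n "suc n"] \<open>\<not> n \<epsilon> om\<close>
    obtain m where m: "m \<epsilon> suc n" "\<not> m \<epsilon> om" "\<forall>z. z \<epsilon> suc n \<longrightarrow> \<not> z \<epsilon> om \<longrightarrow> \<not> z \<epsilon> m"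
      by auto
    then have "m = emp \<or> (\<exists>k. k \<epsilon> n \<and> m = suc k)" using n by (auto simp: is_nat_def)
    then show False using m emp_om suc_om by auto
  qed
next
  assume "n \<epsilon> om"
  then show "is_nat n"
  proof (induction rule: om_induct)
    case definable
    show ?case by (intro definable_intros argument_intros)
  qed (auto simp: is_nat_def)
qed

lemma finite_iteration:
  assumes A: "first_order (\<lambda>e. A (e 0))" and H: "first_order (\<lambda>e. H (e 0) (e 1))"
    and mono: "\<And>j v w. H j v \<Longrightarrow> v \<sqsubseteq> w \<Longrightarrow> H j w"
    and step: "\<And>j v. j \<epsilon> n \<Longrightarrow> A v \<Longrightarrow> \<exists>w. A w \<and> v \<sqsubseteq> w \<and> H j w"
    and n: "n \<epsilon> om" and v\<^sub>0: "A v\<^sub>0"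
  shows "\<exists>v. A v \<and> v\<^sub>0 \<sqsubseteq> v \<and> (\<forall>j. j \<epsilon> n \<longrightarrow> H j v)"
proof -
  have "i \<sqsubseteq> n \<longrightarrow> (\<exists>v. A v \<and> v\<^sub>0 \<sqsubseteq> v \<and> (\<forall>j. j \<epsilon> i \<longrightarrow> H j v))" if "i \<epsilon> om" for i
    using that
  proof (induction rule: om_induct)
    case definable
    show ?case
      by (intro definable_intros argument_intros definable_subst1[OF A] definable_subst2[OF H])
  next
    case zero
    then show ?case using v\<^sub>0 by auto
  next
    case (suc k)
    show ?case
    proof
      assume "suc k \<sqsubseteq> n"
      then obtain v where v: "A v" "v\<^sub>0 \<sqsubseteq> v" "\<forall>j. j \<epsilon> k \<longrightarrow> H j v" using suc.IH by auto
      have "k \<epsilon> n" using \<open>suc k \<sqsubseteq> n\<close> by simp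
      from step[OF this v(1)] obtain w where w: "A w" "v \<sqsubseteq> w" "H k w" by blast
      have "\<forall>j. j \<epsilon> suc k \<longrightarrow> H j w" using v(3) w(3) mono[OF _ w(2)] by simp
      then show "\<exists>v. A v \<and> v\<^sub>0 \<sqsubseteq> v \<and> (\<forall>j. j \<epsilon> suc k \<longrightarrow> H j v)" using w v(2) by blast
    qed
  qed
  then show ?thesis using n by blast
qed


subsection \<open>Dependent choice\<close>

definition om_sequence :: "'a \<Rightarrow> 'a \<Rightarrow> bool" where
  "om_sequence f a \<longleftrightarrow>
    (\<forall>p. p \<epsilon> f \<longrightarrow> (\<exists>n x. n \<epsilon> om \<and> x \<epsilon> a \<and> p = opr n x)) \<and>
    (\<forall>n. n \<epsilon> om \<longrightarrow> (\<exists>!x. opr n x \<epsilon> f))"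

lemma om_sequence_dom: "om_sequence f a \<Longrightarrow> opr n x \<epsilon> f \<Longrightarrow> n \<epsilon> om"
  and om_sequence_range: "om_sequence f a \<Longrightarrow> opr n x \<epsilon> f \<Longrightarrow> x \<epsilon> a"
  and om_sequence_total: "om_sequence f a \<Longrightarrow> n \<epsilon> om \<Longrightarrow> \<exists>x. opr n x \<epsilon> f"
  unfolding om_sequence_def by fastforce+

lemma om_sequence_functional:
  assumes "om_sequence f a" "opr n x \<epsilon> f" "opr n y \<epsilon> f" shows "x = y"
  using om_sequence_dom[OF assms(1,2)] assms unfolding om_sequence_def by blast

lemma prim_rec_opr: "prim_rec f \<Longrightarrow> prim_rec g \<Longrightarrow> prim_rec (\<lambda>e. opr (f e) (g e))"
  unfolding opr_def by (intro prim_rec_ins prim_rec_const)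

lemma is_set_product: "is_set (\<lambda>v. \<exists>x y. x \<epsilon> a \<and> y \<epsilon> b \<and> v = opr x y)"
proof -
  obtain g where g: "prim_rec g" "\<And>e v. v \<epsilon> g e \<longleftrightarrow> (\<exists>y. y \<epsilon> b \<and> v \<epsilon> ins emp (opr (e 0) y))"
    using prim_rec_Union[of "\<lambda>_. b" "\<lambda>y e. ins emp (opr (e 0) y)", OF prim_rec_const
        prim_rec_ins[OF prim_rec_const prim_rec_opr[OF prim_rec_var prim_rec_var]]] by auto
  have "is_set (\<lambda>v. \<exists>x. x \<epsilon> a \<and> v \<epsilon> g (\<lambda>_. x))"
    by (rule is_set_Union[OF prim_rec_subst[OF g(1) prim_rec_var]])
  then show ?thesis unfolding g(2) by (simp add: is_set_def)
qed

lemma om_sequence_iff_bounded: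
  "om_sequence f a \<longleftrightarrow> (\<forall>p. p \<epsilon> f \<longrightarrow> (\<exists>n. n \<epsilon> om \<and> (\<exists>x. x \<epsilon> a \<and> p = opr n x))) \<and>
    (\<forall>n. n \<epsilon> om \<longrightarrow> (\<exists>x. x \<epsilon> a \<and> opr n x \<epsilon> f)) \<and>
    (\<forall>n. n \<epsilon> om \<longrightarrow> (\<forall>x. x \<epsilon> a \<longrightarrow> (\<forall>y. y \<epsilon> a \<longrightarrow> opr n x \<epsilon> f \<and> opr n y \<epsilon> f \<longrightarrow> x = y)))"
    (is "_ \<longleftrightarrow> ?pairs \<and> ?total \<and> ?functional")
proof
  assume f: "om_sequence f a"
  then have ?pairs unfolding om_sequence_def by blast
  moreover have ?total using om_sequence_total[OF f] om_sequence_range[OF f] by blast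
  moreover have ?functional using om_sequence_functional[OF f] by blast
  ultimately show "?pairs \<and> ?total \<and> ?functional" by blast
next
  assume bounded: "?pairs \<and> ?total \<and> ?functional"
  then have range: "x \<epsilon> a" if "opr n x \<epsilon> f" for n x using bounded that by fastforce
  have "\<exists>!x. opr n x \<epsilon> f" if n: "n \<epsilon> om" for n
  proof -
    obtain x where x: "opr n x \<epsilon> f" using bounded n by blast
    have "y = x" if "opr n y \<epsilon> f" for y using bounded n x that range by blast
    with x show ?thesis by blast
  qed
  with bounded show "om_sequence f a" unfolding om_sequence_def by blast
qed

lemma sat_Function_to_omega:
  "sat E F UNIV e (Function_to f omega t) \<longleftrightarrow> om_sequence (val F e f) (val F e t)"
  unfolding om_sequence_iff_bounded
  by (simp add: Function_to_def Let_def numeral_eq_Suc flip: opr_def del: in_ins)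

lemma sat_dependent_choice:
  "sat E F UNIV e dependent_choice \<longleftrightarrow>
    (\<forall>a s. a \<noteq> emp \<and> (\<forall>x. x \<epsilon> a \<longrightarrow> (\<exists>y. y \<epsilon> a \<and> opr x y \<epsilon> s)) \<longrightarrow>
      (\<exists>f. om_sequence f a \<and> (\<forall>n. n \<epsilon> om \<longrightarrow> (\<forall>x. x \<epsilon> a \<longrightarrow> (\<forall>y. y \<epsilon> a \<longrightarrow>
          opr n x \<epsilon> f \<and> opr (suc n) y \<epsilon> f \<longrightarrow> opr x y \<epsilon> s)))))"
  by (simp add: dependent_choice_def sat_Function_to_omega numeral_eq_Suc flip: opr_def del: in_ins)

lemma dependent_choice_sequence:
  assumes R: "Delta0 UNIV (\<lambda>e. R (e 0) (e 1))"
    and a: "a \<noteq> emp" "\<And>x. x \<epsilon> a \<Longrightarrow> \<exists>y. y \<epsilon> a \<and> R x y"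
  shows "\<exists>f. om_sequence f a \<and> (\<forall>n x y. opr n x \<epsilon> f \<longrightarrow> opr (suc n) y \<epsilon> f \<longrightarrow> R x y)"
proof -
  obtain p where p: "\<And>v. v \<epsilon> p \<longleftrightarrow> (\<exists>x y. x \<epsilon> a \<and> y \<epsilon> a \<and> v = opr x y)"
    using is_set_product unfolding is_set_def by blast
  have "Delta0 UNIV (\<lambda>e. \<exists>x y. e 0 = opr x y \<and> R x y)"
    by (intro definable_intros argument_intros definable_subst2[OF R])
  from separation[OF prim_rec_pred_Delta0[OF this], of p]
  obtain s where "\<And>v. v \<epsilon> s \<longleftrightarrow> v \<epsilon> p \<and> (\<exists>x y. v = opr x y \<and> R x y)"
    unfolding is_set_def by blast
  then have s: "opr x y \<epsilon> s \<longleftrightarrow> x \<epsilon> a \<and> y \<epsilon> a \<and> R x y" for x y using p by auto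
  then have "\<forall>x. x \<epsilon> a \<longrightarrow> (\<exists>y. y \<epsilon> a \<and> opr x y \<epsilon> s)" using a(2) by blast
  with a(1) obtain f where f: "om_sequence f a"
    and step: "\<forall>n. n \<epsilon> om \<longrightarrow> (\<forall>x. x \<epsilon> a \<longrightarrow> (\<forall>y. y \<epsilon> a \<longrightarrow>
      opr n x \<epsilon> f \<and> opr (suc n) y \<epsilon> f \<longrightarrow> opr x y \<epsilon> s))"
    using dependent_choice[unfolded sat_dependent_choice, THEN spec, THEN spec, of a s] by blast
  have "R x y" if "opr n x \<epsilon> f" "opr (suc n) y \<epsilon> f" for n x y
    using step om_sequence_dom[OF f that(1)] om_sequence_range[OF f] that s by blast
  with f show ?thesis by blast
qed

end


section \<open>The tree of claims\<close>

primrec subfms :: "fm \<Rightarrow> fm set" where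
  "subfms (Mem s t) = {Mem s t}"
| "subfms (NMem s t) = {NMem s t}"
| "subfms (Eq s t) = {Eq s t}"
| "subfms (NEq s t) = {NEq s t}"
| "subfms (And \<phi> \<psi>) = insert (And \<phi> \<psi>) (subfms \<phi> \<union> subfms \<psi>)"
| "subfms (Or \<phi> \<psi>) = insert (Or \<phi> \<psi>) (subfms \<phi> \<union> subfms \<psi>)"
| "subfms (All \<phi>) = insert (All \<phi>) (subfms \<phi>)"
| "subfms (Ex \<phi>) = insert (Ex \<phi>) (subfms \<phi>)"

lemma finite_subfms: "finite (subfms \<phi>)"
  by (induction \<phi>) auto

lemma subfms_refl: "\<phi> \<in> subfms \<phi>"
  by (cases \<phi>) auto

lemma subfms_trans: "\<phi> \<in> subfms \<psi> \<Longrightarrow> subfms \<phi> \<subseteq> subfms \<psi>"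
  by (induction \<psi>) auto

lemma subfms_closed:
  "And \<phi> \<chi> \<in> subfms \<psi> \<Longrightarrow> \<phi> \<in> subfms \<psi> \<and> \<chi> \<in> subfms \<psi>"
  "Or \<phi> \<chi> \<in> subfms \<psi> \<Longrightarrow> \<phi> \<in> subfms \<psi> \<and> \<chi> \<in> subfms \<psi>"
  "All \<phi> \<in> subfms \<psi> \<Longrightarrow> \<phi> \<in> subfms \<psi>"
  "Ex \<phi> \<in> subfms \<psi> \<Longrightarrow> \<phi> \<in> subfms \<psi>"
  using subfms_trans[of "And \<phi> \<chi>" \<psi>] subfms_trans[of "Or \<phi> \<chi>" \<psi>] subfms_trans[of "All \<phi>" \<psi>]
    subfms_trans[of "Ex \<phi>" \<psi>] subfms_refl[of \<phi>] subfms_refl[of \<chi>] by auto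

lemma set_fm_subfms: "\<phi> \<in> subfms \<psi> \<Longrightarrow> set_fm \<psi> \<Longrightarrow> set_fm \<phi>"
  by (induction \<psi>) auto


subsection \<open>Sequences of claims\<close>

text \<open>Sequences are coded as sets of pairs of an index and a claim.\<close>

context prs_model
begin

definition claim :: "fm \<Rightarrow> 'a \<Rightarrow> 'a" where
  "claim \<phi> c = opr (code \<phi>) c"

definition has :: "'a \<Rightarrow> 'a \<Rightarrow> bool" where
  "has s p \<longleftrightarrow> (\<exists>i. opr i p \<epsilon> s)"

definition mentions_at :: "'a \<Rightarrow> 'a \<Rightarrow> 'a \<Rightarrow> bool" where
  "mentions_at s i b \<longleftrightarrow> (\<exists>k a. opr i (opr k (opr b a)) \<epsilon> s)"

definition mentions :: "'a \<Rightarrow> 'a \<Rightarrow> bool" where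
  "mentions s b \<longleftrightarrow> (\<exists>i. mentions_at s i b)"

lemma claim_inject [simp]: "claim \<phi> c = claim \<psi> d \<longleftrightarrow> \<phi> = \<psi> \<and> c = d"
  by (simp add: claim_def)

lemma has_mono: "has s p \<Longrightarrow> s \<sqsubseteq> t \<Longrightarrow> has t p"
  unfolding has_def by blast

lemma mentions_mono: "mentions s b \<Longrightarrow> s \<sqsubseteq> t \<Longrightarrow> mentions t b"
  unfolding mentions_def mentions_at_def by blast

lemma has_claim_mentions: "has s (claim \<phi> (opr b c)) \<Longrightarrow> mentions s b"
  unfolding has_def claim_def mentions_def mentions_at_def by blast

lemma definable_term_claim [definable_intros]:
  "formula_class K \<Longrightarrow> definable_term K A t \<Longrightarrow> definable_term K A (\<lambda>e. claim \<phi> (t e))"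
  unfolding claim_def by (intro definable_intros)

lemma definable_has [definable_intros]:
  assumes "formula_class K" "argument A f" "definable_term K A t"
  shows "definable K A (\<lambda>e. has (f e) (t e))"
proof -
  have "definable_term K A (\<lambda>e. t (\<lambda>i. e (Suc (Suc i))))"
    by (rule definable_term_subst[OF assms(3) argument_var])
  then have "definable K A (\<lambda>e. \<exists>i q. opr i q \<epsilon> f e \<and> q = t e)"
    by (intro definable_ex_opr_mem definable_eq argument_intros assms(1,2))
  moreover have "has s p \<longleftrightarrow> (\<exists>i q. opr i q \<epsilon> s \<and> q = p)" for s p unfolding has_def by blast
  ultimately show ?thesis by simp
qed

lemma definable_mentions [definable_intros]:
  assumes K: "formula_class K" and f: "argument A f" "argument A g"
  shows "definable K A (\<lambda>e. mentions (f e) (g e))"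
proof -
  have "definable K A (\<lambda>e. \<exists>i q. opr i q \<epsilon> e 0 \<and>
      (\<exists>k d. q = opr k d \<and> (\<exists>b a. d = opr b a \<and> b = e 1)))"
    by (intro definable_intros argument_intros K)
  moreover have "mentions s b \<longleftrightarrow>
      (\<exists>i q. opr i q \<epsilon> s \<and> (\<exists>k d. q = opr k d \<and> (\<exists>b' a. d = opr b' a \<and> b' = b)))" for s b
    unfolding mentions_def mentions_at_def by blast
  ultimately have "definable K A (\<lambda>e. mentions (e 0) (e 1))" by simp
  then show ?thesis using f by (rule definable_subst2)
qed

text \<open>
  Universal claims of \<open>u\<close> are instantiated not only to the elements mentioned in \<open>u\<close>, but also to
  all \<open>i \<epsilon> n\<close>. This puts \<open>\<omega>\<close> into the model along a branch, so that its collapse fixes \<open>r \<subseteq> \<omega>\<close>.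
\<close>

definition handled :: "'a \<Rightarrow> 'a \<Rightarrow> 'a \<Rightarrow> fm \<Rightarrow> 'a \<Rightarrow> bool" where
  "handled n u v \<phi> c \<longleftrightarrow> (case \<phi> of
      And \<alpha> \<beta> \<Rightarrow> has v (claim \<alpha> c) \<and> has v (claim \<beta> c)
    | Or \<alpha> \<beta> \<Rightarrow> has v (claim \<alpha> c) \<or> has v (claim \<beta> c)
    | All \<alpha> \<Rightarrow> \<forall>b. b \<epsilon> n \<or> mentions u b \<longrightarrow> has v (claim \<alpha> (opr b c))
    | Ex \<alpha> \<Rightarrow> \<exists>b. has v (claim \<alpha> (opr b c))
    | _ \<Rightarrow> sat E F UNIV (decode c) \<phi>)"

lemma handled_simps [simp]:
  "handled n u v (Mem s t) c \<longleftrightarrow> sat E F UNIV (decode c) (Mem s t)"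
  "handled n u v (NMem s t) c \<longleftrightarrow> sat E F UNIV (decode c) (NMem s t)"
  "handled n u v (Eq s t) c \<longleftrightarrow> sat E F UNIV (decode c) (Eq s t)"
  "handled n u v (NEq s t) c \<longleftrightarrow> sat E F UNIV (decode c) (NEq s t)"
  "handled n u v (And \<alpha> \<beta>) c \<longleftrightarrow> has v (claim \<alpha> c) \<and> has v (claim \<beta> c)"
  "handled n u v (Or \<alpha> \<beta>) c \<longleftrightarrow> has v (claim \<alpha> c) \<or> has v (claim \<beta> c)"
  "handled n u v (All \<alpha>) c \<longleftrightarrow> (\<forall>b. b \<epsilon> n \<or> mentions u b \<longrightarrow> has v (claim \<alpha> (opr b c)))"
  "handled n u v (Ex \<alpha>) c \<longleftrightarrow> (\<exists>b. has v (claim \<alpha> (opr b c)))"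
  by (simp_all add: handled_def)

lemma handled_mono: "handled n u v \<phi> c \<Longrightarrow> v \<sqsubseteq> w \<Longrightarrow> handled n u w \<phi> c"
  using has_mono[of v _ w] by (cases \<phi>) auto

lemma definable_handled_All:
  assumes K: "formula_class K"
  shows "definable K A (\<lambda>e. handled (e 0) (e 1) (e 2) (All \<alpha>) (e 3))"
proof -
  have "definable K A (\<lambda>e. (\<forall>b. b \<epsilon> e 0 \<longrightarrow> has (e 2) (claim \<alpha> (opr b (e 3)))) \<and>
      (\<forall>i q. opr i q \<epsilon> e 1 \<longrightarrow> (\<forall>k d. q = opr k d \<longrightarrow> (\<forall>b a. d = opr b a \<longrightarrow>
        has (e 2) (claim \<alpha> (opr b (e 3)))))))"
    by (intro definable_intros argument_intros K)
  moreover have "handled n u v (All \<alpha>) c \<longleftrightarrow> (\<forall>b. b \<epsilon> n \<longrightarrow> has v (claim \<alpha> (opr b c))) \<and>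
      (\<forall>i q. opr i q \<epsilon> u \<longrightarrow> (\<forall>k d. q = opr k d \<longrightarrow> (\<forall>b a. d = opr b a \<longrightarrow> has v (claim \<alpha> (opr b c)))))"
    for n u v c
    unfolding handled_simps mentions_def mentions_at_def by blast
  ultimately show ?thesis by simp
qed

lemma definable_handled_Ex:
  assumes K: "formula_class K"
  shows "definable K A (\<lambda>e. handled (e 0) (e 1) (e 2) (Ex \<alpha>) (e 3))"
proof -
  have "definable K A (\<lambda>e. \<exists>i q. opr i q \<epsilon> e 2 \<and>
      (\<exists>k d. q = opr k d \<and> (k = code \<alpha> \<and> (\<exists>b a. d = opr b a \<and> a = e 3))))"
    by (intro definable_intros argument_intros K)
  moreover have "handled n u v (Ex \<alpha>) c \<longleftrightarrow> (\<exists>i q. opr i q \<epsilon> v \<and>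
      (\<exists>k d. q = opr k d \<and> (k = code \<alpha> \<and> (\<exists>b a. d = opr b a \<and> a = c))))" for n u v c
    unfolding handled_simps has_def claim_def by blast
  ultimately show ?thesis by simp
qed

lemma definable_handled [definable_intros]:
  assumes "formula_class K" "set_fm \<phi>" "argument A n" "argument A u" "argument A v" "argument A c"
  shows "definable K A (\<lambda>e. handled (n e) (u e) (v e) \<phi> (c e))"
proof -
  have "definable K A (\<lambda>e. handled (e 0) (e 1) (e 2) \<phi> (e 3))"
  proof (cases \<phi>)
    case (All \<alpha>)
    then show ?thesis using definable_handled_All assms(1) by blast
  next
    case (Ex \<alpha>)
    then show ?thesis using definable_handled_Ex assms(1) by blast
  next
    case (And \<alpha> \<beta>)
    show ?thesis unfolding And handled_simps by (intro definable_intros argument_intros assms(1))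
  next
    case (Or \<alpha> \<beta>)
    show ?thesis unfolding Or handled_simps by (intro definable_intros argument_intros assms(1))
  qed (use assms(1,2) in \<open>simp_all only: handled_simps set_fm.simps,
    (intro definable_sat_decode_atomic argument_intros; simp)+\<close>)
  then show ?thesis using assms(3-6) by (rule definable_subst4)
qed

end


subsection \<open>Nodes and steps\<close>

locale claim_tree = inductive_model E F
  for E :: "'a \<Rightarrow> 'a \<Rightarrow> bool" (infix "\<epsilon>" 50) and F +
  fixes \<Psi> :: fm and r :: 'a
  assumes set_fm_root: "set_fm \<Psi>" and parameter: "r \<sqsubseteq> om"
begin

abbreviation root_claim :: 'a where
  "root_claim \<equiv> claim \<Psi> (opr r emp)"

text \<open>The bound \<open>n\<close> on the indices of \<open>s\<close> provides a fresh index for a further claim.\<close>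

definition node :: "'a \<Rightarrow> 'a \<Rightarrow> bool" where
  "node n s \<longleftrightarrow> is_nat n \<and> (\<forall>p. p \<epsilon> s \<longrightarrow> (\<exists>i q. p = opr i q \<and> i \<epsilon> n)) \<and>
    (\<forall>i p. opr i p \<epsilon> s \<longrightarrow> (\<forall>j q. opr j q \<epsilon> s \<longrightarrow> i = j \<longrightarrow> p = q)) \<and> has s root_claim"

definition step :: "'a \<Rightarrow> 'a \<Rightarrow> 'a \<Rightarrow> 'a \<Rightarrow> bool" where
  "step n u m v \<longleftrightarrow> n \<epsilon> m \<and> u \<sqsubseteq> v \<and>
    (\<forall>\<phi>\<in>subfms \<Psi>. \<forall>c. has u (claim \<phi> c) \<longrightarrow> handled n u v \<phi> c)"

definition below :: "'a \<Rightarrow> 'a \<Rightarrow> bool" where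
  "below y x \<longleftrightarrow> (\<exists>n u. x = opr n u \<and> (\<exists>m v. y = opr m v \<and>
    (node n u \<and> node m v \<and> (y = x \<or> step n u m v))))"

lemma node_nat: "node n s \<Longrightarrow> n \<epsilon> om"
  and node_index: "node n s \<Longrightarrow> opr i p \<epsilon> s \<Longrightarrow> i \<epsilon> n"
  and node_functional: "node n s \<Longrightarrow> opr i p \<epsilon> s \<Longrightarrow> opr i q \<epsilon> s \<Longrightarrow> p = q"
  and node_root: "node n s \<Longrightarrow> has s root_claim"
  unfolding node_def is_nat_iff by fastforce+

lemma below_opr:
  "below (opr m v) (opr n u) \<longleftrightarrow> node n u \<and> node m v \<and> (m = n \<and> v = u \<or> step n u m v)"
  by (auto simp: below_def)

lemma definable_node: "formula_class K \<Longrightarrow> definable K {r} (\<lambda>e. node (e i) (e j))"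
  unfolding node_def by (intro definable_intros argument_intros)

lemma definable_step:
  assumes K: "formula_class K" shows "definable K A (\<lambda>e. step (e i) (e j) (e k) (e l))"
proof -
  have "definable K A (\<lambda>e. e 0 \<epsilon> e 2 \<and> e 1 \<sqsubseteq> e 3 \<and> (\<forall>\<phi>\<in>subfms \<Psi>. \<forall>i q. opr i q \<epsilon> e 1 \<longrightarrow>
      (\<forall>k c. q = opr k c \<longrightarrow> k = code \<phi> \<longrightarrow> handled (e 0) (e 1) (e 3) \<phi> c)))"
    by (intro definable_intros argument_intros K finite_subfms set_fm_subfms[OF _ set_fm_root])
  moreover have "step n u m v \<longleftrightarrow> n \<epsilon> m \<and> u \<sqsubseteq> v \<and> (\<forall>\<phi>\<in>subfms \<Psi>. \<forall>i q. opr i q \<epsilon> u \<longrightarrow>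
      (\<forall>k c. q = opr k c \<longrightarrow> k = code \<phi> \<longrightarrow> handled n u v \<phi> c))" for n u m v
    unfolding step_def has_def claim_def by blast
  ultimately have "definable K A (\<lambda>e. step (e 0) (e 1) (e 2) (e 3))" by simp
  then show ?thesis by (rule definable_subst4) (rule argument_var)+
qed

lemma Delta0_below: "Delta0 {r} (\<lambda>e. below (e i) (e j))"
  unfolding below_def by (intro definable_intros argument_intros definable_node definable_step)


subsection \<open>Nodes with true claims\<close>

definition true_claim :: "'a \<Rightarrow> bool" where
  "true_claim p \<longleftrightarrow> (\<exists>\<phi>\<in>subfms \<Psi>. \<exists>c. p = claim \<phi> c \<and> sat E F UNIV (decode c) \<phi>)"

definition all_true :: "'a \<Rightarrow> bool" where
  "all_true u \<longleftrightarrow> (\<forall>i p. opr i p \<epsilon> u \<longrightarrow> true_claim p)"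

definition true_extension :: "'a \<Rightarrow> 'a \<Rightarrow> 'a \<Rightarrow> bool" where
  "true_extension n u v \<longleftrightarrow> (\<exists>m. node m v \<and> n \<epsilon> m) \<and> all_true v \<and> u \<sqsubseteq> v"

lemma true_claimI: "\<phi> \<in> subfms \<Psi> \<Longrightarrow> sat E F UNIV (decode c) \<phi> \<Longrightarrow> true_claim (claim \<phi> c)"
  unfolding true_claim_def by blast

lemma first_order_all_true: "first_order (\<lambda>e. all_true (e i))"
  unfolding all_true_def true_claim_def
  by (intro definable_intros argument_intros finite_subfms set_fm_subfms[OF _ set_fm_root])

lemma first_order_true_extension: "first_order (\<lambda>e. true_extension n u (e i))"
proof -
  have "first_order (\<lambda>e. node (e j) (e k))" for j k
    by (rule definable_mono[OF definable_node]) (auto intro: formula_class_set_fms)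
  then show ?thesis
    unfolding true_extension_def by (intro definable_intros argument_intros first_order_all_true)
qed

lemma extend_true:
  assumes "true_extension n u v" "true_claim p"
  shows "\<exists>w. true_extension n u w \<and> v \<sqsubseteq> w \<and> has w p"
proof -
  obtain m where m: "node m v" "n \<epsilon> m" and v: "all_true v" "u \<sqsubseteq> v"
    using assms(1) unfolding true_extension_def by blast
  let ?w = "ins v (opr m p)"
  have "node (suc m) ?w"
    unfolding node_def is_nat_iff
  proof (intro conjI allI impI)
    show "suc m \<epsilon> om" using node_nat[OF m(1)] by (rule suc_om)
    show "\<exists>i q. p' = opr i q \<and> i \<epsilon> suc m" if "p' \<epsilon> ?w" for p'
      using that m(1) unfolding node_def by auto
    show "q = q'" if "opr i q \<epsilon> ?w" "opr j q' \<epsilon> ?w" "i = j" for i q j q'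
      using that node_functional[OF m(1)] node_index[OF m(1)] mem_irrefl[of m] by auto
    show "has ?w root_claim" using node_root[OF m(1)] by (rule has_mono) simp
  qed
  moreover have "all_true ?w" using v(1) assms(2) unfolding all_true_def by simp
  ultimately have "true_extension n u ?w" using m(2) v(2) unfolding true_extension_def by fastforce
  moreover have "has ?w p" unfolding has_def by auto
  ultimately show ?thesis by auto
qed

lemma extend_true_instances:
  assumes node: "node n u" and w: "true_extension n u w"
    and true: "\<And>b. true_claim (claim \<alpha> (opr b c))"
  shows "\<exists>w'. true_extension n u w' \<and> w \<sqsubseteq> w' \<and>
    (\<forall>b. b = j \<or> mentions_at u j b \<longrightarrow> has w' (claim \<alpha> (opr b c)))"
proof -
  obtain w\<^sub>1 where w\<^sub>1: "true_extension n u w\<^sub>1" "w \<sqsubseteq> w\<^sub>1" "has w\<^sub>1 (claim \<alpha> (opr j c))"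
    using extend_true[OF w true] by blast
  have unique: "b = b'" if "mentions_at u j b" "mentions_at u j b'" for b b'
    using that node_functional[OF node] unfolding mentions_at_def by (metis opr_inject)
  show ?thesis
  proof (cases "\<exists>b. mentions_at u j b")
    case True
    then obtain b where b: "mentions_at u j b" by blast
    obtain w\<^sub>2 where w\<^sub>2: "true_extension n u w\<^sub>2" "w\<^sub>1 \<sqsubseteq> w\<^sub>2" "has w\<^sub>2 (claim \<alpha> (opr b c))"
      using extend_true[OF w\<^sub>1(1) true] by blast
    have "has w\<^sub>2 (claim \<alpha> (opr j c))" using w\<^sub>1(3) w\<^sub>2(2) by (rule has_mono)
    then have "\<forall>b'. b' = j \<or> mentions_at u j b' \<longrightarrow> has w\<^sub>2 (claim \<alpha> (opr b' c))"
      using w\<^sub>2(3) unique[OF b] by blast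
    then show ?thesis using w\<^sub>1(2) w\<^sub>2(1,2) by blast
  next
    case False
    then show ?thesis using w\<^sub>1 by blast
  qed
qed

lemma handle_true_All:
  assumes node: "node n u" and v: "true_extension n u v"
    and \<alpha>: "All \<alpha> \<in> subfms \<Psi>" "sat E F UNIV (decode c) (All \<alpha>)"
  shows "\<exists>w. true_extension n u w \<and> v \<sqsubseteq> w \<and> handled n u w (All \<alpha>) c"
proof -
  have instance_true: "true_claim (claim \<alpha> (opr b c))" for b
    by (rule true_claimI[OF subfms_closed(3)[OF \<alpha>(1)]]) (use \<alpha>(2) in simp)
  let ?H = "\<lambda>j w. \<forall>b. b = j \<or> mentions_at u j b \<longrightarrow> has w (claim \<alpha> (opr b c))"
  have "\<exists>w. true_extension n u w \<and> v \<sqsubseteq> w \<and> (\<forall>j. j \<epsilon> n \<longrightarrow> ?H j w)"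
  proof (rule finite_iteration)
    show "first_order (\<lambda>e. true_extension n u (e 0))" by (rule first_order_true_extension)
    show "first_order (\<lambda>e. ?H (e 0) (e 1))"
      unfolding mentions_at_def by (intro definable_intros argument_intros)
    show "?H j w'" if "?H j w" "w \<sqsubseteq> w'" for j w w' using that has_mono by blast
    show "\<exists>w'. true_extension n u w' \<and> w \<sqsubseteq> w' \<and> ?H j w'" if "true_extension n u w" for j w
      using node that instance_true by (rule extend_true_instances)
    show "n \<epsilon> om" using node by (rule node_nat)
  qed (rule v)
  then obtain w where w: "true_extension n u w" "v \<sqsubseteq> w" and H: "\<And>j. j \<epsilon> n \<Longrightarrow> ?H j w" by blast
  have "b \<epsilon> n \<or> mentions u b \<longrightarrow> has w (claim \<alpha> (opr b c))" for b
    using H node_index[OF node] unfolding mentions_def mentions_at_def by blast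
  with w show ?thesis by auto
qed

lemma handle_true:
  assumes node: "node n u" and v: "true_extension n u v"
    and \<phi>: "\<phi> \<in> subfms \<Psi>" "sat E F UNIV (decode c) \<phi>"
  shows "\<exists>w. true_extension n u w \<and> v \<sqsubseteq> w \<and> handled n u w \<phi> c"
proof (cases \<phi>)
  case (And \<alpha> \<beta>)
  then have "true_claim (claim \<alpha> c)" "true_claim (claim \<beta> c)"
    using \<phi> subfms_closed(1)[of \<alpha> \<beta> \<Psi>] by (auto intro: true_claimI)
  then obtain w w' where "true_extension n u w" "v \<sqsubseteq> w" "has w (claim \<alpha> c)"
      "true_extension n u w'" "w \<sqsubseteq> w'" "has w' (claim \<beta> c)"
    using extend_true[OF v] extend_true by metis
  then have "handled n u w' \<phi> c" using has_mono[of w "claim \<alpha> c" w'] And by simp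
  then show ?thesis using \<open>true_extension n u w'\<close> \<open>v \<sqsubseteq> w\<close> \<open>w \<sqsubseteq> w'\<close> by blast
next
  case (Or \<alpha> \<beta>)
  then have "true_claim (claim \<alpha> c) \<or> true_claim (claim \<beta> c)"
    using \<phi> subfms_closed(2)[of \<alpha> \<beta> \<Psi>] by (auto intro: true_claimI)
  then show ?thesis using extend_true[OF v] Or by auto
next
  case (All \<alpha>)
  then show ?thesis using handle_true_All[OF node v] \<phi> by blast
next
  case (Ex \<alpha>)
  then obtain b where "sat E F UNIV (decode (opr b c)) \<alpha>" using \<phi>(2) by auto
  then have "true_claim (claim \<alpha> (opr b c))" using \<phi>(1) Ex subfms_closed(4) true_claimI by blast
  from extend_true[OF v this] show ?thesis unfolding Ex handled_simps by blast
qed (use v \<phi> in auto)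

lemma true_node_step:
  assumes node: "node n u" and u: "all_true u"
  shows "\<exists>m v. node m v \<and> all_true v \<and> step n u m v"
proof -
  let ?H = "\<lambda>j w. \<forall>\<phi>\<in>subfms \<Psi>. \<forall>c. opr j (claim \<phi> c) \<epsilon> u \<longrightarrow> handled n u w \<phi> c"
  have "\<exists>w. true_extension n u w \<and> u \<sqsubseteq> w \<and> (\<forall>j. j \<epsilon> n \<longrightarrow> ?H j w)"
  proof (rule finite_iteration)
    show "first_order (\<lambda>e. true_extension n u (e 0))" by (rule first_order_true_extension)
    show "first_order (\<lambda>e. ?H (e 0) (e 1))"
      by (intro definable_intros argument_intros finite_subfms set_fm_subfms[OF _ set_fm_root])
    show "?H j w'" if "?H j w" "w \<sqsubseteq> w'" for j w w' using that handled_mono by blast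
    show "\<exists>w'. true_extension n u w' \<and> w \<sqsubseteq> w' \<and> ?H j w'" if w: "true_extension n u w" for j w
    proof (cases "\<exists>p. opr j p \<epsilon> u")
      case True
      then obtain \<phi> c where \<phi>: "opr j (claim \<phi> c) \<epsilon> u" "\<phi> \<in> subfms \<Psi>" "sat E F UNIV (decode c) \<phi>"
        using u unfolding all_true_def true_claim_def by blast
      obtain w' where w': "true_extension n u w'" "w \<sqsubseteq> w'" "handled n u w' \<phi> c"
        using handle_true[OF node w \<phi>(2,3)] by blast
      have "\<psi> = \<phi> \<and> d = c" if "opr j (claim \<psi> d) \<epsilon> u" for \<psi> d
        using node_functional[OF node that \<phi>(1)] by simp
      then have "?H j w'" using w'(3) by blast
      then show ?thesis using w' by blast
    next
      case False
      then show ?thesis using w by blast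
    qed
    show "n \<epsilon> om" using node by (rule node_nat)
    have "node (suc n) u" using node suc_om unfolding node_def is_nat_iff by fastforce
    then show "true_extension n u u" using u unfolding true_extension_def by fastforce
  qed
  then obtain v m where v: "all_true v" "u \<sqsubseteq> v" "node m v" "n \<epsilon> m" and H: "\<And>j. j \<epsilon> n \<Longrightarrow> ?H j v"
    unfolding true_extension_def by blast
  have "handled n u v \<phi> c" if "\<phi> \<in> subfms \<Psi>" "has u (claim \<phi> c)" for \<phi> c
    using that H node_index[OF node] unfolding has_def by blast
  then have "step n u m v" using v unfolding step_def by blast
  with v show ?thesis by blast
qed

lemma not_well_founded:
  assumes "sat E F UNIV (decode (opr r emp)) \<Psi>"
  shows "\<not> well_founded below"
proof
  assume wf: "well_founded below"
  have "induction_on UNIV below (\<lambda>x. \<not> (\<exists>n u. x = opr n u \<and> all_true u))"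
  proof (rule class_induct[OF Delta0_below parameter _ wf])
    show "reflexive_on_field UNIV below" by (auto simp: reflexive_on_field_def below_def)
    show "first_order (\<lambda>e. \<not> (\<exists>n u. e 0 = opr n u \<and> all_true u))"
      by (intro definable_intros argument_intros first_order_all_true)
  qed
  moreover have "\<exists>y. below y x \<and> y \<noteq> x \<and> (\<exists>n u. y = opr n u \<and> all_true u)"
    if x: "below x x" "\<exists>n u. x = opr n u \<and> all_true u" for x
  proof -
    obtain n u where u: "x = opr n u" "all_true u" using x(2) by blast
    then have "node n u" using x(1) by (simp add: below_opr)
    with u obtain m v where "node m v" "all_true v" "step n u m v" using true_node_step by blast
    moreover from this have "m \<noteq> n" using mem_irrefl unfolding step_def by blast
    ultimately show ?thesis using u \<open>node n u\<close> by (intro exI[of _ "opr m v"]) (simp add: below_opr)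
  qed
  ultimately have no_true_node: "\<not> all_true u" if "node n u" for n u
    using that below_opr unfolding induction_on_def by blast
  let ?u = "ins emp (opr emp root_claim)"
  have "node (suc emp) ?u"
    unfolding node_def is_nat_iff has_def using suc_om[OF emp_om] by auto
  moreover have "all_true ?u"
    unfolding all_true_def using true_claimI[OF subfms_refl assms] by simp
  ultimately show False using no_true_node by blast
qed

end


subsection \<open>The model along a branch\<close>

locale claim_branch = claim_tree +
  fixes w f :: 'a
  assumes sequence: "om_sequence f w"
    and descending: "opr k x \<epsilon> f \<Longrightarrow> opr (suc k) y \<epsilon> f \<Longrightarrow> below y x \<and> y \<noteq> x"
begin

definition stage :: "'a \<Rightarrow> 'a \<Rightarrow> 'a \<Rightarrow> bool" where
  "stage k n u \<longleftrightarrow> opr k (opr n u) \<epsilon> f"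

lemma stage_index: "stage k n u \<Longrightarrow> k \<epsilon> om"
  unfolding stage_def by (rule om_sequence_dom[OF sequence])

lemma ex_stage:
  assumes "k \<epsilon> om" shows "\<exists>n u. stage k n u \<and> node n u"
proof -
  obtain x where x: "opr k x \<epsilon> f" using om_sequence_total[OF sequence assms] by blast
  obtain y where "opr (suc k) y \<epsilon> f" using om_sequence_total[OF sequence suc_om[OF assms]] by blast
  then have "below y x" using descending x by blast
  then show ?thesis using x unfolding below_def stage_def by blast
qed

lemma stage_unique: "stage k n u \<Longrightarrow> stage k m v \<Longrightarrow> n = m \<and> u = v"
  unfolding stage_def using om_sequence_functional[OF sequence] by (metis opr_inject)

lemma stage_node: "stage k n u \<Longrightarrow> node n u"
  using ex_stage[OF stage_index] stage_unique by blast

lemma stage_step: "stage k n u \<Longrightarrow> stage (suc k) m v \<Longrightarrow> step n u m v"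
  using descending[of k "opr n u" "opr m v"] unfolding stage_def below_opr by auto

lemma stage_suc_mono:
  assumes "stage k n u" "stage (suc k) m v" shows "n \<sqsubseteq> m \<and> u \<sqsubseteq> v"
proof -
  have "n \<epsilon> m" "u \<sqsubseteq> v" using stage_step[OF assms] unfolding step_def by blast+
  moreover have "transitive_set m" using nat_transitive[OF node_nat[OF stage_node[OF assms(2)]]] .
  ultimately show ?thesis unfolding transitive_set_def by blast
qed

lemma stage_mono:
  assumes "stage j n u" "stage k m v" "j \<epsilon> k"
  shows "n \<sqsubseteq> m \<and> u \<sqsubseteq> v"
proof -
  have "\<forall>m v. stage k m v \<longrightarrow> j \<epsilon> k \<longrightarrow> n \<sqsubseteq> m \<and> u \<sqsubseteq> v"
    using stage_index[OF assms(2)]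
  proof (induction rule: om_induct)
    case definable
    show ?case unfolding stage_def by (intro definable_intros argument_intros)
  next
    case (suc k)
    obtain m' v' where k: "stage k m' v'" using ex_stage[OF suc.hyps] by blast
    show ?case
    proof (intro allI impI)
      fix m v assume "stage (suc k) m v" "j \<epsilon> suc k"
      then have "m' \<sqsubseteq> m \<and> v' \<sqsubseteq> v" using stage_suc_mono k by blast
      moreover have "n \<sqsubseteq> m' \<and> u \<sqsubseteq> v'"
      proof (cases "j = k")
        case True
        then show ?thesis using stage_unique[OF assms(1)] k by blast
      next
        case False
        then have "j \<epsilon> k" using \<open>j \<epsilon> suc k\<close> by simp
        then show ?thesis using suc.IH k by blast
      qed
      ultimately show "n \<sqsubseteq> m \<and> u \<sqsubseteq> v" by blast
    qed
  qed simp
  then show ?thesis using assms by blast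
qed

lemma stage_directed:
  assumes "stage j n u" "stage k m v"
  shows "(n \<sqsubseteq> m \<and> u \<sqsubseteq> v) \<or> (m \<sqsubseteq> n \<and> v \<sqsubseteq> u)"
proof -
  consider (less) "j \<epsilon> k" | (equal) "j = k" | (greater) "k \<epsilon> j"
    using nat_linear stage_index assms by blast
  then show ?thesis
  proof cases
    case less
    then show ?thesis using stage_mono assms by blast
  next
    case equal
    then show ?thesis using stage_unique assms by blast
  next
    case greater
    then show ?thesis using stage_mono assms by blast
  qed
qed

lemma stage_large:
  assumes "stage k n u" shows "k \<epsilon> n"
proof -
  have "\<forall>n u. stage k n u \<longrightarrow> k \<epsilon> n"
    using stage_index[OF assms]
  proof (induction rule: om_induct)
    case definable
    show ?case unfolding stage_def by (intro definable_intros argument_intros)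
  next
    case zero
    have "emp \<epsilon> n" if "node n u" for n u
      using node_root[OF that] node_index[OF that] nat_emp_or_mem[OF node_nat[OF that]]
      unfolding has_def by auto
    then show ?case using stage_node by blast
  next
    case (suc k)
    show ?case
    proof (intro allI impI)
      fix m v assume m: "stage (suc k) m v"
      obtain n u where n: "stage k n u" using ex_stage[OF suc.hyps] by blast
      then have "k \<epsilon> n" "n \<epsilon> m" using suc.IH stage_step[OF n m] unfolding step_def by blast+
      moreover have "n \<epsilon> om" "transitive_set m"
        using stage_node n m node_nat nat_transitive by blast+
      ultimately show "suc k \<epsilon> m"
        using nat_suc_le[of n k] unfolding transitive_set_def by blast
    qed
  qed
  then show ?thesis using assms by blast
qed

definition branch_universe :: "'a set" where
  "branch_universe = {b. b \<epsilon> om \<or> (\<exists>k n u. stage k n u \<and> mentions u b)}"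

lemma is_set_branch_universe: "is_set (\<lambda>b. b \<in> branch_universe)"
proof -
  have in_universe: "b \<in> branch_universe \<longleftrightarrow>
      b \<epsilon> om \<or> (\<exists>k x. opr k x \<epsilon> f \<and> (\<exists>n u. x = opr n u \<and> mentions u b))" for b
    unfolding branch_universe_def stage_def by blast
  have "Delta0 UNIV (\<lambda>e. e 0 \<in> branch_universe)"
    unfolding in_universe by (intro definable_intros argument_intros)
  then have set: "is_set (\<lambda>b. b \<epsilon> t \<and> b \<in> branch_universe)" for t
    by (rule separation[OF prim_rec_pred_Delta0])
  obtain t where t: "upr om f \<sqsubseteq> t" "transitive_set t" using ex_transitive_superset by blast
  have pair: "x \<epsilon> t \<and> y \<epsilon> t" if "opr x y \<epsilon> t" for x y
    using that t(2) components_in_upr unfolding transitive_set_def by blast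
  have elem: "x \<epsilon> t" if "x \<epsilon> y" "y \<epsilon> t" for x y
    using that t(2) unfolding transitive_set_def by blast
  have "b \<epsilon> t" if "b \<in> branch_universe" for b
    using that unfolding in_universe
  proof (elim disjE exE conjE)
    assume "b \<epsilon> om"
    then show ?thesis using t(1) elem by auto
  next
    fix k x n u assume "opr k x \<epsilon> f" "x = opr n u" "mentions u b"
    moreover have "f \<epsilon> t" using t(1) by simp
    ultimately have "u \<epsilon> t" using elem pair by blast
    moreover obtain i j a where "opr i (opr j (opr b a)) \<epsilon> u"
      using \<open>mentions u b\<close> unfolding mentions_def mentions_at_def by blast
    ultimately have "opr i (opr j (opr b a)) \<epsilon> t" using elem by blast
    then show ?thesis using pair by blast
  qed
  then have "(\<lambda>b. b \<epsilon> t \<and> b \<in> branch_universe) = (\<lambda>b. b \<in> branch_universe)" by auto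
  with set[of t] show ?thesis by simp
qed

lemma stage_handled:
  assumes "stage k n u" "\<phi> \<in> subfms \<Psi>" "has u (claim \<phi> c)"
  shows "\<exists>m v. stage (suc k) m v \<and> handled n u v \<phi> c"
proof -
  obtain m v where "stage (suc k) m v" using ex_stage suc_om stage_index[OF assms(1)] by blast
  then show ?thesis using stage_step[OF assms(1)] assms(2,3) unfolding step_def by blast
qed

lemma stage_mentioning:
  assumes "stage k n u" "b \<in> branch_universe"
  shows "\<exists>j m v. stage j m v \<and> u \<sqsubseteq> v \<and> (b \<epsilon> m \<or> mentions v b)"
proof -
  obtain j m v where "stage j m v" "b \<epsilon> m \<or> mentions v b"
    using assms(2) ex_stage stage_large unfolding branch_universe_def by blast
  then show ?thesis using stage_directed[OF assms(1)] assms(1) mentions_mono by blast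
qed

lemma branch_claim_true:
  "\<phi> \<in> subfms \<Psi> \<Longrightarrow> stage k n u \<Longrightarrow> has u (claim \<phi> c) \<Longrightarrow> sat E F branch_universe (decode c) \<phi>"
proof (induction \<phi> arbitrary: k n u c)
  case (And \<phi> \<psi>)
  obtain m v where "stage (suc k) m v" "handled n u v (And \<phi> \<psi>) c"
    using stage_handled And.prems by blast
  then show ?case using And.IH subfms_closed(1)[OF And.prems(1)] by simp
next
  case (Or \<phi> \<psi>)
  obtain m v where "stage (suc k) m v" "handled n u v (Or \<phi> \<psi>) c"
    using stage_handled Or.prems by blast
  then show ?case using Or.IH subfms_closed(2)[OF Or.prems(1)] by auto
next
  case (Ex \<phi>)
  obtain m v b where v: "stage (suc k) m v" and b: "has v (claim \<phi> (opr b c))"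
    using stage_handled[OF Ex.prems(2,1,3)] by auto
  then have "b \<in> branch_universe" using has_claim_mentions unfolding branch_universe_def by blast
  then show ?case using Ex.IH[OF _ v b] subfms_closed(4)[OF Ex.prems(1)] by auto
next
  case (All \<phi>)
  have "sat E F branch_universe (decode (opr b c)) \<phi>" if b: "b \<in> branch_universe" for b
  proof -
    obtain j n' u' where u': "stage j n' u'" "u \<sqsubseteq> u'" "b \<epsilon> n' \<or> mentions u' b"
      using stage_mentioning[OF All.prems(2) b] by blast
    then obtain m v where "stage (suc j) m v" "handled n' u' v (All \<phi>) c"
      using stage_handled All.prems(1,3) has_mono by blast
    then have "has v (claim \<phi> (opr b c))" using u'(3) unfolding handled_simps by blast
    then show ?thesis using All.IH subfms_closed(3)[OF All.prems(1)] \<open>stage (suc j) m v\<close> by blast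
  qed
  then show ?case by simp
qed (use stage_handled in fastforce)+

lemma branch_model:
  "\<exists>M. om \<sqsubseteq> M \<and> r \<epsilon> M \<and> sat E F {x. x \<epsilon> M} (decode (opr r emp)) \<Psi>"
proof -
  obtain M where M: "\<And>b. b \<epsilon> M \<longleftrightarrow> b \<in> branch_universe"
    using is_set_branch_universe unfolding is_set_def by blast
  obtain n u where u: "stage emp n u" "has u root_claim"
    using ex_stage[OF emp_om] node_root by blast
  have "r \<epsilon> M" using u has_claim_mentions unfolding M branch_universe_def by blast
  moreover have "om \<sqsubseteq> M" unfolding M branch_universe_def by blast
  moreover have "sat E F {x. x \<epsilon> M} (decode (opr r emp)) \<Psi>"
    unfolding M Collect_mem_eq by (rule branch_claim_true[OF subfms_refl u])
  ultimately show ?thesis by blast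
qed

end

lemma (in claim_tree) ex_branch_model:
  assumes "\<not> well_founded below"
  shows "\<exists>M. om \<sqsubseteq> M \<and> r \<epsilon> M \<and> sat E F {x. x \<epsilon> M} (decode (opr r emp)) \<Psi>"
proof -
  obtain w where w: "w \<noteq> emp" "\<And>x. x \<epsilon> w \<Longrightarrow> \<exists>y. y \<epsilon> w \<and> below y x \<and> \<not> y = x"
    using assms unfolding well_founded_def by blast
  have "Delta0 {r} (\<lambda>e. below (e 1) (e 0) \<and> \<not> e 1 = e 0)"
    by (intro definable_intros argument_intros Delta0_below)
  then have "Delta0 UNIV (\<lambda>e. below (e 1) (e 0) \<and> \<not> e 1 = e 0)" by (rule definable_mono) simp_all
  from dependent_choice_sequence[of "\<lambda>x y. below y x \<and> \<not> y = x", OF this w]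
  obtain f where "om_sequence f w" "\<forall>k x y. opr k x \<epsilon> f \<longrightarrow> opr (suc k) y \<epsilon> f \<longrightarrow> below y x \<and> \<not> y = x"
    by blast
  then interpret claim_branch E F \<Psi> r w f by unfold_locales blast+
  show ?thesis by (rule branch_model)
qed


section \<open>Collapse\<close>

lemma sat_isomorphic:
  assumes "set_fm \<phi>" "\<And>i. e i \<in> U"
    and hom: "\<And>x y. x \<in> U \<Longrightarrow> y \<in> U \<Longrightarrow> E (c x) (c y) \<longleftrightarrow> E x y" and inj: "inj_on c U"
  shows "sat E F (c ` U) (\<lambda>i. c (e i)) \<phi> \<longleftrightarrow> sat E F U e \<phi>"
  using assms(1,2)
proof (induction \<phi> arbitrary: e)
  case (All \<phi>)
  have "sat E F (c ` U) (c x ## (\<lambda>i. c (e i))) \<phi> \<longleftrightarrow> sat E F U (x ## e) \<phi>" if "x \<in> U" for x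
  proof -
    have "(x ## e) i \<in> U" for i using that All.prems(2) by (cases i) auto
    with All.IH[of "x ## e"] All.prems(1) show ?thesis by (simp add: comp_build[of c])
  qed
  then show ?case by simp
next
  case (Ex \<phi>)
  have "sat E F (c ` U) (c x ## (\<lambda>i. c (e i))) \<phi> \<longleftrightarrow> sat E F U (x ## e) \<phi>" if "x \<in> U" for x
  proof -
    have "(x ## e) i \<in> U" for i using that Ex.prems(2) by (cases i) auto
    with Ex.IH[of "x ## e"] Ex.prems(1) show ?thesis by (simp add: comp_build[of c])
  qed
  then show ?case by simp
qed (auto simp: is_Var_iff hom inj_on_eq_iff[OF inj])

lemma (in prs_model) ex_collapsing_function:
  "\<exists>c. prim_rec (\<lambda>e. c (e 0)) \<and> (\<forall>z v. v \<epsilon> c z \<longleftrightarrow> (\<exists>u. u \<epsilon> z \<and> u \<epsilon> M \<and> v = c u))"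
proof -
  let ?h = "\<lambda>w z (e :: nat \<Rightarrow> 'a). if z \<epsilon> M then ins emp w else emp"
  have "prim_rec (\<lambda>e. ?h (e 0) (e 1) (\<lambda>i. e (Suc (Suc i))))"
    by (intro prim_rec_if_mem prim_rec_ins prim_rec_const prim_rec_var)
  then obtain R where R: "prim_rec (\<lambda>e. R (e 0) (\<lambda>i. e (Suc i)))"
    and R_rec: "\<And>z e. \<exists>w. (\<forall>v. v \<epsilon> w \<longleftrightarrow> (\<exists>u. u \<epsilon> z \<and> v \<epsilon> R u e)) \<and> R z e = ?h w z e"
    using prim_rec_recursion[of ?h] by blast
  define p where "p z = R z (\<lambda>_. emp)" for z
  have "prim_rec (((\<lambda>e. e 0) ## (\<lambda>_ _. emp)) i)" for i
    by (cases i) (auto intro: prim_rec_var prim_rec_const)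
  with prim_rec_subst[OF R, of "(\<lambda>e. e 0) ## (\<lambda>_ _. emp)"] have "prim_rec (\<lambda>e. p (e 0))"
    by (simp add: p_def)
  then obtain g where g: "prim_rec g" "\<And>e v. v \<epsilon> g e \<longleftrightarrow> (\<exists>u. u \<epsilon> e 0 \<and> v \<epsilon> p u)"
    using prim_rec_Union[of "\<lambda>e. e 0" "\<lambda>u _. p u", OF prim_rec_var] by auto
  define c where "c z = g (\<lambda>_. z)" for z
  have c: "v \<epsilon> c z \<longleftrightarrow> (\<exists>u. u \<epsilon> z \<and> v \<epsilon> p u)" for v z by (simp add: c_def g(2))
  have "v \<epsilon> p u \<longleftrightarrow> u \<epsilon> M \<and> v = c u" for u v
  proof -
    obtain w where w: "\<forall>v. v \<epsilon> w \<longleftrightarrow> (\<exists>x. x \<epsilon> u \<and> v \<epsilon> p x)" "p u = (if u \<epsilon> M then ins emp w else emp)"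
      using R_rec[of u "\<lambda>_. emp"] unfolding p_def by blast
    have "w = c u" using w(1) c by (intro ext) blast
    then show ?thesis using w(2) by auto
  qed
  then have "\<forall>z v. v \<epsilon> c z \<longleftrightarrow> (\<exists>u. u \<epsilon> z \<and> u \<epsilon> M \<and> v = c u)" using c by blast
  moreover have "prim_rec (\<lambda>e. c (e 0))"
    unfolding c_def by (rule prim_rec_subst[OF g(1) prim_rec_var])
  ultimately show ?thesis by blast
qed

locale collapse = inductive_model E F
  for E :: "'a \<Rightarrow> 'a \<Rightarrow> bool" (infix "\<epsilon>" 50) and F +
  fixes M :: 'a and c :: "'a \<Rightarrow> 'a"
  assumes prim_rec_collapse: "prim_rec (\<lambda>e. c (e 0))"
    and in_collapse: "v \<epsilon> c z \<longleftrightarrow> (\<exists>u. u \<epsilon> z \<and> u \<epsilon> M \<and> v = c u)"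
    and extensional: "x \<epsilon> M \<Longrightarrow> y \<epsilon> M \<Longrightarrow> (\<And>z. z \<epsilon> M \<Longrightarrow> z \<epsilon> x \<longleftrightarrow> z \<epsilon> y) \<Longrightarrow> x = y"
begin

lemma prim_rec_collapse_var: "prim_rec (\<lambda>e. c (e i))"
  using prim_rec_subst[OF prim_rec_collapse, of "\<lambda>_ e. e i"] by (simp add: prim_rec_var)

lemma collapse_inj:
  assumes "x \<epsilon> M" "y \<epsilon> M" "c x = c y" shows "x = y"
proof (rule ccontr)
  assume "x \<noteq> y"
  let ?P = "\<lambda>x. \<exists>y. y \<epsilon> M \<and> (c x = c y \<and> \<not> x = y)"
  have "prim_rec_pred (\<lambda>e. ?P (e 0))"
    by (intro prim_rec_pred_bex prim_rec_pred_conj prim_rec_pred_not prim_rec_pred_eq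
        prim_rec_collapse_var prim_rec_var prim_rec_const)
  from ex_minimal[OF this \<open>x \<epsilon> M\<close>] obtain a where a: "a \<epsilon> M" "?P a"
    and minimal: "\<forall>z. z \<epsilon> M \<longrightarrow> ?P z \<longrightarrow> \<not> z \<epsilon> a"
    using assms \<open>x \<noteq> y\<close> by blast
  then obtain b where b: "b \<epsilon> M" "c a = c b" "a \<noteq> b" by blast
  have unique: "u = z" if "z \<epsilon> a \<or> u \<epsilon> a" "z \<epsilon> M" "u \<epsilon> M" "c z = c u" for z u
    using minimal that by metis
  have "z \<epsilon> a \<longleftrightarrow> z \<epsilon> b" if "z \<epsilon> M" for z
  proof
    assume z: "z \<epsilon> a"
    then have "c z \<epsilon> c b" using in_collapse[of "c z" a] b(2) \<open>z \<epsilon> M\<close> by auto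
    then obtain u where u: "u \<epsilon> b" "u \<epsilon> M" "c z = c u" using in_collapse by blast
    then have "u = z" using unique z \<open>z \<epsilon> M\<close> by blast
    then show "z \<epsilon> b" using u(1) by simp
  next
    assume z: "z \<epsilon> b"
    then have "c z \<epsilon> c a" using in_collapse[of "c z" b] b(2) \<open>z \<epsilon> M\<close> by auto
    then obtain u where u: "u \<epsilon> a" "u \<epsilon> M" "c z = c u" using in_collapse by blast
    then have "u = z" using unique \<open>z \<epsilon> M\<close> by blast
    then show "z \<epsilon> a" using u(1) by simp
  qed
  then show False using extensional a(1) b(1,3) by blast
qed

lemma collapse_mem_iff: "x \<epsilon> M \<Longrightarrow> y \<epsilon> M \<Longrightarrow> c x \<epsilon> c y \<longleftrightarrow> x \<epsilon> y"
  using in_collapse[of "c x" y] collapse_inj by blast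

lemma collapse_eq_self:
  assumes "\<And>v. v \<epsilon> z \<Longrightarrow> v \<epsilon> M \<and> c v = v" shows "c z = z"
proof (rule prs_model.ext[OF prs_model_axioms])
  show "v \<epsilon> c z \<longleftrightarrow> v \<epsilon> z" for v unfolding in_collapse using assms by auto
qed

lemma collapse_nat:
  assumes "om \<sqsubseteq> M" "n \<epsilon> om" shows "c n = n"
proof (rule ccontr)
  assume "c n \<noteq> n"
  have "prim_rec_pred (\<lambda>e. \<not> c (e 0) = e 0)"
    by (intro prim_rec_pred_not prim_rec_pred_eq prim_rec_collapse_var prim_rec_var)
  from ex_minimal[of "\<lambda>n. c n \<noteq> n", OF this assms(2) \<open>c n \<noteq> n\<close>]
  obtain k where k: "k \<epsilon> om" "c k \<noteq> k" "\<forall>z. z \<epsilon> om \<longrightarrow> c z \<noteq> z \<longrightarrow> \<not> z \<epsilon> k" by blast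
  then have "c k = k" using om_transitive[OF k(1)] assms(1) by (intro collapse_eq_self) blast
  with k(2) show False ..
qed

lemma transitive_model:
  assumes om: "om \<sqsubseteq> M" and r: "r \<sqsubseteq> om" "r \<epsilon> M"
    and \<psi>: "set_fm \<psi>" "sat E F {x. x \<epsilon> M} (\<lambda>_. r) \<psi>"
  shows "\<exists>N. transitive_set N \<and> sat E F {x. x \<epsilon> N} (\<lambda>_. r) \<psi>"
proof -
  obtain N where N: "\<And>v. v \<epsilon> N \<longleftrightarrow> (\<exists>u. u \<epsilon> M \<and> v = c u)"
    using is_set_image[OF prim_rec_collapse] unfolding is_set_def by blast
  have "c r = r" using collapse_nat[OF om] om r(1) by (intro collapse_eq_self) blast
  moreover have "inj_on c {x. x \<epsilon> M}" using collapse_inj by (intro inj_onI) simp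
  ultimately have "sat E F (c ` {x. x \<epsilon> M}) (\<lambda>_. r) \<psi>"
    using sat_isomorphic[of \<psi> "\<lambda>_. r" "{x. x \<epsilon> M}" E c F] \<psi> r(2) collapse_mem_iff by simp
  moreover have "c ` {x. x \<epsilon> M} = {x. x \<epsilon> N}" using N by auto
  moreover have "transitive_set N" unfolding transitive_set_def N using in_collapse by blast
  ultimately show ?thesis by auto
qed

end


section \<open>Induction implies reflection\<close>

definition Extensional :: fm where
  "Extensional = All (All (Or (Eq (Var 1) (Var 0))
    (Or (Ex (And (Mem (Var 0) (Var 2)) (NMem (Var 0) (Var 1))))
        (Ex (And (NMem (Var 0) (Var 2)) (Mem (Var 0) (Var 1)))))))"

lemma sat_Extensional:
  "sat E F U e Extensional \<longleftrightarrow> (\<forall>x\<in>U. \<forall>y\<in>U. (\<forall>z\<in>U. E z x \<longleftrightarrow> E z y) \<longrightarrow> x = y)"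
  by (simp add: Extensional_def numeral_2_eq_2) blast

context inductive_model
begin

lemma ex_extensional_model:
  assumes \<psi>: "set_fm \<psi>" "fv_below 1 \<psi>" "sat E F UNIV (\<lambda>_. r) \<psi>" and r: "r \<sqsubseteq> om"
  shows "\<exists>M. om \<sqsubseteq> M \<and> r \<epsilon> M \<and> sat E F {x. x \<epsilon> M} (\<lambda>_. r) (And \<psi> Extensional)"
proof -
  let ?\<Psi> = "And \<psi> Extensional"
  interpret claim_tree E F ?\<Psi> r
    by unfold_locales (use \<psi>(1) r in \<open>simp_all add: Extensional_def\<close>)
  have "fv_below 1 ?\<Psi>" using \<psi>(2) by (simp add: Extensional_def)
  then have decode: "sat E F U (decode (opr r emp)) ?\<Psi> \<longleftrightarrow> sat E F U (\<lambda>_. r) ?\<Psi>" for U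
    using sat_conc_cong[of "[r]" ?\<Psi> E F U "decode emp" "\<lambda>_. r"] by simp
  have "sat E F UNIV (\<lambda>_. r) Extensional"
    unfolding sat_Extensional using prs_model.ext[OF prs_model_axioms] by blast
  then have "sat E F UNIV (decode (opr r emp)) ?\<Psi>" unfolding decode using \<psi>(3) by simp
  then have "\<not> well_founded below" by (rule not_well_founded)
  then show ?thesis using ex_branch_model unfolding decode by blast
qed

theorem Reflection:
  assumes "\<chi> \<in> Reflection"
  shows "sat E F UNIV e \<chi>"
proof -
  obtain \<psi> where \<chi>: "\<chi> = reflection \<psi>" and \<psi>: "set_fm \<psi>" "fv_below 1 \<psi>"
    using assms Reflection_iff by blast
  have "\<exists>N. transitive_set N \<and> sat E F {x. x \<epsilon> N} (\<lambda>_. r) \<psi>"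
    if r: "r \<sqsubseteq> om" and sat: "sat E F UNIV (\<lambda>_. r) \<psi>" for r
  proof -
    obtain M where M: "om \<sqsubseteq> M" "r \<epsilon> M" "sat E F {x. x \<epsilon> M} (\<lambda>_. r) \<psi>"
      "sat E F {x. x \<epsilon> M} (\<lambda>_. r) Extensional"
      using ex_extensional_model[OF \<psi> sat r] by auto
    obtain c where c: "prim_rec (\<lambda>e. c (e 0))" "\<And>z v. v \<epsilon> c z \<longleftrightarrow> (\<exists>u. u \<epsilon> z \<and> u \<epsilon> M \<and> v = c u)"
      using ex_collapsing_function by blast
    interpret collapse E F M c
      by unfold_locales (use c M(4) in \<open>auto simp: sat_Extensional\<close>)
    show ?thesis using M r \<psi>(1) by (intro transitive_model)
  qed
  then show ?thesis unfolding \<chi> sat_reflection[OF \<psi>(2)] by blast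
qed

end


section \<open>The equivalence\<close>

lemma PRS_DC_completeness:
  assumes T: "\<And>\<phi>. \<phi> \<in> T \<Longrightarrow> sentence \<phi>" and \<chi>: "sentence \<chi>"
    and valid: "\<And>(E :: nat \<Rightarrow> nat \<Rightarrow> bool) F e.
      (\<And>\<phi> e. \<phi> \<in> PRS_DC \<union> T \<Longrightarrow> sat E F UNIV e \<phi>) \<Longrightarrow> sat E F UNIV e \<chi>"
  shows "PRS_DC \<union> T \<turnstile> \<chi>"
proof (rule completeness[OF _ _ _ _ _ valid])
  show "regularity \<in> PRS_DC \<union> T" "defining_axiom Zero \<in> PRS_DC \<union> T"
    "defining_axiom Adj \<in> PRS_DC \<union> T"
    by (auto simp: PRS_DC_def PRS_def intro: exI[of _ Zero] exI[of _ Adj])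
  show "\<forall>\<phi>\<in>PRS_DC \<union> T. wf_fm \<phi> \<and> fv \<phi> = {}"
    using T sentence_PRS_DC unfolding sentence_def fv_empty_iff by blast
  show "wf_fm \<chi>" using \<chi> by (simp add: sentence_def)
qed

lemma sentence_schemas: "\<chi> \<in> Reflection \<union> Class_Induction \<Longrightarrow> sentence \<chi>"
  by (auto simp: Reflection_iff Class_Induction_iff
      intro: sentence_reflection sentence_class_induction)

theorem theorem3p5:
  shows "(\<forall>\<chi>\<in>Class_Induction. PRS_DC \<union> Reflection \<turnstile> \<chi>) \<and>
         (\<forall>\<chi>\<in>Reflection. PRS_DC \<union> Class_Induction \<turnstile> \<chi>)"
proof (intro conjI ballI)
  fix \<chi> assume \<chi>: "\<chi> \<in> Class_Induction"
  show "PRS_DC \<union> Reflection \<turnstile> \<chi>"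
  proof (rule PRS_DC_completeness)
    fix E :: "nat \<Rightarrow> nat \<Rightarrow> bool" and F e
    assume "\<And>\<phi> e. \<phi> \<in> PRS_DC \<union> Reflection \<Longrightarrow> sat E F UNIV e \<phi>"
    then interpret reflecting_model E F by unfold_locales (auto simp: PRS_DC_def)
    show "sat E F UNIV e \<chi>" using \<chi> by (rule Class_Induction)
  qed (use \<chi> sentence_schemas in auto)
next
  fix \<chi> assume \<chi>: "\<chi> \<in> Reflection"
  show "PRS_DC \<union> Class_Induction \<turnstile> \<chi>"
  proof (rule PRS_DC_completeness)
    fix E :: "nat \<Rightarrow> nat \<Rightarrow> bool" and F e
    assume "\<And>\<phi> e. \<phi> \<in> PRS_DC \<union> Class_Induction \<Longrightarrow> sat E F UNIV e \<phi>"
    then interpret inductive_model E F by unfold_locales (auto simp: PRS_DC_def)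
    show "sat E F UNIV e \<chi>" using \<chi> by (rule Reflection)
  qed (use \<chi> sentence_schemas in auto)
qed

end
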